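(* Let $\beta,\gamma,\mu>-\tfrac12$ and $\alpha=\beta+\mu+\frac{d-1}2$. For $n=1,2,\ldots$ and $(x,t),(y,s)\in\mathbb V^{d+1}$, $$\mathbf P_n^O\big(W_{\beta,\gamma,\mu};(x,t),(y,s)\big)=\frac{\alpha+\gamma+1}{\alpha+\frac12}\,s\,t\;\mathbf P_{n-1}^E\big(W_{\beta+1,\gamma,\mu};(x,t),(y,s)\big).$$ Furthermore, for $\beta\ge\frac12$, $\gamma,\mu\ge0$ and $n=0,1,2,\ldots$, $$\mathbf P_n^E\big(W_{\beta,\gamma,\mu};(x,t),(y,s)\big)=c\int_{[-1,1]^4}Z_n^{\alpha+\gamma}\big(\zeta(x,t,y,s;u,v,z)\big)(1-z_1)^{\mu+\frac{d-1}2}(1+z_1)^{\beta-\frac32}(1-z_2^2)^{\beta-1}(1-v^2)^{\gamma-1}(1-u^2)^{\mu-1}\,du\,dv\,dz,$$ where $z=(z_1,z_2)$, $c=c_{\mu+\frac{d-1}2,\beta-\frac32}\,c_{\beta-\frac12}\,c_{\gamma-\frac12}\,c_{\mu-\frac12}$ and $$\zeta(x,t,y,s;u,v,z)=\frac{1-z_1}2\Big(\langle x,y\rangle+u\sqrt{t^2-\|x\|^2}\sqrt{s^2-\|y\|^2}\Big)\mathrm{sign}(st)+\frac{1+z_1}2z_2\,st+v\sqrt{1-s^2}\sqrt{1-t^2}.$$ The formula holds under the limit if $\beta=\frac12$ or either one of $\gamma$ and $\mu$ is $0$.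
   Context: $\mathbb V^{d+1}=\{(x,t)\in\mathbb R^d\times\mathbb R:\ \|x\|\le|t|,\ -1\le t\le1\}$ is the solid double cone, $W_{\beta,\gamma,\mu}(x,t)=|t|^{2\beta}(1-t^2)^{\gamma-\frac12}(t^2-\|x\|^2)^{\mu-\frac12}$, and $\langle f,g\rangle_{W}=b_W\int_{\mathbb V^{d+1}}f\,g\,W\,dx\,dt$ with $b_W$ chosen so that $\langle1,1\rangle_W=1$. $\mathcal V_n^E$ (resp. $\mathcal V_n^O$) is the space of polynomials in $(x,t)$ of degree at most $n$ that are even (resp. odd) in $t$ and orthogonal to all polynomials of degree at most $n-1$ with respect to $\langle\cdot,\cdot\rangle_W$; $\mathbf P_n^E(W;\cdot,\cdot)$ and $\mathbf P_n^O(W;\cdot,\cdot)$ are the reproducing kernels of these spaces with respect to $\langle\cdot,\cdot\rangle_W$. $Z_n^\lambda(t)=\frac{n+\lambda}\lambda C_n^\lambda(t)$ for $\lambda>0$, with $C_n^\lambda$ the Gegenbauer polynomial. Constants: $c_\lambda=\frac{\Gamma(\lambda+1)}{\Gamma(\frac12)\Gamma(\lambda+\frac12)}$ and $c_{a,b}=\frac{\Gamma(a+b+2)}{\Gamma(a+1)\Gamma(b+1)}$.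
   Formalization: The integral formula is proved with the extra factor 2^{1/2-α} (as printed, n=0 gives 1=2^{α-1/2}); for n odd and st<0, where sign(st) gives the wrong sign, it is taken at (x,|t|),(y,|s|); for d=1 the first identity assumes α>-1/2, needed for b_W to exist. *)

theory Defs
  imports "HOL-Analysis.Analysis"
begin

definition double_cone :: "((real ^ 'd) \<times> real) set" where
  "double_cone = {(x, t). norm x \<le> \<bar>t\<bar> \<and> -1 \<le> t \<and> t \<le> 1}"

(* Only used on the double cone, where all bases of powr are nonnegative.  The points where a
   base vanishes, at which powr takes the value 0, form a null set. *)
definition cone_weight :: "real \<Rightarrow> real \<Rightarrow> real \<Rightarrow> (real ^ 'd) \<times> real \<Rightarrow> real" where
  "cone_weight \<beta> \<gamma> \<mu> = (\<lambda>(x, t).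
     \<bar>t\<bar> powr (2 * \<beta>) * (1 - t\<^sup>2) powr (\<gamma> - 1/2) * (t\<^sup>2 - (norm x)\<^sup>2) powr (\<mu> - 1/2))"

definition cone_inner ::
  "((real ^ 'd) \<times> real \<Rightarrow> real) \<Rightarrow> ((real ^ 'd) \<times> real \<Rightarrow> real) \<Rightarrow> ((real ^ 'd) \<times> real \<Rightarrow> real) \<Rightarrow> real" where
  "cone_inner W f g =
     (1 / (LINT p:double_cone|lborel. W p)) * (LINT p:double_cone|lborel. f p * g p * W p)"

(* Polynomial functions in (x, t) of total degree at most n; the monomial
   x_1^k_1 ... x_d^k_d t^m is indexed by (k, m). *)
definition poly_deg_le :: "nat \<Rightarrow> ((real ^ 'd) \<times> real \<Rightarrow> real) set" where
  "poly_deg_le n = {f. \<exists>c :: ('d \<Rightarrow> nat) \<times> nat \<Rightarrow> real. \<forall>x t.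
     f (x, t) = (\<Sum>(k, m) \<in> {(k, m). (\<Sum>i\<in>UNIV. k i) + m \<le> n}.
                   c (k, m) * (\<Prod>i\<in>UNIV. (x $ i) ^ k i) * t ^ m)}"

(* "Orthogonal to all polynomials of degree at most n - 1" is expressed by quantifying over
   all degrees m < n, so that for n = 0 the condition is void. *)
definition orth_poly ::
  "((real ^ 'd) \<times> real \<Rightarrow> real) \<Rightarrow> nat \<Rightarrow> ((real ^ 'd) \<times> real \<Rightarrow> real) set" where
  "orth_poly W n = {f \<in> poly_deg_le n. \<forall>m<n. \<forall>q\<in>poly_deg_le m. cone_inner W f q = 0}"

definition orth_poly_even ::
  "((real ^ 'd) \<times> real \<Rightarrow> real) \<Rightarrow> nat \<Rightarrow> ((real ^ 'd) \<times> real \<Rightarrow> real) set" where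
  "orth_poly_even W n = {f \<in> orth_poly W n. \<forall>x t. f (x, - t) = f (x, t)}"

definition orth_poly_odd ::
  "((real ^ 'd) \<times> real \<Rightarrow> real) \<Rightarrow> nat \<Rightarrow> ((real ^ 'd) \<times> real \<Rightarrow> real) set" where
  "orth_poly_odd W n = {f \<in> orth_poly W n. \<forall>x t. f (x, - t) = - f (x, t)}"

definition is_reproducing_kernel ::
  "(('a \<Rightarrow> real) \<Rightarrow> ('a \<Rightarrow> real) \<Rightarrow> real) \<Rightarrow> ('a \<Rightarrow> real) set \<Rightarrow> ('a \<Rightarrow> 'a \<Rightarrow> real) \<Rightarrow> bool" where
  "is_reproducing_kernel ip V K \<longleftrightarrow>
     (\<forall>q. (\<lambda>p. K p q) \<in> V) \<and> (\<forall>q. \<forall>f\<in>V. ip f (\<lambda>p. K p q) = f q)"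

definition reproducing_kernel ::
  "(('a \<Rightarrow> real) \<Rightarrow> ('a \<Rightarrow> real) \<Rightarrow> real) \<Rightarrow> ('a \<Rightarrow> real) set \<Rightarrow> ('a \<Rightarrow> 'a \<Rightarrow> real)" where
  "reproducing_kernel ip V = (THE K. is_reproducing_kernel ip V K)"

definition kernel_even ::
  "nat \<Rightarrow> ((real ^ 'd) \<times> real \<Rightarrow> real) \<Rightarrow> (real ^ 'd) \<times> real \<Rightarrow> (real ^ 'd) \<times> real \<Rightarrow> real" where
  "kernel_even n W = reproducing_kernel (cone_inner W) (orth_poly_even W n)"

definition kernel_odd ::
  "nat \<Rightarrow> ((real ^ 'd) \<times> real \<Rightarrow> real) \<Rightarrow> (real ^ 'd) \<times> real \<Rightarrow> (real ^ 'd) \<times> real \<Rightarrow> real" where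
  "kernel_odd n W = reproducing_kernel (cone_inner W) (orth_poly_odd W n)"

definition gegenbauer :: "nat \<Rightarrow> real \<Rightarrow> real \<Rightarrow> real" where
  "gegenbauer n l t = (\<Sum>k\<le>n div 2.
     (-1) ^ k * pochhammer l (n - k) / (fact k * fact (n - 2 * k)) * (2 * t) ^ (n - 2 * k))"

definition Z_poly :: "nat \<Rightarrow> real \<Rightarrow> real \<Rightarrow> real" where
  "Z_poly n l t = (real n + l) / l * gegenbauer n l t"

definition c_geg :: "real \<Rightarrow> real" where
  "c_geg l = Gamma (l + 1) / (Gamma (1/2) * Gamma (l + 1/2))"

definition c_jac :: "real \<Rightarrow> real \<Rightarrow> real" where
  "c_jac a b = Gamma (a + b + 2) / (Gamma (a + 1) * Gamma (b + 1))"

definition alpha :: "nat \<Rightarrow> real \<Rightarrow> real \<Rightarrow> real" where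
  "alpha d \<beta> \<mu> = \<beta> + \<mu> + (real d - 1) / 2"

definition zeta ::
  "real ^ 'd \<Rightarrow> real \<Rightarrow> real ^ 'd \<Rightarrow> real \<Rightarrow> real \<Rightarrow> real \<Rightarrow> real \<Rightarrow> real \<Rightarrow> real" where
  "zeta x t y s u v z1 z2 =
     (1 - z1) / 2 * (x \<bullet> y + u * sqrt (t\<^sup>2 - (norm x)\<^sup>2) * sqrt (s\<^sup>2 - (norm y)\<^sup>2)) * sgn (s * t)
     + (1 + z1) / 2 * z2 * (s * t)
     + v * sqrt (1 - s\<^sup>2) * sqrt (1 - t\<^sup>2)"

(* The constants c_geg are normalizing for the weights in u, v and z2, but for a, b > -1
     c_jac a b * (\<integral> over [-1,1] of (1 - z)^a (1 + z)^b dz) = 2^(a + b + 1),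
   and a + b + 1 = alpha - 1/2 for the exponents a = \<mu> + (d-1)/2 and b = \<beta> - 3/2 of the weight
   in z1.  Hence kernel_integral 0 has the constant value 2^(alpha - 1/2), and it has to be multiplied
   by 2^(1/2 - alpha) to give the reproducing kernel, which is 1 for n = 0.

   The factor sgn (s * t) in zeta multiplies kernel_integral by -1 if n is odd and s * t < 0 (replace
   (v, z2) by (-v, -z2)), whereas the even kernel does not change under t \<mapsto> -t or s \<mapsto> -s.  In that case
   kernel_integral represents the even kernel only when it is taken at (x, |t|), (y, |s|). *)
definition kernel_integral ::
  "nat \<Rightarrow> real \<Rightarrow> real \<Rightarrow> real \<Rightarrow> (real ^ 'd) \<times> real \<Rightarrow> (real ^ 'd) \<times> real \<Rightarrow> real" where
  "kernel_integral n \<beta> \<gamma> \<mu> = (\<lambda>(x, t) (y, s).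
     c_jac (\<mu> + (real CARD('d) - 1) / 2) (\<beta> - 3/2) * c_geg (\<beta> - 1/2) * c_geg (\<gamma> - 1/2) * c_geg (\<mu> - 1/2) *
     (LINT (u, v, z1, z2):{-1..1} \<times> {-1..1} \<times> {-1..1} \<times> {-1..1}|lborel.
        Z_poly n (alpha CARD('d) \<beta> \<mu> + \<gamma>) (zeta x t y s u v z1 z2)
        * (1 - z1) powr (\<mu> + (real CARD('d) - 1) / 2) * (1 + z1) powr (\<beta> - 3/2)
        * (1 - z2\<^sup>2) powr (\<beta> - 1) * (1 - v\<^sup>2) powr (\<gamma> - 1) * (1 - u\<^sup>2) powr (\<mu> - 1)))"

(* For \<beta> \<ge> 1/2 and \<gamma>, \<mu> \<ge> 0: the identity v = F \<beta> \<gamma> \<mu> if all exponents of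
   the weights in kernel_integral exceed -1, and v as the limit of F from that parameter region if some
   exponent equals -1 (that is, \<beta> = 1/2, \<gamma> = 0 or \<mu> = 0). *)
definition holds_under_limit ::
  "(real \<Rightarrow> real \<Rightarrow> real \<Rightarrow> real) \<Rightarrow> real \<Rightarrow> real \<Rightarrow> real \<Rightarrow> real \<Rightarrow> bool" where
  "holds_under_limit F \<beta> \<gamma> \<mu> v \<longleftrightarrow>
     (if \<beta> > 1/2 \<and> \<gamma> > 0 \<and> \<mu> > 0 then v = F \<beta> \<gamma> \<mu>
      else ((\<lambda>(b, g, m). F b g m) \<longlongrightarrow> v)
             (at (\<beta>, \<gamma>, \<mu>) within {1/2<..} \<times> {0<..} \<times> {0<..}))"

end

theory Submission
  imports Defs "HOL-Probability.Distributions"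
begin

text \<open>Write \<open>E\<close> for the average over \<open>(u, v, z)\<close>, so that the claim is that \<open>E Z\<^sub>n(\<zeta>)\<close> reproduces the even
  space. Expanding \<open>Z\<^sub>n\<close> in powers leads to \<open>E\<^sub>k(p, q) = E \<zeta>\<^sup>k / k!\<close>, a polynomial in \<open>\<langle>x, y\<rangle>\<close>,
  \<open>(t\<^sup>2 - |x|\<^sup>2)(s\<^sup>2 - |y|\<^sup>2)\<close>, \<open>t\<^sup>2 s\<^sup>2\<close> and \<open>(1 - t\<^sup>2)(1 - s\<^sup>2)\<close> that plays the role of \<open>\<langle>p, q\<rangle>\<^sup>k / k!\<close> on a
  sphere. For a Gaussian measure, the integral of \<open>f(p) exp \<langle>p, q\<rangle>\<close> is \<open>exp (|q|\<^sup>2 / 2)\<close> times a polynomial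
  with leading part \<open>f\<close>. Moments of the cone weight differ from Gaussian moments by Gamma factors only, and
  the effect of \<open>z\<close> is absorbed by a Rothe--Hagen convolution identity; hence for an even polynomial \<open>f\<close>
  of degree \<open>j\<close> the inner product of \<open>f\<close> and \<open>E\<^sub>k(\<cdot>, q)\<close> is, up to an explicit factor, the sum of
  \<open>F\<^sub>a(q) / ((k - j) / 2 + a)!\<close> over \<open>a\<close>, with \<open>F\<^sub>0 = f\<close> and \<open>F\<^sub>a\<close> independent of \<open>k\<close>. A finite difference
  identity for the coefficients of \<open>Z\<^sub>n\<close> makes the sum over \<open>k\<close> vanish if \<open>j < n\<close>. If \<open>f\<close> has degree \<open>n\<close>
  and is orthogonal to lower degrees, then \<open>F\<^sub>a = 0\<close> for \<open>a > 0\<close>, and the sum is \<open>f(q)\<close>. The resulting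
  polynomial kernel depends continuously on the parameters, which gives the limit cases. The odd
  kernel is obtained from the even one because the odd polynomials are \<open>t\<close> times the even ones and
  \<open>t\<^sup>2\<close> raises \<open>\<beta>\<close> by one.\<close>

text \<open>For \<beta> = 1/2 and integers 2\<mu> + 1, 2\<gamma> + 1 \<ge> 2 the weight is the image
  of surface measure on a unit sphere: (x, t) lifts to (x, sqrt(t^2 - |x|^2) xi, sqrt(1 - t^2) eta)
  with unit vectors xi, eta of dimensions 2\<mu> + 1 and 2\<gamma> + 1. Averaging over xi and eta
  yields the variables u and v, and the total dimension 2(\<alpha> + \<gamma> + 1) explains the
  Gegenbauer index \<alpha> + \<gamma>. The function t^2 lifts to a polynomial of the same degree, t
  does not; hence the even space is the natural one. For other parameters there is no sphere and
  only moments survive, with half-dimensions \<theta> = \<mu> + (d + 1)/2 of the block (x, xi) and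
  \<theta> + \<delta> = \<alpha> + 1/2, \<delta> = \<beta> - 1/2. The shift by \<delta> spoils the
  match between moments and power series coefficients; the z average repairs it through
  \<open>hagen j \<delta>\<close>, which is 0 for j > 0 at \<beta> = 1/2. The relation |q| = 1
  survives in the form that |y|^2, s^2 - |y|^2 and 1 - s^2 add up to 1.\<close>

section \<open>A convolution identity of Rothe--Hagen type\<close>

text \<open>With \<open>B = 1 + z B\<^sup>2\<close>, these are the coefficients of \<open>z\<^sup>j\<close> in \<open>B\<close> to the power \<open>\<delta>\<close>; below, \<open>shifted \<phi> b\<close> is
  the coefficient of \<open>z\<^sup>b\<close> in \<open>B\<close> to the power \<open>\<phi> - 1\<close> divided by \<open>sqrt (1 - 4 z)\<close>.\<close>

definition hagen :: "nat \<Rightarrow> real \<Rightarrow> real" where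
  "hagen j \<delta> = (if j = 0 then 1 else \<delta> * pochhammer (\<delta> + real j + 1) (j - 1) / fact j)"

text \<open>The quotient is what averaging over z produces (see
  \<open>exp_cone_conv_moments\<close>); the product form in \<open>hagen\<close> is visibly a
  polynomial in \<delta>, which \<open>rothe_hagen\<close> and the limits in the parameters rely
  on.\<close>

lemma hagen_conv_pochhammer:
  assumes "\<delta> \<ge> 0"
  shows "hagen j \<delta> = pochhammer \<delta> (2 * j) / (fact j * pochhammer (\<delta> + 1) j)"
proof (cases j)
  case (Suc i)
  have "pochhammer \<delta> (2 * j) = \<delta> * pochhammer (\<delta> + 1) (j + i)"
    using pochhammer_rec[of \<delta> "j + i"] Suc by (simp add: mult_2)
  also have "pochhammer (\<delta> + 1) (j + i) = pochhammer (\<delta> + 1) j * pochhammer (\<delta> + real j + 1) i"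
    using pochhammer_product'[of "\<delta> + 1" j i] by (simp add: algebra_simps)
  finally have *: "pochhammer \<delta> (2 * j) = \<delta> * (pochhammer (\<delta> + 1) j * pochhammer (\<delta> + real j + 1) i)" .
  have "pochhammer (\<delta> + 1) j \<noteq> 0" using pochhammer_pos[of "\<delta> + 1" j] assms by simp
  with * show ?thesis using Suc by (simp add: hagen_def)
qed (simp add: hagen_def)

text \<open>Coefficient form of B = 1 + z B^2 multiplied by B to the power \<delta>.\<close>

lemma hagen_add_one: "hagen (Suc j) (\<delta> + 1) = hagen (Suc j) \<delta> + hagen j (\<delta> + 2)"
proof (cases j)
  case (Suc i)
  define A where "A = pochhammer (\<delta> + real i + 4) i"
  have "pochhammer (\<delta> + 1 + real (Suc j) + 1) j = A * (\<delta> + real i + 4 + real i)"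
    unfolding A_def Suc by (simp add: pochhammer_Suc algebra_simps)
  moreover have "pochhammer (\<delta> + real (Suc j) + 1) j = (\<delta> + real i + 3) * A"
    unfolding A_def Suc by (subst pochhammer_rec) (simp add: algebra_simps)
  moreover have "pochhammer (\<delta> + 2 + real j + 1) (j - 1) = A"
    unfolding A_def Suc by (simp add: algebra_simps)
  ultimately have "hagen (Suc j) (\<delta> + 1) = (\<delta> + 1) * (A * (\<delta> + real i + 4 + real i)) / fact (Suc j)"
    "hagen (Suc j) \<delta> = \<delta> * ((\<delta> + real i + 3) * A) / fact (Suc j)"
    "hagen j (\<delta> + 2) = (\<delta> + 2) * A / fact j"
    using Suc by (simp_all add: hagen_def)
  moreover have "(\<delta> + 2) * A / fact j = (real (Suc j) * ((\<delta> + 2) * A)) / fact (Suc j)"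
    by (simp del: of_nat_Suc)
  moreover have "(\<delta> + 1) * (A * (\<delta> + real i + 4 + real i)) =
      \<delta> * ((\<delta> + real i + 3) * A) + real (Suc j) * ((\<delta> + 2) * A)"
    using Suc by (simp add: algebra_simps)
  ultimately show ?thesis by (simp only: add_divide_distrib)
qed (simp add: hagen_def)

text \<open>The factor left by the moments over the inner ball for the a-th term of the Gaussian
  expansion, divided by b!. For a = 0 it is \<open>shifted\<close>; larger a is reached through
  \<open>central_rec\<close>.\<close>

definition central :: "nat \<Rightarrow> real \<Rightarrow> nat \<Rightarrow> real" where
  "central a \<phi> b = pochhammer \<phi> (2 * b) / (pochhammer \<phi> (a + b) * fact b)"

definition shifted :: "real \<Rightarrow> nat \<Rightarrow> real" where
  "shifted \<phi> b = pochhammer (\<phi> + real b) b / fact b"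

lemma central_0: "\<phi> > 0 \<Longrightarrow> central 0 \<phi> b = shifted \<phi> b"
  using pochhammer_pos[of \<phi> b]
  by (simp add: central_def shifted_def mult_2 pochhammer_product')

text \<open>Again B = 1 + z B^2, now multiplied by B to the power \<phi> - 1 over sqrt(1 - 4
  z).\<close>

lemma shifted_add_one: "shifted (\<phi> + 1) (Suc b) = shifted \<phi> (Suc b) + shifted (\<phi> + 2) b"
proof -
  define A where "A = pochhammer (\<phi> + real b + 2) b"
  have "pochhammer (\<phi> + 1 + real (Suc b)) (Suc b) = A * (\<phi> + 2 * real b + 2)"
    unfolding A_def by (simp add: pochhammer_Suc algebra_simps)
  moreover have "pochhammer (\<phi> + real (Suc b)) (Suc b) = (\<phi> + real b + 1) * A"
    unfolding A_def by (subst pochhammer_rec) (simp add: algebra_simps)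
  moreover have "pochhammer (\<phi> + 2 + real b) b = A"
    unfolding A_def by (simp add: algebra_simps)
  moreover have "A / fact b = real (Suc b) * A / fact (Suc b)" by (simp del: of_nat_Suc)
  moreover have "A * (\<phi> + 2 * real b + 2) = (\<phi> + real b + 1) * A + real (Suc b) * A"
    by (simp add: algebra_simps)
  ultimately show ?thesis unfolding shifted_def by (simp only: add_divide_distrib)
qed

lemma poly_fun_pochhammer: "\<exists>p::real poly. \<forall>x. poly p x = pochhammer (x + c) n"
proof (induction n)
  case 0
  show ?case by (rule exI[of _ 1]) simp
next
  case (Suc n)
  then obtain p :: "real poly" where p: "\<And>x. poly p x = pochhammer (x + c) n" by blast
  show ?case
    by (rule exI[of _ "p * [:c + real n, 1:]"]) (simp add: p pochhammer_Suc algebra_simps)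
qed

lemma poly_fun_hagen: "\<exists>p::real poly. \<forall>x. poly p x = hagen j x"
proof (cases "j = 0")
  case False
  obtain p :: "real poly" where p: "\<And>x. poly p x = pochhammer (x + (real j + 1)) (j - 1)"
    using poly_fun_pochhammer by blast
  show ?thesis
    by (rule exI[of _ "smult (1 / fact j) ([:0, 1:] * p)"]) (simp add: p False hagen_def algebra_simps)
qed (auto simp: hagen_def intro: exI[of _ 1])

lemma poly_eq_of_nat:
  fixes p q :: "real poly"
  assumes "\<And>n::nat. poly p (real n) = poly q (real n)"
  shows "p = q"
proof (rule ccontr)
  assume "p \<noteq> q"
  then have "finite {x. poly (p - q) x = 0}" by (intro poly_roots_finite) simp
  moreover have "range real \<subseteq> {x. poly (p - q) x = 0}" using assms by auto
  ultimately show False using finite_subset finite_imageD[of real UNIV] by (auto simp: inj_on_def)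
qed

text \<open>The instance of the Rothe--Hagen convolution identity with step 2. Both sides satisfy the same
  recurrence in \<open>\<delta>\<close> with step 1 and agree at 0; being polynomials in \<open>\<delta>\<close>, they coincide.\<close>

lemma rothe_hagen: "(\<Sum>b\<le>N. shifted \<phi> b * hagen (N - b) \<delta>) = shifted (\<phi> + \<delta>) N"
proof (induction N arbitrary: \<delta>)
  case 0
  show ?case by (simp add: shifted_def hagen_def)
next
  case (Suc N)
  define L where "L \<delta> = (\<Sum>b\<le>Suc N. shifted \<phi> b * hagen (Suc N - b) \<delta>)" for \<delta>
  have step: "L (\<delta> + 1) = L \<delta> + shifted (\<phi> + (\<delta> + 2)) N" for \<delta>
  proof -
    have "L (\<delta> + 1) = (\<Sum>b\<le>N. shifted \<phi> b * (hagen (Suc (N - b)) \<delta> + hagen (N - b) (\<delta> + 2)))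
         + shifted \<phi> (Suc N)"
      unfolding L_def by (simp add: Suc_diff_le hagen_add_one) (simp add: hagen_def)
    also have "\<dots> = L \<delta> + (\<Sum>b\<le>N. shifted \<phi> b * hagen (N - b) (\<delta> + 2))"
      unfolding L_def by (simp add: Suc_diff_le algebra_simps sum.distrib) (simp add: hagen_def)
    finally show ?thesis by (simp add: Suc.IH)
  qed
  have nat: "L (real n) = shifted (\<phi> + real n) (Suc N)" for n
  proof (induction n)
    case 0
    have "L 0 = (\<Sum>b\<le>Suc N. if b = Suc N then shifted \<phi> b else 0)"
      unfolding L_def by (intro sum.cong) (auto simp: hagen_def)
    then show ?case by simp
  next
    case (Suc n)
    have "L (real (Suc n)) = L (real n + 1)" by (simp add: add.commute)
    also have "\<dots> = shifted (\<phi> + real n + 1) (Suc N)"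
      unfolding step Suc shifted_add_one by (simp add: algebra_simps)
    finally show ?case by (simp add: algebra_simps)
  qed
  obtain h :: "nat \<Rightarrow> real poly" where h: "\<And>j x. poly (h j) x = hagen j x"
    using poly_fun_hagen by metis
  obtain r :: "real poly" where r: "\<And>x. poly r x = pochhammer (x + (\<phi> + real (Suc N))) (Suc N)"
    using poly_fun_pochhammer by blast
  have pl: "poly (\<Sum>b\<le>Suc N. smult (shifted \<phi> b) (h (Suc N - b))) x = L x" for x
    by (simp add: L_def poly_sum h)
  have pr: "poly (smult (1 / fact (Suc N)) r) x = shifted (\<phi> + x) (Suc N)" for x
    by (simp add: r shifted_def algebra_simps)
  have "(\<Sum>b\<le>Suc N. smult (shifted \<phi> b) (h (Suc N - b))) = smult (1 / fact (Suc N)) r"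
    by (rule poly_eq_of_nat) (simp only: pl pr nat)
  then show ?case using pl[of \<delta>] pr[of \<delta>] unfolding L_def by simp
qed

lemma central_Suc:
  assumes "\<phi> > 0"
  shows "central a \<phi> b = (\<phi> + real a + real b) * central (Suc a) \<phi> b"
proof -
  have "pochhammer \<phi> (a + b) > 0" using assms by (rule pochhammer_pos)
  moreover have "\<phi> + real a + real b > 0" using assms by simp
  moreover have "pochhammer \<phi> (Suc a + b) = pochhammer \<phi> (a + b) * (\<phi> + real a + real b)"
    by (simp add: pochhammer_Suc)
  ultimately show ?thesis unfolding central_def by (simp add: mult.assoc[symmetric])
qed

text \<open>The subtracted term equals b times \<open>central (Suc a) \<phi> b\<close>, whereas
  \<open>central a \<phi> b\<close> is (\<phi> + a + b) times it. Thus a grows by one at the price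
  of moving \<phi> to \<phi> + 2 and b to b - 1.\<close>

lemma central_rec:
  assumes "\<phi> > 0"
  shows "(\<phi> + real a) * central (Suc a) \<phi> b =
    central a \<phi> b - (if b = 0 then 0 else central a (\<phi> + 2) (b - 1))"
proof -
  have c2: "(if b = 0 then 0 else central a (\<phi> + 2) (b - 1)) = real b * central (Suc a) \<phi> b"
  proof (cases b)
    case (Suc c)
    have two: "pochhammer \<phi> (Suc (Suc m)) = pochhammer \<phi> 2 * pochhammer (\<phi> + 2) m" for m
      using pochhammer_product'[of \<phi> 2 m] by simp
    have "pochhammer \<phi> (2 * b) = pochhammer \<phi> 2 * pochhammer (\<phi> + 2) (2 * c)"
      "pochhammer \<phi> (Suc a + b) = pochhammer \<phi> 2 * pochhammer (\<phi> + 2) (a + c)"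
      using Suc two[of "2 * c"] two[of "a + c"] by simp_all
    moreover have "pochhammer \<phi> 2 > 0" using assms by (rule pochhammer_pos)
    moreover have "fact b = real b * fact c" using Suc by simp
    ultimately show ?thesis using Suc unfolding central_def by simp
  qed simp
  show ?thesis unfolding central_Suc[OF assms, of a] c2 by (simp add: algebra_simps)
qed

text \<open>Polynomials of degree at most \<open>d\<close> on the naturals, in the basis of falling factorials because
  \<open>f N\<close> is going to be divided by \<open>N!\<close>; \<open>l\<close> is the coefficient of degree \<open>d\<close>.\<close>

definition inv_fact_diff :: "nat \<Rightarrow> nat \<Rightarrow> real" where
  "inv_fact_diff N i = (if i \<le> N then 1 / fact (N - i) else 0)"

definition fall_poly :: "nat \<Rightarrow> (nat \<Rightarrow> real) \<Rightarrow> real \<Rightarrow> bool" where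
  "fall_poly d f l \<longleftrightarrow>
     (\<exists>c. c d = l \<and> (\<forall>N. f N / fact N = (\<Sum>i\<le>d. c i * inv_fact_diff N i)))"

text \<open>With (N)_i for the falling factorial this is N (N)_i = i (N)_i + (N)_{i+1}, divided by
  N!.\<close>

lemma inv_fact_diff_mult: "real N * inv_fact_diff N i = real i * inv_fact_diff N i + inv_fact_diff N (Suc i)"
proof (cases "Suc i \<le> N")
  case True
  then have "fact (N - i) = real (N - i) * fact (N - Suc i)"
    by (metis Suc_diff_Suc Suc_le_eq fact_Suc of_nat_fact of_nat_mult)
  moreover have "real (N - i) > 0" using True by simp
  ultimately show ?thesis using True by (simp add: inv_fact_diff_def field_simps of_nat_diff)
qed (auto simp: inv_fact_diff_def)

lemma fall_poly_one: "fall_poly 0 (\<lambda>_. 1) 1"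
  unfolding fall_poly_def by (rule exI[of _ "\<lambda>_. 1"]) (simp add: inv_fact_diff_def)

lemma fall_poly_lin:
  assumes "fall_poly d f l" "fall_poly d g m"
  shows "fall_poly d (\<lambda>N. u * f N + v * g N) (u * l + v * m)"
proof -
  obtain b c where "b d = l" "c d = m"
    and b: "\<And>N. f N / fact N = (\<Sum>i\<le>d. b i * inv_fact_diff N i)"
    and c: "\<And>N. g N / fact N = (\<Sum>i\<le>d. c i * inv_fact_diff N i)"
    using assms unfolding fall_poly_def by blast
  moreover have "(u * f N + v * g N) / fact N = (\<Sum>i\<le>d. (u * b i + v * c i) * inv_fact_diff N i)" for N
  proof -
    have "(u * f N + v * g N) / fact N = u * (f N / fact N) + v * (g N / fact N)"
      by (simp add: field_simps)
    then show ?thesis by (simp add: b c sum_distrib_left sum.distrib algebra_simps)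
  qed
  ultimately show ?thesis unfolding fall_poly_def
    by (intro exI[of _ "\<lambda>i. u * b i + v * c i"]) simp
qed

lemma fall_poly_mult:
  assumes "fall_poly d f l"
  shows "fall_poly (Suc d) (\<lambda>N. (y + real N) * f N) l"
proof -
  obtain c where cl: "c d = l" and c: "\<And>N. f N / fact N = (\<Sum>i\<le>d. c i * inv_fact_diff N i)"
    using assms unfolding fall_poly_def by blast
  define c' where "c' i = (if i \<le> d then (y + real i) * c i else 0) + (if i = 0 then 0 else c (i - 1))" for i
  have "(y + real N) * f N / fact N = (\<Sum>i\<le>Suc d. c' i * inv_fact_diff N i)" for N
  proof -
    have "(y + real N) * f N / fact N = (\<Sum>i\<le>d. c i * (y * inv_fact_diff N i + real N * inv_fact_diff N i))"
    proof -
      have "(y + real N) * f N / fact N = (y + real N) * (\<Sum>i\<le>d. c i * inv_fact_diff N i)"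
        unfolding c[symmetric] by simp
      then show ?thesis by (simp add: sum_distrib_left algebra_simps)
    qed
    also have "\<dots> = (\<Sum>i\<le>d. (y + real i) * c i * inv_fact_diff N i) + (\<Sum>i\<le>d. c i * inv_fact_diff N (Suc i))"
      unfolding inv_fact_diff_mult by (simp add: sum.distrib algebra_simps)
    also have "(\<Sum>i\<le>d. c i * inv_fact_diff N (Suc i)) =
        (\<Sum>i\<le>Suc d. (if i = 0 then 0 else c (i - 1)) * inv_fact_diff N i)"
      by (subst sum.atMost_Suc_shift) simp
    also have "(\<Sum>i\<le>d. (y + real i) * c i * inv_fact_diff N i) =
        (\<Sum>i\<le>Suc d. (if i \<le> d then (y + real i) * c i else 0) * inv_fact_diff N i)"
      by simp
    finally show ?thesis unfolding c'_def by (simp only: sum.distrib[symmetric] distrib_right)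
  qed
  then show ?thesis unfolding fall_poly_def
    by (intro exI[of _ c'] conjI allI) (simp_all add: c'_def cl)
qed

text \<open>Division by N! turns N f(N - 1) into f(N - 1) / (N - 1)!, which shifts the basis index
  by one and keeps the leading coefficient. At N = 0 the factor N makes the truncated
  \<open>N - 1\<close> harmless.\<close>

lemma fall_poly_shift:
  assumes "fall_poly d f l"
  shows "fall_poly (Suc d) (\<lambda>N. real N * f (N - 1)) l"
proof -
  obtain c where cl: "c d = l" and c: "\<And>N. f N / fact N = (\<Sum>i\<le>d. c i * inv_fact_diff N i)"
    using assms unfolding fall_poly_def by blast
  define c' where "c' i = (if i = 0 then 0 else c (i - 1))" for i
  have "real N * f (N - 1) / fact N = (\<Sum>i\<le>Suc d. c' i * inv_fact_diff N i)" for N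
  proof (cases N)
    case (Suc M)
    have "real N * f (N - 1) / fact N = f M / fact M" using Suc by (simp add: field_simps del: of_nat_Suc)
    also have "\<dots> = (\<Sum>i\<le>Suc d. c' i * inv_fact_diff N i)"
      unfolding c by (subst sum.atMost_Suc_shift) (simp add: c'_def Suc inv_fact_diff_def if_distrib cong: if_cong)
    finally show ?thesis .
  next
    case 0
    then show ?thesis by (subst sum.atMost_Suc_shift) (simp add: c'_def inv_fact_diff_def)
  qed
  then show ?thesis unfolding fall_poly_def
    by (intro exI[of _ c'] conjI allI) (simp_all add: c'_def cl)
qed

lemma fall_poly_pochhammer:
  assumes "fall_poly d f l"
  shows "fall_poly (d + e) (\<lambda>N. pochhammer (y + real N) e * f N) l"
proof (induction e)
  case (Suc e)
  have "(\<lambda>N. (y + real e + real N) * (pochhammer (y + real N) e * f N)) =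
     (\<lambda>N. pochhammer (y + real N) (Suc e) * f N)"
    by (simp add: pochhammer_Suc algebra_simps)
  then show ?case using fall_poly_mult[OF Suc, of "y + real e"] by simp
qed (simp add: assms)

text \<open>Induction on a by \<open>central_rec\<close>, with \<open>rothe_hagen\<close> as the
  case a = 0. The leading coefficient 0 for a > 0 is what later makes the zeroth coefficient of an
  expansion equal to the expanded function itself.\<close>

lemma central_convolution:
  assumes "\<phi> > 0" "\<delta> \<ge> 0"
  shows "\<exists>f. fall_poly a f (if a = 0 then 1 else 0) \<and>
    (\<forall>N. (\<Sum>b\<le>N. central a \<phi> b * hagen (N - b) \<delta>) = f N * central a (\<phi> + \<delta>) N)"
  using assms(1)
proof (induction a arbitrary: \<phi>)
  case 0
  show ?case
    by (rule exI[of _ "\<lambda>_. 1"]) (use 0 assms(2) in \<open>simp add: fall_poly_one central_0 rothe_hagen\<close>)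
next
  case (Suc a)
  define S where "S a \<phi> N = (\<Sum>b\<le>N. central a \<phi> b * hagen (N - b) \<delta>)" for a \<phi> N
  let ?l = "if a = 0 then 1 else 0 :: real"
  obtain f where f: "fall_poly a f ?l" "\<And>N. S a \<phi> N = f N * central a (\<phi> + \<delta>) N"
    using Suc.IH[OF Suc.prems] unfolding S_def by blast
  have "\<phi> + 2 > 0" using Suc.prems by simp
  then obtain g where g: "fall_poly a g ?l" "\<And>N. S a (\<phi> + 2) N = g N * central a (\<phi> + 2 + \<delta>) N"
    using Suc.IH[of "\<phi> + 2"] unfolding S_def by blast
  define X where "X = \<phi> + real a"
  define Y where "Y = \<phi> + \<delta> + real a"
  have X: "X > 0" using Suc.prems by (simp add: X_def)
  \<comment> \<open>This is the recurrence solved for the next factor. Both summands have degree a +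
    1, and their leading coefficients are opposite, so the top coefficient cancels.\<close>
  define h where "h N = (1 / X) * ((Y + real N) * f N) + (- 1 / X) * (real N * g (N - 1))" for N
  have h: "fall_poly (Suc a) h 0"
    unfolding h_def using fall_poly_lin[OF fall_poly_mult[OF f(1), of Y] fall_poly_shift[OF g(1)], of "1 / X" "- 1 / X"]
    by simp
  have "S (Suc a) \<phi> N = h N * central (Suc a) (\<phi> + \<delta>) N" for N
  proof -
    define T where "T = central (Suc a) (\<phi> + \<delta>) N"
    have pos: "\<phi> + \<delta> > 0" using Suc.prems assms(2) by simp
    have T1: "central a (\<phi> + \<delta>) N = (Y + real N) * T"
      unfolding T_def Y_def by (rule central_Suc[OF pos])
    have T2: "(if N = 0 then 0 else central a (\<phi> + \<delta> + 2) (N - 1)) = real N * T"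
      using central_rec[OF pos, of a N] T1 unfolding T_def Y_def by (simp add: algebra_simps)
    have "X * S (Suc a) \<phi> N = (\<Sum>b\<le>N. (X * central (Suc a) \<phi> b) * hagen (N - b) \<delta>)"
      unfolding S_def by (simp add: sum_distrib_left mult.assoc)
    also have "\<dots> = S a \<phi> N - (\<Sum>b\<le>N. (if b = 0 then 0 else central a (\<phi> + 2) (b - 1)) * hagen (N - b) \<delta>)"
      unfolding X_def central_rec[OF Suc.prems] S_def by (simp add: left_diff_distrib sum_subtractf)
    also have "(\<Sum>b\<le>N. (if b = 0 then 0 else central a (\<phi> + 2) (b - 1)) * hagen (N - b) \<delta>) =
        (if N = 0 then 0 else S a (\<phi> + 2) (N - 1))"
    proof (cases N)
      case (Suc M)
      show ?thesis unfolding Suc S_def by (subst sum.atMost_Suc_shift) simp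
    qed simp
    also have "\<dots> = g (N - 1) * (real N * T)"
      unfolding T2[symmetric] by (simp add: g(2) algebra_simps)
    finally have "X * S (Suc a) \<phi> N = f N * ((Y + real N) * T) - g (N - 1) * (real N * T)"
      by (simp only: f(2) T1)
    also have "\<dots> = X * (h N * T)"
      unfolding h_def using X by (simp add: algebra_simps)
    finally show ?thesis unfolding T_def using X by simp
  qed
  with h show ?case unfolding S_def by auto
qed

text \<open>An M-th difference of a polynomial of degree K in x. Pascal's rule extracts one
  difference, which lowers both K and M by one.\<close>

lemma finite_difference_pochhammer:
  fixes x :: real
  assumes "K < M"
  shows "(\<Sum>e\<le>M. (-1) ^ e * of_nat (M choose e) * pochhammer (x - real e) K) = 0"
  using assms
proof (induction M arbitrary: K x)
  case (Suc M)
  have "(\<Sum>e\<le>Suc M. (-1) ^ e * of_nat (Suc M choose e) * pochhammer (x - real e) K) =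
      (\<Sum>e\<le>M. (-1) ^ e * of_nat (M choose e) * (pochhammer (x - real e) K - pochhammer (x - 1 - real e) K))"
  proof -
    have "(\<Sum>e\<le>Suc M. (-1) ^ e * of_nat (Suc M choose e) * pochhammer (x - real e) K) =
      pochhammer x K + (\<Sum>e\<le>M. (-1) ^ Suc e * of_nat (Suc M choose Suc e) * pochhammer (x - real (Suc e)) K)"
      by (subst sum.atMost_Suc_shift) simp
    also have "(\<Sum>e\<le>M. (-1) ^ Suc e * of_nat (Suc M choose Suc e) * pochhammer (x - real (Suc e)) K) =
      (\<Sum>e\<le>M. (-1) ^ Suc e * of_nat (M choose Suc e) * pochhammer (x - real (Suc e)) K
         - (-1) ^ e * of_nat (M choose e) * pochhammer (x - 1 - real e) K)"
      by (intro sum.cong) (simp_all add: algebra_simps)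
    also have "pochhammer x K + \<dots> = pochhammer x K + (\<Sum>e\<le>M. (-1) ^ Suc e * of_nat (M choose Suc e) * pochhammer (x - real (Suc e)) K)
      - (\<Sum>e\<le>M. (-1) ^ e * of_nat (M choose e) * pochhammer (x - 1 - real e) K)"
      by (simp add: sum_subtractf)
    also have "pochhammer x K + (\<Sum>e\<le>M. (-1) ^ Suc e * of_nat (M choose Suc e) * pochhammer (x - real (Suc e)) K) =
       (\<Sum>e\<le>Suc M. (-1) ^ e * of_nat (M choose e) * pochhammer (x - real e) K)"
      by (subst sum.atMost_Suc_shift) simp
    also have "\<dots> = (\<Sum>e\<le>M. (-1) ^ e * of_nat (M choose e) * pochhammer (x - real e) K)"
      by simp
    finally show ?thesis by (simp add: sum_subtractf right_diff_distrib)
  qed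
  also have "\<dots> = 0"
  proof (cases K)
    case (Suc L)
    have "pochhammer (x - real e) K - pochhammer (x - 1 - real e) K = real K * pochhammer (x - real e) L" for e
    proof -
      have "pochhammer (x - 1 - real e) K = (x - 1 - real e) * pochhammer (x - real e) L"
        unfolding Suc by (subst pochhammer_rec) (simp add: algebra_simps)
      then show ?thesis unfolding Suc by (simp add: pochhammer_Suc algebra_simps)
    qed
    then have "(\<Sum>e\<le>M. (-1) ^ e * of_nat (M choose e) * (pochhammer (x - real e) K - pochhammer (x - 1 - real e) K)) =
       real K * (\<Sum>e\<le>M. (-1) ^ e * of_nat (M choose e) * pochhammer (x - real e) L)"
      by (simp add: sum_distrib_left algebra_simps)
    then show ?thesis using Suc.IH[of L x] Suc.prems Suc by simp
  qed simp
  finally show ?case .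
qed simp

section \<open>Gaussian moments\<close>

definition vmonom :: "('d::finite \<Rightarrow> nat) \<Rightarrow> real ^ 'd \<Rightarrow> real" where
  "vmonom k x = (\<Prod>i\<in>UNIV. (x $ i) ^ k i)"

definition gauss_density :: "real ^ 'd \<Rightarrow> real" where
  "gauss_density x = (\<Prod>i\<in>UNIV. std_normal_density (x $ i))"

definition gauss_mean :: "(real ^ 'd \<Rightarrow> real) \<Rightarrow> real" where
  "gauss_mean f = (LINT x|lborel. f x * gauss_density x)"

definition normal_moment :: "nat \<Rightarrow> real" where
  "normal_moment k = (LINT x|lborel. std_normal_density x * x ^ k)"

lemma normal_moment_even: "normal_moment (2 * k) = fact (2 * k) / (2 ^ k * fact k)"
  unfolding normal_moment_def by (rule integral_std_normal_moment_even)

lemma normal_moment_odd: "normal_moment (Suc (2 * k)) = 0"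
  unfolding normal_moment_def using integral_std_normal_moment_odd[of k] by simp

text \<open>Integration by parts in dimension one. At k = 0 the factor \<open>real k\<close>
  neutralizes the truncated \<open>k - 1\<close>.\<close>

lemma normal_moment_Suc: "normal_moment (Suc k) = real k * normal_moment (k - 1)"
proof (cases "even k")
  case True
  then obtain j where "k = 2 * j" by blast
  moreover have "real (2 * j) * normal_moment (2 * j - 1) = 0"
    by (cases j) (simp_all add: normal_moment_odd)
  ultimately show ?thesis by (simp add: normal_moment_odd)
next
  case False
  then obtain j where k: "k = 2 * j + 1" by (elim oddE)
  have "normal_moment (Suc k) = normal_moment (2 * Suc j)" by (simp add: k)
  also have "\<dots> = real k * normal_moment (2 * j)"
  proof -
    have num: "fact (2 * Suc j) = (2 * real j + 2) * (real k * fact (2 * j))"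
      by (simp add: k algebra_simps)
    have den: "2 ^ Suc j * fact (Suc j) = (2 * real j + 2) * (2 ^ j * fact j)"
      by (simp add: algebra_simps)
    have nz: "2 * real j + 2 \<noteq> 0" by simp
    show ?thesis unfolding normal_moment_even num den times_divide_eq_right
      by (rule mult_divide_mult_cancel_left[OF nz])
  qed
  finally show ?thesis by (simp add: k)
qed

lemma bij_betw_axis: "bij_betw (\<lambda>i. axis i (1::real)) UNIV (Basis :: (real ^ 'd) set)"
  by (auto simp: bij_betw_def inj_on_def Basis_vec_def axis_eq_axis)

text \<open>\<open>lborel\<close> on vectors is a product measure over \<open>Basis\<close>, so the
  index type is carried over to the axis vectors, with \<open>ix\<close> as the way back.\<close>

lemma has_bochner_integral_prod_component:
  fixes f :: "'d::finite \<Rightarrow> real \<Rightarrow> real"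
  assumes "\<And>i. integrable lborel (f i)"
  shows "has_bochner_integral lborel (\<lambda>x::real ^ 'd. \<Prod>i\<in>UNIV. f i (x $ i)) (\<Prod>i\<in>UNIV. LINT x|lborel. f i x)"
proof -
  interpret product_sigma_finite "\<lambda>_::real ^ 'd. lborel :: real measure" by standard
  define ix :: "real ^ 'd \<Rightarrow> 'd" where "ix = the_inv (\<lambda>i. axis i 1)"
  have ix [simp]: "ix (axis i 1) = i" for i
    unfolding ix_def by (rule the_inv_f_f) (auto simp: inj_on_def axis_eq_axis)
  have [measurable]: "f i \<in> borel_measurable borel" for i
    using borel_measurable_integrable[OF assms[of i]] by simp
  have prod: "(\<Prod>b\<in>Basis. h b) = (\<Prod>i\<in>UNIV. h (axis i 1))" for h :: "real ^ 'd \<Rightarrow> real"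
    using prod.reindex_bij_betw[OF bij_betw_axis, of h] by simp
  have comp: "(\<Sum>b\<in>Basis. w b *\<^sub>R b) $ i = w (axis i 1)" for w and i :: 'd
  proof -
    have "(\<Sum>b\<in>Basis. w b *\<^sub>R b) $ i = (\<Sum>b\<in>Basis. w b *\<^sub>R b) \<bullet> axis i 1" by (simp add: inner_axis)
    also have "\<dots> = w (axis i 1)" by (subst inner_sum_left_Basis) simp_all
    finally show ?thesis .
  qed
  have eq: "(\<Prod>i\<in>UNIV. f i ((\<Sum>b\<in>Basis. w b *\<^sub>R b) $ i)) = (\<Prod>b\<in>Basis. f (ix b) (w b))" for w
    by (simp only: prod comp ix)
  have int: "integrable (\<Pi>\<^sub>M b\<in>(Basis :: (real ^ 'd) set). lborel) (\<lambda>w. \<Prod>b\<in>Basis. f (ix b) (w b))"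
    by (rule product_integrable_prod) (simp_all add: assms)
  have val: "(LINT w|(\<Pi>\<^sub>M b\<in>(Basis :: (real ^ 'd) set). lborel). (\<Prod>b\<in>Basis. f (ix b) (w b))) =
      (\<Prod>i\<in>UNIV. LINT x|lborel. f i x)"
    by (subst product_integral_prod) (simp_all add: assms prod)
  have "has_bochner_integral (\<Pi>\<^sub>M b\<in>(Basis :: (real ^ 'd) set). lborel)
      (\<lambda>w. \<Prod>i\<in>UNIV. f i ((\<Sum>b\<in>Basis. w b *\<^sub>R b) $ i)) (\<Prod>i\<in>UNIV. LINT x|lborel. f i x)"
    unfolding eq using int val by (simp add: has_bochner_integral_iff)
  then show ?thesis
    by (subst lborel_eq) (simp add: has_bochner_integral_distr)
qed

lemma gauss_mean_vmonom:
  fixes k :: "'d::finite \<Rightarrow> nat"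
  shows "integrable lborel (\<lambda>x. vmonom k x * gauss_density x)"
    and "gauss_mean (vmonom k) = (\<Prod>i\<in>UNIV. normal_moment (k i))"
proof -
  have "has_bochner_integral lborel (\<lambda>x::real ^ 'd. \<Prod>i\<in>UNIV. std_normal_density (x $ i) * (x $ i) ^ k i)
      (\<Prod>i\<in>UNIV. normal_moment (k i))"
    unfolding normal_moment_def
    by (rule has_bochner_integral_prod_component) (rule integrable_std_normal_moment)
  then have "has_bochner_integral lborel (\<lambda>x. vmonom k x * gauss_density x) (\<Prod>i\<in>UNIV. normal_moment (k i))"
    by (simp add: vmonom_def gauss_density_def prod.distrib mult.commute)
  then show "integrable lborel (\<lambda>x. vmonom k x * gauss_density x)"
    and "gauss_mean (vmonom k) = (\<Prod>i\<in>UNIV. normal_moment (k i))"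
    by (simp_all add: has_bochner_integral_iff gauss_mean_def)
qed

lemma prod_UNIV_remove: "(\<Prod>i\<in>UNIV. f i) = f (l::'d::finite) * (\<Prod>i\<in>UNIV - {l}. f i)" for f :: "_ \<Rightarrow> real"
  by (rule prod.remove) simp_all

lemma vmonom_upd: "vmonom (k(l := Suc (k l))) x = x $ l * vmonom k x"
  unfolding vmonom_def prod_UNIV_remove[of _ l] by simp

lemma inner_vec_sum: "x \<bullet> y = (\<Sum>l\<in>UNIV. y $ l * x $ l)" for x y :: "real ^ 'd"
  by (simp add: inner_vec_def mult.commute)

lemma integrable_vmonom_inner:
  "integrable lborel (\<lambda>x. vmonom k x * (x \<bullet> y) ^ i * gauss_density x)"
proof (induction i arbitrary: k)
  case (Suc i)
  have "vmonom k x * (x \<bullet> y) ^ Suc i * gauss_density x =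
      (\<Sum>l\<in>UNIV. y $ l * (vmonom (k(l := Suc (k l))) x * (x \<bullet> y) ^ i * gauss_density x))" for x
    unfolding vmonom_upd power_Suc inner_vec_sum[of x y]
    by (simp add: sum_distrib_left sum_distrib_right algebra_simps)
  then show ?case using Suc by simp
qed (simp add: gauss_mean_vmonom)

definition gauss_moment :: "('d \<Rightarrow> nat) \<Rightarrow> nat \<Rightarrow> real ^ 'd \<Rightarrow> real" where
  "gauss_moment k i y = gauss_mean (\<lambda>x. vmonom k x * (x \<bullet> y) ^ i)"

lemma gauss_moment_Suc:
  "gauss_moment k (Suc i) y = (\<Sum>l\<in>UNIV. y $ l * gauss_moment (k(l := Suc (k l))) i y)"
proof -
  have "vmonom k x * (x \<bullet> y) ^ Suc i * gauss_density x =
      (\<Sum>l\<in>UNIV. y $ l * (vmonom (k(l := Suc (k l))) x * (x \<bullet> y) ^ i * gauss_density x))" for x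
    unfolding vmonom_upd power_Suc inner_vec_sum[of x y]
    by (simp add: sum_distrib_left sum_distrib_right algebra_simps)
  then show ?thesis unfolding gauss_moment_def gauss_mean_def
    by (simp add: integrable_vmonom_inner)
qed

text \<open>Integration by parts E(x_l f) = E(d_l f) for f = x^k <x, y>^i, where d_l is the partial
  derivative. The induction expands one factor <x, y> at a time and starts from the one-dimensional
  recurrence. The truncated \<open>k l - 1\<close> and \<open>i - 1\<close> occur with factor
  0.\<close>

lemma gauss_moment_stein:
  "gauss_moment (k(l := Suc (k l))) i y =
     real (k l) * gauss_moment (k(l := k l - 1)) i y + real i * y $ l * gauss_moment k (i - 1) y"
proof (induction i arbitrary: k)
  case 0
  show ?case
    unfolding gauss_moment_def
    by (simp add: gauss_mean_vmonom prod_UNIV_remove[of _ l] normal_moment_Suc)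
next
  case (Suc i)
  let ?G = "\<lambda>k i. gauss_moment k i y"
  \<comment> \<open>The hypothesis is applied with the exponent of x_m raised first. For m = l the
    exponent of x_l is then larger by one, and this surplus supplies the y_l that turns i into i +
    1.\<close>
  have IH: "?G ((k(m := Suc (k m)))(l := Suc ((k(m := Suc (k m))) l))) i =
      real (k l) * ?G ((k(l := k l - 1))(m := Suc ((k(l := k l - 1)) m))) i +
      (if m = l then ?G k i else 0) + real i * y $ l * ?G (k(m := Suc (k m))) (i - 1)" for m
  proof (cases "m = l")
    case True
    have A: "?G (k(l := Suc (Suc (k l)))) i =
        real (Suc (k l)) * ?G k i + real i * y $ l * ?G (k(l := Suc (k l))) (i - 1)"
      using Suc.IH[of "k(l := Suc (k l))"] by (simp only: fun_upd_upd fun_upd_same diff_Suc_1 fun_upd_triv)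
    have B: "real (k l) * ?G ((k(l := k l - 1))(l := Suc ((k(l := k l - 1)) l))) i = real (k l) * ?G k i"
    proof (cases "k l = 0")
      case False
      then have "Suc (k l - 1) = k l" by simp
      then show ?thesis by (simp only: fun_upd_upd fun_upd_same fun_upd_triv)
    qed simp
    have C: "?G ((k(l := Suc (k l)))(l := Suc ((k(l := Suc (k l))) l))) i = ?G (k(l := Suc (Suc (k l)))) i"
      by (simp only: fun_upd_upd fun_upd_same)
    show ?thesis unfolding True B C A by (simp add: algebra_simps)
  next
    case False
    then have "(k(m := Suc (k m))) l = k l"
      "(k(m := Suc (k m)))(l := k l - 1) = (k(l := k l - 1))(m := Suc ((k(l := k l - 1)) m))" by auto
    then show ?thesis using Suc.IH[of "k(m := Suc (k m))"] False by (simp only: if_False add_0_right)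
  qed
  have "?G (k(l := Suc (k l))) (Suc i) =
      (\<Sum>m\<in>UNIV. y $ m * ?G ((k(m := Suc (k m)))(l := Suc ((k(m := Suc (k m))) l))) i)"
  proof -
    have "(k(l := Suc (k l)))(m := Suc ((k(l := Suc (k l))) m)) =
       (k(m := Suc (k m)))(l := Suc ((k(m := Suc (k m))) l))" for m by auto
    then show ?thesis by (simp only: gauss_moment_Suc)
  qed
  also have "\<dots> = real (k l) * ?G (k(l := k l - 1)) (Suc i) + y $ l * ?G k i
      + real i * y $ l * (\<Sum>m\<in>UNIV. y $ m * ?G (k(m := Suc (k m))) (i - 1))"
  proof -
    have "(\<Sum>m\<in>UNIV. y $ m * (c * A m + (if m = l then g else 0) + d * B m)) =
        c * (\<Sum>m\<in>UNIV. y $ m * A m) + y $ l * g + d * (\<Sum>m\<in>UNIV. y $ m * B m)" for c g d A B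
      by (simp add: sum_distrib_left sum.distrib algebra_simps if_distrib[of "\<lambda>x. _ * x"] cong: if_cong)
    then show ?thesis unfolding IH gauss_moment_Suc[of "k(l := k l - 1)"] .
  qed
  also have "real i * y $ l * (\<Sum>m\<in>UNIV. y $ m * ?G (k(m := Suc (k m))) (i - 1)) = real i * y $ l * ?G k i"
  proof (cases i)
    case (Suc r)
    then show ?thesis using gauss_moment_Suc[of k r y] by simp
  qed simp
  finally show ?case by (simp add: algebra_simps)
qed

text \<open>The part of degree m of exp(x) when x counts as degree 2. The index is an integer so
  that negative degrees can be written down; they give 0.\<close>

definition exp_term :: "real \<Rightarrow> int \<Rightarrow> real" where
  "exp_term x m = (if m \<ge> 0 \<and> even m then x ^ nat (m div 2) / fact (nat (m div 2)) else 0)"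

lemma exp_term_add2:
  assumes "m \<ge> 0"
  shows "exp_term x (m + 2) = 2 * x / (real_of_int m + 2) * exp_term x m"
proof (cases "even m")
  case True
  then obtain r where r: "m = 2 * r" by blast
  with assms have "r \<ge> 0" by simp
  then obtain n where n: "r = int n" by (metis nonneg_int_cases)
  have m: "m = 2 * int n" using r n by simp
  have "nat ((m + 2) div 2) = Suc n" "nat (m div 2) = n" unfolding m by (simp_all add: nat_add_distrib)
  then have "exp_term x (m + 2) = x ^ Suc n / fact (Suc n)" "exp_term x m = x ^ n / fact n"
    using m by (simp_all add: exp_term_def)
  moreover have "x ^ Suc n / fact (Suc n) = x / (real n + 1) * (x ^ n / fact n)"
    by (simp add: field_simps)
  moreover have "2 * x / (real_of_int m + 2) = x / (real n + 1)"
    using m by (simp add: divide_simps)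
  ultimately show ?thesis by simp
qed (simp add: exp_term_def)

text \<open>The part of degree i of E exp<x, y> = exp(|y|^2 / 2). Expanding one factor <x, y> and
  integrating by parts lowers i by two.\<close>

lemma gauss_moment_zero:
  fixes y :: "real ^ 'd"
  shows "gauss_moment (\<lambda>_. 0) i y / fact i = exp_term ((norm y)\<^sup>2 / 2) (int i)"
proof (induction i rule: less_induct)
  case (less i)
  consider "i = 0" | "i = 1" | j where "i = Suc (Suc j)" by (metis One_nat_def not0_implies_Suc)
  then show ?case
  proof cases
    case 1
    have "normal_moment 0 = 1" using normal_moment_even[of 0] by simp
    moreover have "gauss_moment (\<lambda>_. 0) 0 y = gauss_mean (vmonom (\<lambda>_::'d. 0))"
      by (simp add: gauss_moment_def)
    ultimately show ?thesis unfolding 1 by (simp add: gauss_mean_vmonom exp_term_def)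
  next
    case 2
    then show ?thesis using gauss_moment_Suc[of "\<lambda>_. 0" 0 y]
      by (simp add: gauss_moment_stein[of "\<lambda>_. 0", simplified] exp_term_def)
  next
    case 3
    have "gauss_moment (\<lambda>_. 0) i y = (\<Sum>l\<in>UNIV. y $ l * (real (Suc j) * y $ l * gauss_moment (\<lambda>_. 0) j y))"
      unfolding 3 gauss_moment_Suc[of "\<lambda>_. 0" "Suc j"] using gauss_moment_stein[of "\<lambda>_. 0" _ "Suc j" y]
      by simp
    also have "\<dots> = real (Suc j) * (norm y)\<^sup>2 * gauss_moment (\<lambda>_. 0) j y"
      by (simp only: power2_norm_eq_inner inner_vec_sum[of y y] sum_distrib_left sum_distrib_right mult_ac)
    finally have "gauss_moment (\<lambda>_. 0) i y / fact i = (norm y)\<^sup>2 / real (Suc (Suc j)) * (gauss_moment (\<lambda>_. 0) j y / fact j)"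
      unfolding 3 by (simp add: divide_simps del: of_nat_Suc)
    also have "\<dots> = (norm y)\<^sup>2 / real (Suc (Suc j)) * exp_term ((norm y)\<^sup>2 / 2) (int j)"
      using less[of j] 3 by simp
    also have "\<dots> = exp_term ((norm y)\<^sup>2 / 2) (int i)"
      using exp_term_add2[of "int j" "(norm y)\<^sup>2 / 2"] 3 by (simp add: algebra_simps)
    finally show ?thesis .
  qed
qed

text \<open>\<open>P a\<close> is the \<open>a\<close>-th power of the Laplacian, divided by \<open>2\<^sup>a a!\<close>, applied to the monomial; only \<open>P 0\<close>
  matters.\<close>

lemma gauss_moment_expansion:
  fixes k :: "'d::finite \<Rightarrow> nat"
  shows "\<exists>P. P 0 = vmonom k \<and> (\<forall>a y. 2 * a > sum k UNIV \<longrightarrow> P a y = 0) \<and>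
    (\<forall>i y. gauss_moment k i y / fact i =
      (\<Sum>a\<le>sum k UNIV. P a y * exp_term ((norm y)\<^sup>2 / 2) (int i - int (sum k UNIV) + 2 * int a)))"
proof (induction "sum k UNIV" arbitrary: k rule: less_induct)
  case less
  show ?case
  proof (cases "sum k UNIV = 0")
    case True
    then have k: "k = (\<lambda>_. 0)" by auto
    show ?thesis
      by (rule exI[of _ "\<lambda>a y. if a = 0 then vmonom k y else 0"])
        (auto simp: k gauss_moment_zero vmonom_def)
  next
    case False
    then obtain l where l: "k l \<noteq> 0" by auto
    define h where "h = k(l := k l - 1)"
    define h' where "h' = h(l := h l - 1)"
    have k: "k = h(l := Suc (h l))" using l by (auto simp: h_def)
    have rem: "sum f UNIV = f l + sum f (UNIV - {l})" for f :: "'d \<Rightarrow> nat"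
      by (rule sum.remove) simp_all
    have sk: "sum k UNIV = Suc (sum h UNIV)" using rem[of k] rem[of h] l by (simp add: h_def)
    have sh: "sum h UNIV = Suc (sum h' UNIV)" if "h l \<noteq> 0"
      using rem[of h'] rem[of h] that by (simp add: h'_def)
    define n where "n = sum h UNIV"
    obtain P where P: "P 0 = vmonom h" "\<And>a y. 2 * a > n \<Longrightarrow> P a y = 0"
      "\<And>i y. gauss_moment h i y / fact i =
          (\<Sum>a\<le>n. P a y * exp_term ((norm y)\<^sup>2 / 2) (int i - int n + 2 * int a))"
      using less(1)[of h] sk unfolding n_def by auto
    obtain R :: "nat \<Rightarrow> real ^ 'd \<Rightarrow> real" where R: "\<And>a y. 2 * a + 1 > n \<Longrightarrow> R a y = 0"
      "\<And>i y. real (h l) * (gauss_moment h' i y / fact i) =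
          (\<Sum>a\<le>n. R a y * exp_term ((norm y)\<^sup>2 / 2) (int i - int n + 2 * int a + 1))"
    proof (cases "h l = 0")
      case True
      show ?thesis by (rule that[of "\<lambda>_ _. 0"]) (simp_all add: True)
    next
      case False
      then obtain P' where P': "\<And>a y. 2 * a > sum h' UNIV \<Longrightarrow> P' a y = 0"
      "\<And>i y. gauss_moment h' i y / fact i =
          (\<Sum>a\<le>sum h' UNIV. P' a y * exp_term ((norm y)\<^sup>2 / 2) (int i - int (sum h' UNIV) + 2 * int a))"
        using less(1)[of h'] sk sh unfolding n_def by auto
      have n: "n = Suc (sum h' UNIV)" using sh[OF False] by (simp add: n_def)
      show ?thesis
      proof (rule that[of "\<lambda>a y. real (h l) * P' a y"])
        show "real (h l) * P' a y = 0" if "2 * a + 1 > n" for a y using P'(1) that n by simp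
        have "(\<Sum>a\<le>n. (real (h l) * P' a y) * exp_term ((norm y)\<^sup>2 / 2) (int i - int n + 2 * int a + 1)) =
            real (h l) * (\<Sum>a\<le>sum h' UNIV. P' a y * exp_term ((norm y)\<^sup>2 / 2) (int i - int (sum h' UNIV) + 2 * int a))" for i y
          unfolding n by (simp add: P'(1) sum_distrib_left algebra_simps)
        then show "real (h l) * (gauss_moment h' i y / fact i) =
          (\<Sum>a\<le>n. (real (h l) * P' a y) * exp_term ((norm y)\<^sup>2 / 2) (int i - int n + 2 * int a + 1))" for i y
          by (simp add: P'(2))
      qed
    qed
    \<comment> \<open>By Stein's identity the part with y_l keeps the index a, while the derivative
      part has degree smaller by two than k and therefore moves to index a + 1.\<close>
    define Q where "Q a y = y $ l * P a y + (if a = 0 then 0 else R (a - 1) y)" for a y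
    show ?thesis
    proof (intro exI[of _ Q] conjI allI impI)
      show "Q 0 = vmonom k" unfolding k by (auto simp: Q_def P(1) vmonom_upd[of h l])
      show "Q a y = 0" if "2 * a > sum k UNIV" for a y
      proof -
        have "P a y = 0" using P(2) that sk n_def by simp
        moreover have "R (a - 1) y = 0" if "a \<noteq> 0"
          using \<open>2 * a > sum k UNIV\<close> sk that by (intro R(1)) (simp add: n_def)
        ultimately show ?thesis by (simp add: Q_def)
      qed
      show "gauss_moment k i y / fact i =
        (\<Sum>a\<le>sum k UNIV. Q a y * exp_term ((norm y)\<^sup>2 / 2) (int i - int (sum k UNIV) + 2 * int a))" for i y
      proof -
        let ?e = "exp_term ((norm y)\<^sup>2 / 2)"
        have P1: "(\<Sum>a\<le>Suc n. y $ l * P a y * ?e (int i - int (Suc n) + 2 * int a)) =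
           real i * y $ l * gauss_moment h (i - 1) y / fact i"
        proof (cases i)
          case 0
          \<comment> \<open>Either \<open>P a\<close> vanishes or the degree 2 a - n - 1 of the
            exponential term is negative.\<close>
          have "P a y * ?e (int i - int (Suc n) + 2 * int a) = 0" for a
            by (cases "2 * a > n") (auto simp: P(2) exp_term_def 0)
          then have "(\<Sum>a\<le>Suc n. y $ l * P a y * ?e (int i - int (Suc n) + 2 * int a)) = 0"
            by (intro sum.neutral ballI) (simp only: mult.assoc mult_zero_right)
          then show ?thesis using 0 by simp
        next
          case (Suc j)
          have "(\<Sum>a\<le>Suc n. y $ l * P a y * ?e (int i - int (Suc n) + 2 * int a)) =
              y $ l * (\<Sum>a\<le>n. P a y * ?e (int j - int n + 2 * int a))"
            using P(2)[of "Suc n" y] Suc by (simp add: sum_distrib_left algebra_simps)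
          also have "\<dots> = y $ l * (gauss_moment h j y / fact j)" by (simp add: P(3))
          also have "\<dots> = real i * y $ l * gauss_moment h (i - 1) y / fact i"
            unfolding Suc by (simp add: divide_simps del: of_nat_Suc) 
          finally show ?thesis .
        qed
        have R1: "(\<Sum>a\<le>Suc n. (if a = 0 then 0 else R (a - 1) y) * ?e (int i - int (Suc n) + 2 * int a)) =
            real (h l) * (gauss_moment h' i y / fact i) "
          unfolding R(2) by (subst sum.atMost_Suc_shift) (simp add: algebra_simps)
        have "gauss_moment k i y = real (h l) * gauss_moment h' i y + real i * y $ l * gauss_moment h (i - 1) y"
          unfolding k h'_def by (rule gauss_moment_stein)
        then have "gauss_moment k i y / fact i = real (h l) * (gauss_moment h' i y / fact i)
            + real i * y $ l * gauss_moment h (i - 1) y / fact i"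
          by (simp add: add_divide_distrib)
        also have "\<dots> = (\<Sum>a\<le>Suc n. Q a y * ?e (int i - int (Suc n) + 2 * int a))"
          unfolding P1[symmetric] R1[symmetric] Q_def by (simp only: sum.distrib[symmetric] distrib_right add.commute)
        finally show ?thesis using sk n_def by simp
      qed
    qed
  qed
qed

section \<open>Integrals over the double cone\<close>

lemma nn_integral_lborel_scaleR:
  fixes f :: "'a::euclidean_space \<Rightarrow> ennreal"
  assumes [measurable]: "f \<in> borel_measurable borel" and "c > 0"
  shows "(\<integral>\<^sup>+x. f x \<partial>lborel) = ennreal (c ^ DIM('a)) * (\<integral>\<^sup>+x. f (c *\<^sub>R x) \<partial>lborel)"
proof -
  have "(\<integral>\<^sup>+x. f x \<partial>lborel) =
      (\<integral>\<^sup>+x. f x \<partial>density (distr lborel borel (\<lambda>x. 0 + c *\<^sub>R x)) (\<lambda>_. ennreal (\<bar>c\<bar> ^ DIM('a))))"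
    using lborel_affine[of c "0::'a"] assms(2) by simp
  also have "\<dots> = (\<integral>\<^sup>+x. ennreal (c ^ DIM('a)) * f (c *\<^sub>R x) \<partial>lborel)"
    using assms(2) by (simp add: nn_integral_density nn_integral_distr)
  also have "\<dots> = ennreal (c ^ DIM('a)) * (\<integral>\<^sup>+x. f (c *\<^sub>R x) \<partial>lborel)"
    by (rule nn_integral_cmult) simp
  finally show ?thesis .
qed

text \<open>An extended nonnegative integral, so that scaling and Fubini apply before finiteness is
  known; \<open>ennreal\<close> cuts off negative values.\<close>

definition ball_integral :: "('a::euclidean_space \<Rightarrow> real) \<Rightarrow> real \<Rightarrow> ennreal" where
  "ball_integral g \<nu> = (\<integral>\<^sup>+x. ennreal (indicator (cball 0 1) x * (g x * (1 - (norm x)\<^sup>2) powr \<nu>)) \<partial>lborel)"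

lemma cball_borel [measurable]: "cball c r \<in> sets borel"
  by simp

text \<open>The substitution x = r x' turns homogeneity into a power of r. The degree is a real
  number and homogeneity is asked for positive factors only, so that powers of |t| and positive
  parts of polynomials qualify.\<close>

lemma ball_integral_scaled:
  fixes g :: "'a::euclidean_space \<Rightarrow> real"
  assumes [measurable]: "g \<in> borel_measurable borel"
    and hom: "\<And>c x. c > 0 \<Longrightarrow> g (c *\<^sub>R x) = c powr m * g x" and "r > 0"
  shows "(\<integral>\<^sup>+x. ennreal (indicator (cball 0 r) x * (g x * (r\<^sup>2 - (norm x)\<^sup>2) powr \<nu>)) \<partial>lborel) =
    ennreal (r powr (m + real DIM('a) + 2 * \<nu>)) * ball_integral g \<nu>"
proof -
  have eq: "indicator (cball 0 r) (r *\<^sub>R x) * (g (r *\<^sub>R x) * (r\<^sup>2 - (norm (r *\<^sub>R x))\<^sup>2) powr \<nu>) =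
      r powr (m + 2 * \<nu>) * (indicator (cball 0 1) x * (g x * (1 - (norm x)\<^sup>2) powr \<nu>))" for x
  proof (cases "norm x \<le> 1")
    case True
    then have "1 - (norm x)\<^sup>2 \<ge> 0" by (simp add: abs_square_le_1)
    moreover have "r\<^sup>2 - (norm (r *\<^sub>R x))\<^sup>2 = r\<^sup>2 * (1 - (norm x)\<^sup>2)"
      using assms(3) by (simp add: power_mult_distrib algebra_simps)
    moreover have "r\<^sup>2 powr \<nu> = r powr (2 * \<nu>)"
    proof -
      have "r\<^sup>2 powr \<nu> = (r powr 2) powr \<nu>" using assms(3) by simp
      then show ?thesis by (simp only: powr_powr)
    qed
    ultimately have e1: "(r\<^sup>2 - (norm (r *\<^sub>R x))\<^sup>2) powr \<nu> = r powr (2 * \<nu>) * (1 - (norm x)\<^sup>2) powr \<nu>"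
      by (metis powr_mult zero_le_power2)
    have e2: "indicator (cball 0 r) (r *\<^sub>R x) = (1::real)" "indicator (cball 0 1) x = (1::real)"
      using True assms(3) by simp_all
    show ?thesis unfolding e1 e2 hom[OF assms(3)] powr_add by simp
  qed (use assms(3) in \<open>simp add: indicator_def\<close>)
  have "(\<integral>\<^sup>+x. ennreal (indicator (cball 0 r) x * (g x * (r\<^sup>2 - (norm x)\<^sup>2) powr \<nu>)) \<partial>lborel) =
     ennreal (r ^ DIM('a)) * (\<integral>\<^sup>+x. ennreal (indicator (cball 0 r) (r *\<^sub>R x) *
        (g (r *\<^sub>R x) * (r\<^sup>2 - (norm (r *\<^sub>R x))\<^sup>2) powr \<nu>)) \<partial>lborel)"
    by (rule nn_integral_lborel_scaleR[OF _ assms(3)]) measurable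
  also have "\<dots> = ennreal (r ^ DIM('a)) * (\<integral>\<^sup>+x. ennreal (r powr (m + 2 * \<nu>)) *
        ennreal (indicator (cball 0 1) x * (g x * (1 - (norm x)\<^sup>2) powr \<nu>)) \<partial>lborel)"
    unfolding eq by (simp only: ennreal_mult'[OF powr_ge_zero])
  also have "\<dots> = ennreal (r ^ DIM('a)) * (ennreal (r powr (m + 2 * \<nu>)) * ball_integral g \<nu>)"
    unfolding ball_integral_def by (subst nn_integral_cmult) simp_all
  also have "\<dots> = ennreal (r ^ DIM('a) * r powr (m + 2 * \<nu>)) * ball_integral g \<nu>"
    using assms(3) by (simp add: ennreal_mult' mult.assoc)
  also have "r ^ DIM('a) * r powr (m + 2 * \<nu>) = r powr (m + real DIM('a) + 2 * \<nu>)"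
  proof -
    have "r ^ DIM('a) = r powr real DIM('a)" using assms(3) by (rule powr_realpow[symmetric])
    moreover have "real DIM('a) + (m + 2 * \<nu>) = m + real DIM('a) + 2 * \<nu>" by simp
    ultimately show ?thesis by (simp only: powr_add[symmetric])
  qed
  finally show ?thesis .
qed

lemma Gamma_nn_integral_shift:
  assumes "\<nu> > - 1"
  shows "ennreal (Gamma (\<nu> + 1)) =
    (\<integral>\<^sup>+\<sigma>. ennreal (indicator {c..} \<sigma> * ((\<sigma> - c) powr \<nu> * exp (c - \<sigma>))) \<partial>lborel)"
proof -
  have "ennreal (Gamma (\<nu> + 1)) = (\<integral>\<^sup>+t. ennreal (indicator {0..} t * t powr \<nu> / exp t) \<partial>lborel)"
    using Gamma_conv_nn_integral_real[of "\<nu> + 1"] assms by simp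
  also have "\<dots> = (\<integral>\<^sup>+t. ennreal (indicator {0..} t * t powr \<nu> / exp t) \<partial>distr lborel borel ((+) (- c)))"
    using lborel_distr_plus[of "- c"] by simp
  also have "\<dots> = (\<integral>\<^sup>+\<sigma>. ennreal (indicator {c..} \<sigma> * ((\<sigma> - c) powr \<nu> * exp (c - \<sigma>))) \<partial>lborel)"
    by (subst nn_integral_distr) (auto simp: indicator_def exp_diff exp_minus field_simps intro!: nn_integral_cong)
  finally show ?thesis .
qed

text \<open>The pair \<open>(x, w)\<close>, \<open>w > 0\<close>, is replaced by \<open>x\<close> and \<open>\<sigma> = norm x ^ 2 / 2 + w\<close>.\<close>

lemma ball_integral_gauss:
  fixes g :: "'a::euclidean_space \<Rightarrow> real"
  assumes [measurable]: "g \<in> borel_measurable borel" and nonneg: "\<And>x. g x \<ge> 0"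
    and hom: "\<And>c x. c > 0 \<Longrightarrow> g (c *\<^sub>R x) = c powr m * g x"
    and "\<nu> > - 1" and s: "s = (m + real DIM('a)) / 2" "s + \<nu> + 1 > 0"
  shows "ennreal (2 powr s * Gamma (s + \<nu> + 1)) * ball_integral g \<nu> =
    ennreal (Gamma (\<nu> + 1)) * (\<integral>\<^sup>+x. ennreal (g x * exp (- (norm x)\<^sup>2 / 2)) \<partial>lborel)"
proof -
  define q where "q x = (norm x)\<^sup>2 / 2" for x :: 'a
  define F where "F x \<sigma> = ennreal (g x * (indicator {q x..} \<sigma> * ((\<sigma> - q x) powr \<nu> * exp (- \<sigma>))))" for x \<sigma>
  have [measurable]: "q \<in> borel_measurable borel" unfolding q_def by simp
  have "closed {p::'a \<times> real. q (fst p) \<le> snd p}"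
    unfolding q_def by (intro closed_Collect_le continuous_intros) simp_all
  then have [measurable]: "{p::'a \<times> real. q (fst p) \<le> snd p} \<in> sets (borel \<Otimes>\<^sub>M borel)"
    unfolding borel_prod by (rule borel_closed)
  have F': "F x \<sigma> = ennreal (g x * (indicator {p. q (fst p) \<le> snd p} (x, \<sigma>) * ((\<sigma> - q x) powr \<nu> * exp (- \<sigma>))))" for x \<sigma>
    by (simp add: F_def indicator_def)
  have meas [measurable]: "case_prod F \<in> borel_measurable (lborel \<Otimes>\<^sub>M lborel)"
    unfolding F' by measurable
  have "ennreal (Gamma (\<nu> + 1)) * (\<integral>\<^sup>+x. ennreal (g x * exp (- q x)) \<partial>lborel) =
     (\<integral>\<^sup>+x. ennreal (g x * exp (- q x)) * ennreal (Gamma (\<nu> + 1)) \<partial>lborel)"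
    by (subst nn_integral_cmult[symmetric]) (simp_all add: mult.commute)
  also have "\<dots> = (\<integral>\<^sup>+x. (\<integral>\<^sup>+\<sigma>. F x \<sigma> \<partial>lborel) \<partial>lborel)"
  proof (rule nn_integral_cong)
    fix x :: 'a
    have "ennreal (g x * exp (- q x)) * ennreal (Gamma (\<nu> + 1)) =
       (\<integral>\<^sup>+\<sigma>. ennreal (g x * exp (- q x)) * ennreal (indicator {q x..} \<sigma> * ((\<sigma> - q x) powr \<nu> * exp (q x - \<sigma>))) \<partial>lborel)"
      unfolding Gamma_nn_integral_shift[OF assms(4), of "q x"] by (subst nn_integral_cmult) simp_all
    also have "\<dots> = (\<integral>\<^sup>+\<sigma>. F x \<sigma> \<partial>lborel)"
    proof (rule nn_integral_cong)
      fix \<sigma> :: real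
      have "exp (- q x) * exp (q x - \<sigma>) = exp (- \<sigma>)" by (simp flip: exp_add)
      then have "g x * exp (- q x) * (indicator {q x..} \<sigma> * ((\<sigma> - q x) powr \<nu> * exp (q x - \<sigma>))) =
         g x * (indicator {q x..} \<sigma> * ((\<sigma> - q x) powr \<nu> * exp (- \<sigma>)))"
        by (metis (no_types, opaque_lifting) mult.assoc mult.left_commute)
      then show "ennreal (g x * exp (- q x)) * ennreal (indicator {q x..} \<sigma> * ((\<sigma> - q x) powr \<nu> * exp (q x - \<sigma>))) = F x \<sigma>"
        unfolding F_def using nonneg by (simp add: ennreal_mult'[symmetric])
    qed
    finally show "ennreal (g x * exp (- q x)) * ennreal (Gamma (\<nu> + 1)) = (\<integral>\<^sup>+\<sigma>. F x \<sigma> \<partial>lborel)" .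
  qed
  also have "\<dots> = (\<integral>\<^sup>+\<sigma>. (\<integral>\<^sup>+x. F x \<sigma> \<partial>lborel) \<partial>lborel)"
    by (rule lborel_pair.Fubini'[symmetric]) (rule meas)
  also have "\<dots> = (\<integral>\<^sup>+\<sigma>. ennreal (2 powr s) * ennreal (indicator {0..} \<sigma> * \<sigma> powr (s + \<nu>) / exp \<sigma>) * ball_integral g \<nu> \<partial>lborel)"
  proof (intro nn_integral_cong_AE)
    have "AE \<sigma> in lborel. \<sigma> \<noteq> (0::real)" by (rule AE_lborel_singleton)
    then show "AE \<sigma> in lborel. (\<integral>\<^sup>+x. F x \<sigma> \<partial>lborel) =
       ennreal (2 powr s) * ennreal (indicator {0..} \<sigma> * \<sigma> powr (s + \<nu>) / exp \<sigma>) * ball_integral g \<nu>"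
    proof eventually_elim
      case (elim \<sigma>)
      show ?case
      proof (cases "\<sigma> > 0")
        case True
        \<comment> \<open>For fixed \<sigma> the section is the ball of radius sqrt(2 \<sigma>). By
          homogeneity it contributes the unit ball integral times \<sigma> to the power s + \<nu>,
          and the integral over \<sigma> is then Gamma(s + \<nu> + 1).\<close>
        define r where "r = sqrt (2 * \<sigma>)"
        have r: "r > 0" "r\<^sup>2 = 2 * \<sigma>" using True by (simp_all add: r_def)
        have ind: "indicator {q x..} \<sigma> = (indicator (cball 0 r) x :: real)" for x
        proof -
          have "q x \<le> \<sigma> \<longleftrightarrow> (norm x)\<^sup>2 \<le> r\<^sup>2" by (simp add: q_def r(2)) linarith
          also have "\<dots> \<longleftrightarrow> norm x \<le> r" using r(1) by (simp add: abs_le_square_iff[symmetric])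
          finally show ?thesis by (simp add: indicator_def)
        qed
        have F2: "F x \<sigma> = ennreal (exp (- \<sigma>) * 2 powr (- \<nu>)) *
            ennreal (indicator (cball 0 r) x * (g x * (r\<^sup>2 - (norm x)\<^sup>2) powr \<nu>))" for x
        proof (cases "norm x \<le> r")
          case True
          then have "(norm x)\<^sup>2 \<le> r\<^sup>2" using r(1) by (simp add: abs_le_square_iff[symmetric])
          moreover have "\<sigma> - q x = (1/2) * (r\<^sup>2 - (norm x)\<^sup>2)" by (simp add: q_def r(2) field_simps)
          moreover have "(1/2) powr \<nu> = 2 powr (- \<nu>)" by (simp add: powr_divide powr_minus field_simps)
          ultimately have "(\<sigma> - q x) powr \<nu> = 2 powr (- \<nu>) * (r\<^sup>2 - (norm x)\<^sup>2) powr \<nu>"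
            by (metis powr_mult)
          then show ?thesis unfolding F_def ind using True nonneg
            by (simp add: ennreal_mult'[symmetric] algebra_simps)
        next
          case False
          then show ?thesis unfolding F_def ind by simp
        qed
        have "(\<integral>\<^sup>+x. F x \<sigma> \<partial>lborel) = ennreal (exp (- \<sigma>) * 2 powr (- \<nu>)) *
           (ennreal (r powr (m + real DIM('a) + 2 * \<nu>)) * ball_integral g \<nu>)"
          unfolding F2 by (subst nn_integral_cmult) (simp_all add: ball_integral_scaled[OF assms(1) hom r(1)])
        also have "\<dots> = ennreal (exp (- \<sigma>) * 2 powr (- \<nu>) * r powr (m + real DIM('a) + 2 * \<nu>)) * ball_integral g \<nu>"
          by (simp add: ennreal_mult' mult.assoc)
        also have "r powr (m + real DIM('a) + 2 * \<nu>) = (2 * \<sigma>) powr (s + \<nu>)"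
        proof -
          have "m + real DIM('a) + 2 * \<nu> = 2 * (s + \<nu>)" using s(1) by simp
          then have "r powr (m + real DIM('a) + 2 * \<nu>) = (r powr 2) powr (s + \<nu>)"
            by (simp only: powr_powr)
          also have "r powr 2 = 2 * \<sigma>" using r by (simp add: powr_numeral)
          finally show ?thesis .
        qed
        also have "exp (- \<sigma>) * 2 powr (- \<nu>) * (2 * \<sigma>) powr (s + \<nu>) = 2 powr s * (\<sigma> powr (s + \<nu>) / exp \<sigma>)"
          using True by (simp add: powr_mult powr_add powr_minus exp_minus field_simps)
        finally show ?thesis using True
          by (simp only: ennreal_mult'[OF powr_ge_zero] indicator_simps atLeast_iff less_imp_le) simp
      next
        case False
        have "\<not> (q x \<le> \<sigma>)" for x
        proof -
          have "q x \<ge> 0" by (simp add: q_def)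
          then show ?thesis using False elim by linarith
        qed
        then show ?thesis using False elim by (simp add: F_def indicator_def)
      qed
    qed
  qed
  also have "\<dots> = ennreal (2 powr s) * (\<integral>\<^sup>+\<sigma>. ennreal (indicator {0..} \<sigma> * \<sigma> powr (s + \<nu>) / exp \<sigma>) \<partial>lborel) * ball_integral g \<nu>"
    by (simp add: nn_integral_cmult nn_integral_multc)
  also have "(\<integral>\<^sup>+\<sigma>. ennreal (indicator {0..} \<sigma> * \<sigma> powr (s + \<nu>) / exp \<sigma>) \<partial>lborel) = ennreal (Gamma (s + \<nu> + 1))"
    using Gamma_conv_nn_integral_real[of "s + \<nu> + 1"] s(2) by simp
  finally show ?thesis by (simp add: q_def ennreal_mult')
qed

lemma nn_integral_abs_powr:
  assumes "p > - 1"
  shows "ball_integral (\<lambda>t::real. \<bar>t\<bar> powr p) 0 = ennreal (2 / (p + 1))"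
proof -
  have half: "(\<integral>\<^sup>+t. ennreal (indicator {0..1} t * t powr p) \<partial>lborel) = ennreal (1 / (p + 1))"
  proof -
    have "((\<lambda>t. t powr p) has_integral (1 / (p + 1))) {0..1::real}"
      using has_integral_powr_from_0[of p 1] assms by simp
    from nn_integral_has_integral_lebesgue[OF _ this] show ?thesis
      by (simp add: ennreal_mult' ennreal_indicator mult.commute)
  qed
  have "ball_integral (\<lambda>t::real. \<bar>t\<bar> powr p) 0 =
     (\<integral>\<^sup>+t. ennreal (indicator {0..1} t * t powr p) + ennreal (indicator {-1..0} t * (- t) powr p) \<partial>lborel)"
    unfolding ball_integral_def
  proof (intro nn_integral_cong_AE)
    \<comment> \<open>The endpoints are excluded because \<open>0 powr 0\<close> is 0 rather than
      1.\<close>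
    have "AE t in lborel. t \<notin> {0, 1, - 1 :: real}"
      by (intro AE_not_in countable_imp_null_set_lborel) auto
    then show "AE t in lborel. ennreal (indicator (cball 0 1) t * (\<bar>t\<bar> powr p * (1 - (norm t)\<^sup>2) powr 0)) =
        ennreal (indicator {0..1} t * t powr p) + ennreal (indicator {-1..0} t * (- t) powr p)"
    proof eventually_elim
      case (elim t)
      then show ?case by (cases "t > 0") (auto simp: indicator_def abs_square_eq_1)
    qed
  qed
  also have "\<dots> = ennreal (1 / (p + 1)) + (\<integral>\<^sup>+t. ennreal (indicator {-1..0} t * (- t) powr p) \<partial>lborel)"
    by (simp add: nn_integral_add half)
  also have "(\<integral>\<^sup>+t. ennreal (indicator {-1..0} t * (- t) powr p) \<partial>lborel) =
      (\<integral>\<^sup>+t. ennreal (indicator {-1..0} t * (- t) powr p) \<partial>distr lborel borel uminus)"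
    by (simp add: lborel_distr_uminus)
  also have "\<dots> = (\<integral>\<^sup>+t. ennreal (indicator {0..1} t * t powr p) \<partial>lborel)"
    by (subst nn_integral_distr) (auto simp: indicator_def intro!: nn_integral_cong)
  finally show ?thesis using assms by (simp add: half ennreal_plus[symmetric] del: ennreal_plus)
qed

text \<open>\<open>ball_integral_gauss\<close> involves the same Gaussian integral \<open>E\<close>
  for every exponent. The elementary exponent 0 determines \<open>E\<close>, and inserting it yields
  the Beta integral for \<nu>.\<close>

lemma ball_integral_abs_powr:
  assumes "p > - 1" "\<nu> > - 1"
  shows "ball_integral (\<lambda>t::real. \<bar>t\<bar> powr p) \<nu> =
    ennreal (Gamma (\<nu> + 1) * Gamma ((p + 1) / 2) / Gamma ((p + 1) / 2 + \<nu> + 1))"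
proof -
  define s where "s = (p + 1) / 2"
  have s: "s > 0" using assms by (simp add: s_def)
  have hom: "\<And>c t. c > 0 \<Longrightarrow> \<bar>c *\<^sub>R t\<bar> powr p = c powr p * \<bar>t :: real\<bar> powr p"
    by (simp add: abs_mult powr_mult)
  define E where "E = (\<integral>\<^sup>+t. ennreal (\<bar>t\<bar> powr p * exp (- (norm t)\<^sup>2 / 2)) \<partial>lborel)"
  have *: "ennreal (2 powr s * Gamma (s + \<mu> + 1)) * ball_integral (\<lambda>t::real. \<bar>t\<bar> powr p) \<mu> =
      ennreal (Gamma (\<mu> + 1)) * E" if "\<mu> > - 1" for \<mu>
  proof -
    have "s = (p + real DIM(real)) / 2" "s + \<mu> + 1 > 0" using s that by (simp add: s_def, linarith)
    then show ?thesis unfolding E_def by (intro ball_integral_gauss[OF _ _ hom that]) simp_all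
  qed
  have G: "Gamma (s + 1) = s * Gamma s" using s by (intro Gamma_plus1) (auto elim!: nonpos_Ints_cases)
  have "E = ennreal (2 powr s * Gamma (s + 1)) * ennreal (2 / (p + 1))"
    using *[of 0] nn_integral_abs_powr[OF assms(1)] by simp
  also have "\<dots> = ennreal (2 powr s * Gamma (s + 1) * (2 / (p + 1)))"
    using s by (simp add: ennreal_mult'[symmetric])
  also have "2 powr s * Gamma (s + 1) * (2 / (p + 1)) = 2 powr s * Gamma s"
    using assms(1) unfolding G by (simp add: s_def field_simps)
  finally have E: "E = ennreal (2 powr s * Gamma s)" .
  define D where "D = 2 powr s * Gamma (s + \<nu> + 1)"
  have D: "D > 0" using s assms(2) by (simp add: D_def)
  have "ball_integral (\<lambda>t::real. \<bar>t\<bar> powr p) \<nu> = ennreal (1 / D) * (ennreal D * ball_integral (\<lambda>t::real. \<bar>t\<bar> powr p) \<nu>)"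
    using D by (simp add: mult.assoc[symmetric] ennreal_mult'[symmetric])
  also have "\<dots> = ennreal (1 / D * (Gamma (\<nu> + 1) * (2 powr s * Gamma s)))"
    unfolding D_def *[OF assms(2)] E using D assms s by (simp add: ennreal_mult'[symmetric] D_def)
  also have "1 / D * (Gamma (\<nu> + 1) * (2 powr s * Gamma s)) = Gamma (\<nu> + 1) * Gamma s / Gamma (s + \<nu> + 1)"
    by (simp add: D_def)
  finally show ?thesis by (simp add: s_def)
qed

lemma double_cone_closed: "closed (double_cone :: ((real ^ 'd) \<times> real) set)"
proof -
  have "closed {p :: (real ^ 'd) \<times> real. norm (fst p) \<le> \<bar>snd p\<bar> \<and> - 1 \<le> snd p \<and> snd p \<le> 1}"
    by (intro closed_Collect_conj closed_Collect_le continuous_intros)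
  then show ?thesis by (simp add: double_cone_def case_prod_unfold)
qed

lemma double_cone_borel [measurable]: "double_cone \<in> sets borel"
  by (rule borel_closed) (rule double_cone_closed)

definition cone_fun :: "(real ^ 'd \<Rightarrow> real) \<Rightarrow> real \<Rightarrow> real \<Rightarrow> real \<Rightarrow> (real ^ 'd) \<times> real \<Rightarrow> real" where
  "cone_fun g a b \<nu> p = indicator double_cone p *
     (g (fst p) * (\<bar>snd p\<bar> powr a * (1 - (snd p)\<^sup>2) powr b * ((snd p)\<^sup>2 - (norm (fst p))\<^sup>2) powr \<nu>))"

lemma cone_fun_borel [measurable]:
  "g \<in> borel_measurable borel \<Longrightarrow> cone_fun g a b \<nu> \<in> borel_measurable borel"
proof -
  assume [measurable]: "g \<in> borel_measurable borel"
  have [measurable]: "double_cone \<in> sets (borel \<Otimes>\<^sub>M borel :: ((real ^ 'd) \<times> real) measure)"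
    unfolding borel_prod by (rule double_cone_borel)
  have "cone_fun g a b \<nu> \<in> borel_measurable (borel \<Otimes>\<^sub>M borel)"
    unfolding cone_fun_def[abs_def] by measurable
  then show ?thesis by (simp add: borel_prod)
qed

text \<open>For fixed t the section in x is the ball of radius |t|. Scaling it to the unit ball
  releases a power of |t| that joins the weight in t, and the two variables separate.\<close>

lemma cone_nn_integral:
  fixes g :: "real ^ 'd \<Rightarrow> real"
  assumes [measurable]: "g \<in> borel_measurable borel"
    and hom: "\<And>c x. c > 0 \<Longrightarrow> g (c *\<^sub>R x) = c powr m * g x"
  shows "(\<integral>\<^sup>+p. ennreal (cone_fun g a b \<nu> p) \<partial>lborel) =
    ball_integral g \<nu> * ball_integral (\<lambda>t::real. \<bar>t\<bar> powr (a + m + real CARD('d) + 2 * \<nu>)) b"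
proof -
  define q where "q = a + m + real CARD('d) + 2 * \<nu>"
  have "(\<integral>\<^sup>+p. ennreal (cone_fun g a b \<nu> p) \<partial>lborel) =
      (\<integral>\<^sup>+t. (\<integral>\<^sup>+x. ennreal (cone_fun g a b \<nu> (x, t)) \<partial>lborel) \<partial>lborel)"
    unfolding lborel_prod[symmetric]
    by (rule lborel_pair.nn_integral_snd[symmetric]) (simp add: lborel_prod)
  also have "\<dots> = (\<integral>\<^sup>+t. ball_integral g \<nu> *
      ennreal (indicator (cball 0 1) t * (\<bar>t\<bar> powr q * (1 - (norm t)\<^sup>2) powr b)) \<partial>lborel)"
  proof (intro nn_integral_cong_AE)
    have "AE t in lborel. t \<noteq> (0::real)" by (rule AE_lborel_singleton)
    then show "AE t in lborel. (\<integral>\<^sup>+x. ennreal (cone_fun g a b \<nu> (x, t)) \<partial>lborel) = ball_integral g \<nu> *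
      ennreal (indicator (cball 0 1) t * (\<bar>t\<bar> powr q * (1 - (norm t)\<^sup>2) powr b))"
    proof eventually_elim
      case (elim t)
      show ?case
      proof (cases "\<bar>t\<bar> \<le> 1")
        case True
        have eq: "cone_fun g a b \<nu> (x, t) = \<bar>t\<bar> powr a * (1 - t\<^sup>2) powr b *
           (indicator (cball 0 \<bar>t\<bar>) x * (g x * (\<bar>t\<bar>\<^sup>2 - (norm x)\<^sup>2) powr \<nu>))" for x
          using True by (auto simp: cone_fun_def double_cone_def indicator_def)
        have "(\<integral>\<^sup>+x. ennreal (cone_fun g a b \<nu> (x, t)) \<partial>lborel) =
          (\<integral>\<^sup>+x. ennreal (\<bar>t\<bar> powr a * (1 - t\<^sup>2) powr b) *
            ennreal (indicator (cball 0 \<bar>t\<bar>) x * (g x * (\<bar>t\<bar>\<^sup>2 - (norm x)\<^sup>2) powr \<nu>)) \<partial>lborel)"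
          unfolding eq by (simp only: ennreal_mult'[OF mult_nonneg_nonneg[OF powr_ge_zero powr_ge_zero]])
        also have "\<dots> = ennreal (\<bar>t\<bar> powr a * (1 - t\<^sup>2) powr b) *
          (\<integral>\<^sup>+x. ennreal (indicator (cball 0 \<bar>t\<bar>) x * (g x * (\<bar>t\<bar>\<^sup>2 - (norm x)\<^sup>2) powr \<nu>)) \<partial>lborel)"
          by (rule nn_integral_cmult) simp
        also have "\<dots> = ennreal (\<bar>t\<bar> powr a * (1 - t\<^sup>2) powr b) *
           (ennreal (\<bar>t\<bar> powr (m + real CARD('d) + 2 * \<nu>)) * ball_integral g \<nu>)"
          using elim by (subst ball_integral_scaled[OF assms(1) hom]) simp_all
        also have "\<dots> = ball_integral g \<nu> * ennreal (\<bar>t\<bar> powr q * (1 - t\<^sup>2) powr b)"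
        proof -
          have "\<bar>t\<bar> powr a * (1 - t\<^sup>2) powr b * \<bar>t\<bar> powr (m + real CARD('d) + 2 * \<nu>) = \<bar>t\<bar> powr q * (1 - t\<^sup>2) powr b"
            unfolding q_def by (simp add: powr_add algebra_simps)
          moreover have "ennreal A * (ennreal B * X) = X * ennreal (A * B)" if "A \<ge> 0" for A B and X :: ennreal
            using that by (simp add: ennreal_mult' mult_ac)
          ultimately show ?thesis by (metis mult_nonneg_nonneg powr_ge_zero)
        qed
        finally show ?thesis using True by simp
      next
        case False
        then have "cone_fun g a b \<nu> (x, t) = 0" for x
          by (auto simp: cone_fun_def double_cone_def indicator_def)
        then show ?thesis using False by simp
      qed
    qed
  qed
  also have "\<dots> = ball_integral g \<nu> * ball_integral (\<lambda>t::real. \<bar>t\<bar> powr q) b"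
    unfolding ball_integral_def[of "\<lambda>t::real. \<bar>t\<bar> powr q"] by (rule nn_integral_cmult) simp
  finally show ?thesis unfolding q_def .
qed

text \<open>The first quotient trades the unit ball for a Gaussian integral, with \<open>s\<close>
  half of degree plus dimension; the second is the integral over t, with \<open>r\<close> half of
  its exponent plus one.\<close>

definition cone_const :: "real \<Rightarrow> real \<Rightarrow> real \<Rightarrow> real \<Rightarrow> real" where
  "cone_const s r b \<nu> = Gamma (\<nu> + 1) / (2 powr s * Gamma (s + \<nu> + 1)) *
     (Gamma (b + 1) * Gamma r / Gamma (r + b + 1))"

text \<open>Nonnegative integrands are settled by extended integrals. A general g is the difference
  of its positive and negative parts, both of which inherit homogeneity.\<close>

lemma has_bochner_integral_cone_fun:
  fixes g :: "real ^ 'd \<Rightarrow> real"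
  assumes g: "g \<in> borel_measurable borel"
    and hom: "\<And>c x. c > 0 \<Longrightarrow> g (c *\<^sub>R x) = c powr m * g x"
    and int: "integrable lborel (\<lambda>x. g x * exp (- (norm x)\<^sup>2 / 2))"
    and \<nu>: "\<nu> > - 1" and b: "b > - 1" and s: "s = (m + real CARD('d)) / 2" "s \<ge> 0"
    and r: "r = (a + m + real CARD('d) + 2 * \<nu> + 1) / 2" "r > 0"
  shows "has_bochner_integral lborel (cone_fun g a b \<nu>)
    (cone_const s r b \<nu> * (LINT x|lborel. g x * exp (- (norm x)\<^sup>2 / 2)))"
proof -
  define C where "C = cone_const s r b \<nu>"
  have pos: "Gamma (\<nu> + 1) > 0" "Gamma (s + \<nu> + 1) > 0" "Gamma (b + 1) > 0" "Gamma r > 0" "Gamma (r + b + 1) > 0"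
    using \<nu> b s(2) r(2) by auto
  then have C: "C \<ge> 0" by (simp add: C_def cone_const_def)
  have nonneg: "has_bochner_integral lborel (cone_fun h a b \<nu>) (C * (LINT x|lborel. h x * exp (- (norm x)\<^sup>2 / 2)))"
    if h: "h \<in> borel_measurable borel" and h0: "\<And>x. h x \<ge> 0"
      and hhom: "\<And>c x. c > 0 \<Longrightarrow> h (c *\<^sub>R x) = c powr m * h x"
      and hint: "integrable lborel (\<lambda>x. h x * exp (- (norm x)\<^sup>2 / 2))" for h :: "real ^ 'd \<Rightarrow> real"
  proof -
    define I where "I = (LINT x|lborel. h x * exp (- (norm x)\<^sup>2 / 2))"
    have I: "(\<integral>\<^sup>+x. ennreal (h x * exp (- (norm x)\<^sup>2 / 2)) \<partial>lborel) = ennreal I" "I \<ge> 0"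
      unfolding I_def using hint h0 by (simp_all add: nn_integral_eq_integral)
    define D where "D = 2 powr s * Gamma (s + \<nu> + 1)"
    have D: "D > 0" using pos by (simp add: D_def)
    have "ball_integral h \<nu> = ennreal (1 / D) * (ennreal D * ball_integral h \<nu>)"
      using D by (simp add: mult.assoc[symmetric] ennreal_mult'[symmetric])
    also have "ennreal D * ball_integral h \<nu> = ennreal (Gamma (\<nu> + 1)) * ennreal I"
      unfolding D_def I(1)[symmetric] 
      by (rule ball_integral_gauss[OF h h0 hhom \<nu>]) (use s \<nu> in simp_all)
    also have "ennreal (1 / D) * \<dots> = ennreal (Gamma (\<nu> + 1) / D * I)"
      using D pos I(2) by (simp add: ennreal_mult'[symmetric])
    finally have "ball_integral h \<nu> = ennreal (Gamma (\<nu> + 1) / D * I)" .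
    moreover have "ball_integral (\<lambda>t::real. \<bar>t\<bar> powr (a + m + real CARD('d) + 2 * \<nu>)) b =
        ennreal (Gamma (b + 1) * Gamma r / Gamma (r + b + 1))"
      unfolding r(1) by (rule ball_integral_abs_powr) (use r b in auto)
    moreover have "(\<integral>\<^sup>+p. ennreal (cone_fun h a b \<nu> p) \<partial>lborel) =
        ball_integral h \<nu> * ball_integral (\<lambda>t::real. \<bar>t\<bar> powr (a + m + real CARD('d) + 2 * \<nu>)) b"
      by (rule cone_nn_integral[OF h hhom])
    moreover have "C * I = (Gamma (\<nu> + 1) / D * I) * (Gamma (b + 1) * Gamma r / Gamma (r + b + 1))"
      by (simp add: C_def cone_const_def D_def)
    ultimately have "(\<integral>\<^sup>+p. ennreal (cone_fun h a b \<nu> p) \<partial>lborel) = ennreal (C * I)"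
      using pos D I(2) by (simp only: ennreal_mult'[symmetric] mult_nonneg_nonneg divide_nonneg_pos less_imp_le)
    moreover have "cone_fun h a b \<nu> p \<ge> 0" for p
      unfolding cone_fun_def by (intro mult_nonneg_nonneg h0 powr_ge_zero) (simp add: indicator_def)
    ultimately show ?thesis unfolding I_def[symmetric]
      using C I(2) by (intro has_bochner_integral_nn_integral) (simp_all add: h cone_fun_borel)
  qed
  have hom_max: "max (g (c *\<^sub>R x)) 0 = c powr m * max (g x) 0"
    "max (- g (c *\<^sub>R x)) 0 = c powr m * max (- g x) 0" if "c > 0" for c x
    by (simp_all add: hom[OF that] max_def mult_le_0_iff zero_le_mult_iff)
  have int_max: "integrable lborel (\<lambda>x. max (g x) 0 * exp (- (norm x)\<^sup>2 / 2))"
     "integrable lborel (\<lambda>x. max (- g x) 0 * exp (- (norm x)\<^sup>2 / 2))"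
    using g by (auto intro!: Bochner_Integration.integrable_bound[OF int] simp: abs_mult)
  have "has_bochner_integral lborel
     (\<lambda>p. cone_fun (\<lambda>x. max (g x) 0) a b \<nu> p - cone_fun (\<lambda>x. max (- g x) 0) a b \<nu> p)
     (C * (LINT x|lborel. max (g x) 0 * exp (- (norm x)\<^sup>2 / 2)) -
      C * (LINT x|lborel. max (- g x) 0 * exp (- (norm x)\<^sup>2 / 2)))"
    using g by (intro has_bochner_integral_diff nonneg int_max hom_max) simp_all
  moreover have "cone_fun (\<lambda>x. max (g x) 0) a b \<nu> p - cone_fun (\<lambda>x. max (- g x) 0) a b \<nu> p = cone_fun g a b \<nu> p" for p
    unfolding cone_fun_def by (simp add: max_def)
  moreover have "C * (LINT x|lborel. max (g x) 0 * exp (- (norm x)\<^sup>2 / 2)) -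
      C * (LINT x|lborel. max (- g x) 0 * exp (- (norm x)\<^sup>2 / 2)) = C * (LINT x|lborel. g x * exp (- (norm x)\<^sup>2 / 2))"
  proof -
    have "(LINT x|lborel. max (g x) 0 * exp (- (norm x)\<^sup>2 / 2)) - (LINT x|lborel. max (- g x) 0 * exp (- (norm x)\<^sup>2 / 2)) =
       (LINT x|lborel. max (g x) 0 * exp (- (norm x)\<^sup>2 / 2) - max (- g x) 0 * exp (- (norm x)\<^sup>2 / 2))"
      using int_max by simp
    also have "\<dots> = (LINT x|lborel. g x * exp (- (norm x)\<^sup>2 / 2))"
      by (rule Bochner_Integration.integral_cong) (simp_all add: max_def)
    finally show ?thesis by (simp add: right_diff_distrib[symmetric])
  qed
  ultimately show ?thesis by (simp add: C_def)
qed

lemma double_cone_compact: "compact (double_cone :: ((real ^ 'd) \<times> real) set)"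
proof -
  have "bounded (double_cone :: ((real ^ 'd) \<times> real) set)"
  proof (rule bounded_subset)
    show "bounded (cball (0 :: real ^ 'd) 1 \<times> cball (0::real) 1)"
      by (intro bounded_Times bounded_cball)
    show "double_cone \<subseteq> cball (0 :: real ^ 'd) 1 \<times> cball (0::real) 1"
      by (auto simp: double_cone_def)
  qed
  then show ?thesis using double_cone_closed by (simp add: compact_eq_bounded_closed)
qed

text \<open>Each factor apart from g matches one factor of the weight, so integrating it amounts to
  shifting \<mu>, \<beta>, \<gamma> by h, u, l.\<close>

definition mono_fun :: "(real ^ 'd \<Rightarrow> real) \<Rightarrow> nat \<Rightarrow> nat \<Rightarrow> nat \<Rightarrow> (real ^ 'd) \<times> real \<Rightarrow> real" where
  "mono_fun g h u l p = g (fst p) * ((snd p)\<^sup>2 - (norm (fst p))\<^sup>2) ^ h * ((snd p)\<^sup>2) ^ u * (1 - (snd p)\<^sup>2) ^ l"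

text \<open>The case z = 0 is included: both sides are 0, since \<open>0 powr b\<close> is 0 for
  every b.\<close>

lemma power_mult_powr:
  fixes z :: real
  assumes "z \<ge> 0"
  shows "z ^ h * z powr a = z powr (a + real h)"
  using assms by (cases "z = 0") (auto simp: powr_add powr_realpow power_0_left)

lemma mono_fun_weight:
  "indicator double_cone p * (mono_fun g h u l p * cone_weight \<beta> \<gamma> \<mu> p) =
     cone_fun g (2 * \<beta> + 2 * real u) (\<gamma> - 1/2 + real l) (\<mu> - 1/2 + real h) p"
proof (cases "p \<in> double_cone")
  case True
  obtain x t where p: "p = (x, t)" by (cases p)
  have t: "norm x \<le> \<bar>t\<bar>" "\<bar>t\<bar> \<le> 1" using True p by (auto simp: double_cone_def)
  have "(norm x)\<^sup>2 \<le> t\<^sup>2" using t(1) by (simp add: abs_le_square_iff[symmetric])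
  then have 1: "(t\<^sup>2 - (norm x)\<^sup>2) ^ h * (t\<^sup>2 - (norm x)\<^sup>2) powr (\<mu> - 1/2) = (t\<^sup>2 - (norm x)\<^sup>2) powr (\<mu> - 1/2 + real h)"
    by (intro power_mult_powr) simp
  have 2: "(1 - t\<^sup>2) ^ l * (1 - t\<^sup>2) powr (\<gamma> - 1/2) = (1 - t\<^sup>2) powr (\<gamma> - 1/2 + real l)"
    using t(2) by (intro power_mult_powr) (simp add: abs_square_le_1)
  have "(t\<^sup>2) ^ u * \<bar>t\<bar> powr (2 * \<beta>) = \<bar>t\<bar> ^ (2 * u) * \<bar>t\<bar> powr (2 * \<beta>)"
    by (simp add: power_mult power_even_abs)
  also have "\<dots> = \<bar>t\<bar> powr (2 * \<beta> + 2 * real u)" using power_mult_powr[of "\<bar>t\<bar>" "2 * u" "2 * \<beta>"] by simp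
  finally have 3: "(t\<^sup>2) ^ u * \<bar>t\<bar> powr (2 * \<beta>) = \<bar>t\<bar> powr (2 * \<beta> + 2 * real u)" .
  show ?thesis using True unfolding p mono_fun_def cone_weight_def cone_fun_def 1[symmetric] 2[symmetric] fst_conv snd_conv 3[symmetric] prod.case
    by (simp only: mult_ac)
qed (simp add: cone_fun_def)

lemma gauss_density_exp:
  "gauss_density (x :: real ^ 'd) = (1 / sqrt (2 * pi)) ^ CARD('d) * exp (- (norm x)\<^sup>2 / 2)"
proof -
  have "gauss_density x = (\<Prod>i::'d\<in>UNIV. 1 / sqrt (2 * pi)) * (\<Prod>i\<in>UNIV. exp (- (x $ i)\<^sup>2 / 2))"
    unfolding gauss_density_def std_normal_density_def prod.distrib ..
  also have "(\<Prod>i\<in>UNIV. exp (- (x $ i)\<^sup>2 / 2)) = exp (\<Sum>i\<in>UNIV. - (x $ i)\<^sup>2 / 2)"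
    by (simp add: exp_sum)
  also have "(\<Sum>i\<in>UNIV. - (x $ i)\<^sup>2 / 2) = - (norm x)\<^sup>2 / 2"
    by (simp add: power2_norm_eq_inner inner_vec_def power2_eq_square[of "x $ _"] sum_negf sum_divide_distrib)
  finally show ?thesis by simp
qed

section \<open>Means with respect to the normalized cone weight\<close>

definition wint :: "real \<Rightarrow> real \<Rightarrow> real \<Rightarrow> ((real ^ 'd) \<times> real \<Rightarrow> real) \<Rightarrow> real" where
  "wint \<beta> \<gamma> \<mu> f = (LINT p:double_cone|lborel. f p * cone_weight \<beta> \<gamma> \<mu> p)"

text \<open>The value of \<open>cone_const\<close> at shifted parameters divided by the one at the
  original parameters, with Gamma quotients written as rising factorials; e is half the degree of
  the factor in x.\<close>

definition cone_moment :: "nat \<Rightarrow> real \<Rightarrow> real \<Rightarrow> real \<Rightarrow> nat \<Rightarrow> nat \<Rightarrow> nat \<Rightarrow> nat \<Rightarrow> real" where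
  "cone_moment d \<beta> \<gamma> \<mu> e h u l = pochhammer (\<mu> + 1/2) h / (2 ^ e * pochhammer (\<mu> + (real d + 1) / 2) (e + h)) *
     (pochhammer (alpha d \<beta> \<mu> + 1/2) (e + h + u) * pochhammer (\<gamma> + 1/2) l /
        pochhammer (alpha d \<beta> \<mu> + \<gamma> + 1) (e + h + u + l))"

lemma wint_mono_fun:
  fixes g :: "real ^ 'd \<Rightarrow> real"
  assumes g: "g \<in> borel_measurable borel"
    and hom: "\<And>c x. c > 0 \<Longrightarrow> g (c *\<^sub>R x) = c ^ m * g x"
    and int: "integrable lborel (\<lambda>x. g x * gauss_density x)"
    and par: "\<gamma> > - 1/2" "\<mu> > - 1/2" "alpha CARD('d) \<beta> \<mu> > - 1/2"
  defines "a \<equiv> alpha CARD('d) \<beta> \<mu>"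
  shows "set_integrable lborel double_cone (\<lambda>p. mono_fun g h u l p * cone_weight \<beta> \<gamma> \<mu> p)"
    and "wint \<beta> \<gamma> \<mu> (mono_fun g h u l) =
      cone_const ((real m + real CARD('d)) / 2) (a + 1/2 + real u + real m / 2 + real h) (\<gamma> - 1/2 + real l) (\<mu> - 1/2 + real h)
        * (sqrt (2 * pi) ^ CARD('d) * gauss_mean g)"
proof -
  let ?k = "sqrt (2 * pi) ^ CARD('d)"
  have k: "g x * exp (- (norm x)\<^sup>2 / 2) = ?k * (g x * gauss_density x)" for x
    by (simp add: gauss_density_exp power_divide)
  have int': "integrable lborel (\<lambda>x. g x * exp (- (norm x)\<^sup>2 / 2))"
    unfolding k using int by simp
  have I: "(LINT x|lborel. g x * exp (- (norm x)\<^sup>2 / 2)) = ?k * gauss_mean g"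
    unfolding k gauss_mean_def by simp
  have "has_bochner_integral lborel (cone_fun g (2 * \<beta> + 2 * real u) (\<gamma> - 1/2 + real l) (\<mu> - 1/2 + real h))
     (cone_const ((real m + real CARD('d)) / 2) (a + 1/2 + real u + real m / 2 + real h) (\<gamma> - 1/2 + real l) (\<mu> - 1/2 + real h)
       * (LINT x|lborel. g x * exp (- (norm x)\<^sup>2 / 2)))"
  proof (rule has_bochner_integral_cone_fun[OF g, of "real m"])
    show "g (c *\<^sub>R x) = c powr real m * g x" if "c > 0" for c x
      using hom[OF that] that by (simp add: powr_realpow)
  qed (use par int' in \<open>auto simp: a_def alpha_def field_simps\<close>)
  then have B: "has_bochner_integral lborel (\<lambda>p. indicator double_cone p * (mono_fun g h u l p * cone_weight \<beta> \<gamma> \<mu> p))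
     (cone_const ((real m + real CARD('d)) / 2) (a + 1/2 + real u + real m / 2 + real h) (\<gamma> - 1/2 + real l) (\<mu> - 1/2 + real h)
       * (?k * gauss_mean g))"
    unfolding mono_fun_weight I .
  then show "set_integrable lborel double_cone (\<lambda>p. mono_fun g h u l p * cone_weight \<beta> \<gamma> \<mu> p)"
    by (simp add: set_integrable_def has_bochner_integral_iff)
  show "wint \<beta> \<gamma> \<mu> (mono_fun g h u l) =
      cone_const ((real m + real CARD('d)) / 2) (a + 1/2 + real u + real m / 2 + real h) (\<gamma> - 1/2 + real l) (\<mu> - 1/2 + real h)
        * (?k * gauss_mean g)"
    using B by (simp add: wint_def set_lebesgue_integral_def has_bochner_integral_iff)
qed

lemma Gamma_add_nat:
  assumes "z > 0"
  shows "Gamma (z + real n) = pochhammer z n * Gamma (z :: real)"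
proof -
  have "z \<notin> \<int>\<^sub>\<le>\<^sub>0" using nonpos_Ints_nonpos[of z] assms by auto
  then have "pochhammer z n = Gamma (z + real n) / Gamma z" by (rule pochhammer_Gamma)
  then show ?thesis using Gamma_real_pos[OF assms] by simp
qed

lemma wint_one:
  assumes par: "\<gamma> > - 1/2" "\<mu> > - 1/2" "alpha CARD('d) \<beta> \<mu> > - 1/2"
  shows "set_integrable lborel double_cone (cone_weight \<beta> \<gamma> \<mu> :: (real ^ 'd) \<times> real \<Rightarrow> real)"
    and "wint \<beta> \<gamma> \<mu> (\<lambda>_ :: (real ^ 'd) \<times> real. 1) > 0"
    and "wint \<beta> \<gamma> \<mu> (\<lambda>_ :: (real ^ 'd) \<times> real. 1) =
       cone_const (real CARD('d) / 2) (alpha CARD('d) \<beta> \<mu> + 1/2) (\<gamma> - 1/2) (\<mu> - 1/2) * sqrt (2 * pi) ^ CARD('d)"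
proof -
  have one: "(\<lambda>_ :: (real ^ 'd) \<times> real. 1) = mono_fun (vmonom (\<lambda>_. 0)) 0 0 0"
    by (simp add: mono_fun_def vmonom_def fun_eq_iff)
  have g1: "gauss_mean (vmonom (\<lambda>_::'d. 0)) = 1"
    using normal_moment_even[of 0] by (simp add: gauss_mean_vmonom)
  have vb: "vmonom (\<lambda>_::'d. 0) \<in> borel_measurable borel" by (simp add: vmonom_def[abs_def])
  have vh: "\<And>c x. c > 0 \<Longrightarrow> vmonom (\<lambda>_::'d. 0) (c *\<^sub>R x) = c ^ 0 * vmonom (\<lambda>_. 0) x" by (simp add: vmonom_def)
  note W = wint_mono_fun[OF vb vh gauss_mean_vmonom(1) par, of 0 0 0, folded one]
  show "set_integrable lborel double_cone (cone_weight \<beta> \<gamma> \<mu> :: (real ^ 'd) \<times> real \<Rightarrow> real)"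
    using W(1) by simp
  show eq: "wint \<beta> \<gamma> \<mu> (\<lambda>_ :: (real ^ 'd) \<times> real. 1) =
       cone_const (real CARD('d) / 2) (alpha CARD('d) \<beta> \<mu> + 1/2) (\<gamma> - 1/2) (\<mu> - 1/2) * sqrt (2 * pi) ^ CARD('d)"
    using W(2) g1 by simp
  have "Gamma (\<mu> - 1/2 + 1) > 0" "Gamma (real CARD('d) / 2 + (\<mu> - 1/2) + 1) > 0" "Gamma (\<gamma> - 1/2 + 1) > 0"
    "Gamma (alpha CARD('d) \<beta> \<mu> + 1/2) > 0" "Gamma (alpha CARD('d) \<beta> \<mu> + 1/2 + (\<gamma> - 1/2) + 1) > 0"
    using par by auto
  then show "wint \<beta> \<gamma> \<mu> (\<lambda>_ :: (real ^ 'd) \<times> real. 1) > 0"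
    unfolding eq cone_const_def by simp
qed

definition cmean :: "real \<Rightarrow> real \<Rightarrow> real \<Rightarrow> ((real ^ 'd) \<times> real \<Rightarrow> real) \<Rightarrow> real" where
  "cmean \<beta> \<gamma> \<mu> f = wint \<beta> \<gamma> \<mu> f / wint \<beta> \<gamma> \<mu> (\<lambda>_ :: (real ^ 'd) \<times> real. 1)"

lemma cone_inner_conv_cmean:
  "cone_inner (cone_weight \<beta> \<gamma> \<mu>) f g = cmean \<beta> \<gamma> \<mu> (\<lambda>p. f p * g p)"
  by (simp add: cone_inner_def cmean_def wint_def)

text \<open>Odd degrees have no integer half degree; the second claim serves them, because their
  Gaussian means vanish.\<close>

lemma cmean_mono_fun:
  fixes g :: "real ^ 'd \<Rightarrow> real"
  assumes g: "g \<in> borel_measurable borel"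
    and hom: "\<And>c x. c > 0 \<Longrightarrow> g (c *\<^sub>R x) = c ^ m * g x"
    and int: "integrable lborel (\<lambda>x. g x * gauss_density x)"
    and par: "\<gamma> > - 1/2" "\<mu> > - 1/2" "alpha CARD('d) \<beta> \<mu> > - 1/2"
  shows "even m \<Longrightarrow> cmean \<beta> \<gamma> \<mu> (mono_fun g h u l) = cone_moment CARD('d) \<beta> \<gamma> \<mu> (m div 2) h u l * gauss_mean g"
    and "gauss_mean g = 0 \<Longrightarrow> cmean \<beta> \<gamma> \<mu> (mono_fun g h u l) = 0"
proof -
  define a where "a = alpha CARD('d) \<beta> \<mu>"
  have W: "wint \<beta> \<gamma> \<mu> (mono_fun g h u l) =
      cone_const ((real m + real CARD('d)) / 2) (a + 1/2 + real u + real m / 2 + real h) (\<gamma> - 1/2 + real l) (\<mu> - 1/2 + real h)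
        * (sqrt (2 * pi) ^ CARD('d) * gauss_mean g)"
    unfolding a_def by (rule wint_mono_fun(2)[OF g _ int par]) (rule hom)
  show "gauss_mean g = 0 \<Longrightarrow> cmean \<beta> \<gamma> \<mu> (mono_fun g h u l) = 0"
    unfolding cmean_def using W by simp
  show "cmean \<beta> \<gamma> \<mu> (mono_fun g h u l) = cone_moment CARD('d) \<beta> \<gamma> \<mu> (m div 2) h u l * gauss_mean g" if "even m"
  proof -
    define e where "e = m div 2"
    have m: "real m = 2 * real e" using that by (auto simp: e_def)
    define \<theta> where "\<theta> = \<mu> + (real CARD('d) + 1) / 2"
    have pos: "\<mu> + 1/2 > 0" "\<gamma> + 1/2 > 0" "a + 1/2 > 0" "\<theta> > 0" "a + \<gamma> + 1 > 0"
      using par by (simp_all add: a_def \<theta>_def field_simps add_pos_pos)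
    have A: "cone_const ((real m + real CARD('d)) / 2) (a + 1/2 + real u + real m / 2 + real h) (\<gamma> - 1/2 + real l) (\<mu> - 1/2 + real h) =
       Gamma (\<mu> + 1/2 + real h) / (2 powr (real CARD('d) / 2) * 2 ^ e * Gamma (\<theta> + real (e + h))) *
       (Gamma (\<gamma> + 1/2 + real l) * Gamma (a + 1/2 + real (e + h + u)) / Gamma (a + \<gamma> + 1 + real (e + h + u + l)))"
    proof -
      have "(real m + real CARD('d)) / 2 = real CARD('d) / 2 + real e" by (simp add: m)
      then have "2 powr ((real m + real CARD('d)) / 2) = 2 powr (real CARD('d) / 2) * 2 ^ e"
        by (simp only: powr_add powr_realpow zero_less_numeral)
      moreover have "\<mu> - 1/2 + real h + 1 = \<mu> + 1/2 + real h"
        "(real m + real CARD('d)) / 2 + (\<mu> - 1/2 + real h) + 1 = \<theta> + real (e + h)"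
        "\<gamma> - 1/2 + real l + 1 = \<gamma> + 1/2 + real l"
        "a + 1/2 + real u + real m / 2 + real h = a + 1/2 + real (e + h + u)"
        "a + 1/2 + real (e + h + u) + (\<gamma> - 1/2 + real l) + 1 = a + \<gamma> + 1 + real (e + h + u + l)"
        by (simp_all add: m \<theta>_def field_simps)
      ultimately show ?thesis unfolding cone_const_def by (simp only:)
    qed
    have B: "cone_const (real CARD('d) / 2) (a + 1/2) (\<gamma> - 1/2) (\<mu> - 1/2) =
       Gamma (\<mu> + 1/2) / (2 powr (real CARD('d) / 2) * Gamma \<theta>) * (Gamma (\<gamma> + 1/2) * Gamma (a + 1/2) / Gamma (a + \<gamma> + 1))"
    proof -
      have "\<mu> - 1/2 + 1 = \<mu> + 1/2" "real CARD('d) / 2 + (\<mu> - 1/2) + 1 = \<theta>"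
        "\<gamma> - 1/2 + 1 = \<gamma> + 1/2" "a + 1/2 + (\<gamma> - 1/2) + 1 = a + \<gamma> + 1"
        by (simp_all add: \<theta>_def field_simps)
      then show ?thesis unfolding cone_const_def by (simp only:)
    qed
    have G: "Gamma (\<mu> + 1/2) > 0" "Gamma \<theta> > 0" "Gamma (\<gamma> + 1/2) > 0" "Gamma (a + 1/2) > 0" "Gamma (a + \<gamma> + 1) > 0"
      using pos by auto
    have S: "sqrt (2 * pi) ^ CARD('d) > 0" by simp
    have E: "cmean \<beta> \<gamma> \<mu> (mono_fun g h u l) =
      (Gamma (\<mu> + 1/2 + real h) / (2 powr (real CARD('d) / 2) * 2 ^ e * Gamma (\<theta> + real (e + h))) *
       (Gamma (\<gamma> + 1/2 + real l) * Gamma (a + 1/2 + real (e + h + u)) / Gamma (a + \<gamma> + 1 + real (e + h + u + l))) * (sqrt (2 * pi) ^ CARD('d) * gauss_mean g)) /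
      (Gamma (\<mu> + 1/2) / (2 powr (real CARD('d) / 2) * Gamma \<theta>) * (Gamma (\<gamma> + 1/2) * Gamma (a + 1/2) / Gamma (a + \<gamma> + 1)) * sqrt (2 * pi) ^ CARD('d))"
      unfolding cmean_def W wint_one(3)[OF par] a_def[symmetric] A B ..
    show ?thesis
      unfolding E cone_moment_def a_def[symmetric] \<theta>_def[symmetric] e_def[symmetric]
        Gamma_add_nat[OF pos(1)] Gamma_add_nat[OF pos(2)] Gamma_add_nat[OF pos(3)] Gamma_add_nat[OF pos(4)] Gamma_add_nat[OF pos(5)]
      using G S by (simp add: mult_ac)
  qed
qed

text \<open>A continuous function is bounded on the compact cone, and the weight itself is
  integrable there.\<close>

lemma set_integrable_continuous_weight:
  fixes f :: "(real ^ 'd) \<times> real \<Rightarrow> real"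
  assumes par: "\<gamma> > - 1/2" "\<mu> > - 1/2" "alpha CARD('d) \<beta> \<mu> > - 1/2"
    and f: "continuous_on UNIV f"
  shows "set_integrable lborel double_cone (\<lambda>p. f p * cone_weight \<beta> \<gamma> \<mu> p)"
proof -
  have "compact (f ` double_cone)"
    by (rule compact_continuous_image[OF continuous_on_subset[OF f] double_cone_compact]) simp
  then obtain K where K: "\<And>p. p \<in> double_cone \<Longrightarrow> \<bar>f p\<bar> \<le> K"
    using compact_imp_bounded[of "f ` double_cone"] by (auto simp: bounded_iff)
  have fm: "f \<in> borel_measurable borel" using f by (rule borel_measurable_continuous_onI)
  have W: "integrable lborel (\<lambda>p :: (real ^ 'd) \<times> real. indicator double_cone p * cone_weight \<beta> \<gamma> \<mu> p :: real)"
    using wint_one(1)[OF par] by (simp add: set_integrable_def)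
  have m: "(\<lambda>p. f p * (indicator double_cone p * cone_weight \<beta> \<gamma> \<mu> p)) \<in> borel_measurable lborel"
    using borel_measurable_times[OF _ borel_measurable_integrable[OF W], of f] fm by simp
  have "integrable lborel (\<lambda>p. f p * (indicator double_cone p * cone_weight \<beta> \<gamma> \<mu> p))"
  proof (rule Bochner_Integration.integrable_bound[OF _ m])
    show "integrable lborel (\<lambda>p :: (real ^ 'd) \<times> real. K * (indicator double_cone p * cone_weight \<beta> \<gamma> \<mu> p))"
      using W by simp
    show "AE p in lborel. norm (f p * (indicator double_cone p * cone_weight \<beta> \<gamma> \<mu> p)) \<le>
        norm (K * (indicator double_cone p * cone_weight \<beta> \<gamma> \<mu> p))"
    proof (rule AE_I2)
      fix p :: "(real ^ 'd) \<times> real"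
      show "norm (f p * (indicator double_cone p * cone_weight \<beta> \<gamma> \<mu> p)) \<le>
        norm (K * (indicator double_cone p * cone_weight \<beta> \<gamma> \<mu> p))"
      proof (cases "p \<in> double_cone")
        case True
        then have "\<bar>f p\<bar> \<le> \<bar>K\<bar>" using K[OF True] by linarith
        then show ?thesis using True by (simp add: abs_mult mult_right_mono)
      qed simp
    qed
  qed
  then show ?thesis by (simp add: set_integrable_def mult.left_commute)
qed

context
  fixes \<beta> \<gamma> \<mu> :: real
  assumes g: "\<gamma> > - 1/2" and m: "\<mu> > - 1/2"
begin

lemma cmean_sum:
  fixes f :: "'i \<Rightarrow> (real ^ 'd) \<times> real \<Rightarrow> real"
  assumes a: "alpha CARD('d) \<beta> \<mu> > - 1/2" and f: "\<And>i. i \<in> I \<Longrightarrow> continuous_on UNIV (f i)"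
  shows "cmean \<beta> \<gamma> \<mu> (\<lambda>p. \<Sum>i\<in>I. f i p) = (\<Sum>i\<in>I. cmean \<beta> \<gamma> \<mu> (f i))"
proof -
  have i: "integrable lborel (\<lambda>p. indicator double_cone p * (f i p * cone_weight \<beta> \<gamma> \<mu> p))" if "i \<in> I" for i
    using set_integrable_continuous_weight[OF g m a f[OF that]] by (simp add: set_integrable_def)
  have "wint \<beta> \<gamma> \<mu> (\<lambda>p. \<Sum>i\<in>I. f i p) = (\<Sum>i\<in>I. wint \<beta> \<gamma> \<mu> (f i))"
    unfolding wint_def set_lebesgue_integral_def using i
    by (simp add: sum_distrib_left sum_distrib_right)
  then show ?thesis by (simp add: cmean_def sum_divide_distrib)
qed

lemma cmean_cmult: "cmean \<beta> \<gamma> \<mu> (\<lambda>p. c * f p) = c * cmean \<beta> \<gamma> \<mu> f"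
  by (simp add: cmean_def wint_def set_lebesgue_integral_def mult.assoc mult.left_commute)

lemma cmean_add:
  fixes f1 f2 :: "(real ^ 'd) \<times> real \<Rightarrow> real"
  assumes a: "alpha CARD('d) \<beta> \<mu> > - 1/2" and f: "continuous_on UNIV f1" "continuous_on UNIV f2"
  shows "cmean \<beta> \<gamma> \<mu> (\<lambda>p. f1 p + f2 p) = cmean \<beta> \<gamma> \<mu> f1 + cmean \<beta> \<gamma> \<mu> f2"
  using cmean_sum[OF a, of "{True, False}" "\<lambda>b. if b then f1 else f2"] f by simp

end

section \<open>Summation of the moment series\<close>

lemma exp_binomial:
  fixes A B :: real
  shows "(\<Sum>h\<le>b. A ^ (b - h) / fact (b - h) * (B ^ h / fact h)) = (A + B) ^ b / fact b"
proof -
  have "(A + B) ^ b / fact b = (\<Sum>h\<le>b. real (b choose h) * B ^ h * A ^ (b - h)) / fact b"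
    by (subst add.commute) (simp add: binomial_ring)
  also have "\<dots> = (\<Sum>h\<le>b. A ^ (b - h) / fact (b - h) * (B ^ h / fact h))"
    unfolding sum_divide_distrib by (intro sum.cong) (simp_all add: binomial_fact field_simps)
  finally show ?thesis ..
qed

text \<open>Both sides are the part of degree M of D^i exp(D) exp(R).\<close>

lemma exp_binomial_shift:
  fixes D R :: real
  shows "(\<Sum>l\<le>M. D ^ (M - l) * inv_fact_diff (M - l) i * (R ^ l / fact l)) =
     D ^ i * (D + R) ^ (M - i) * inv_fact_diff M i"
proof (cases "i \<le> M")
  case True
  have "(\<Sum>l\<le>M. D ^ (M - l) * inv_fact_diff (M - l) i * (R ^ l / fact l)) =
     (\<Sum>l\<le>M - i. D ^ (M - l) * inv_fact_diff (M - l) i * (R ^ l / fact l))"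
    by (rule sum.mono_neutral_right) (auto simp: inv_fact_diff_def)
  also have "\<dots> = (\<Sum>l\<le>M - i. D ^ i * (D ^ (M - i - l) / fact (M - i - l) * (R ^ l / fact l)))"
  proof (rule sum.cong)
    fix l assume "l \<in> {..M - i}"
    then have "i \<le> M - l" "M - l = i + (M - i - l)" using True by auto
    then show "D ^ (M - l) * inv_fact_diff (M - l) i * (R ^ l / fact l) =
        D ^ i * (D ^ (M - i - l) / fact (M - i - l) * (R ^ l / fact l))"
      by (simp add: inv_fact_diff_def power_add[symmetric] diff_diff_add add.commute)
  qed simp
  finally show ?thesis using True
    by (simp only: sum_distrib_left[symmetric] exp_binomial) (simp add: inv_fact_diff_def)
qed (auto simp: inv_fact_diff_def intro!: sum.neutral)

text \<open>Integrating a monomial against the exponential kernel of a fixed degree produces sums of these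
  terms, where \<open>a\<close> is the index of a coefficient in the Gaussian expansion.\<close>

definition cone_term :: "real \<Rightarrow> real \<Rightarrow> nat \<Rightarrow> nat \<Rightarrow> nat \<Rightarrow> nat \<Rightarrow> real \<Rightarrow> real \<Rightarrow> real \<Rightarrow> nat \<Rightarrow> nat \<Rightarrow> nat \<Rightarrow> real" where
  "cone_term \<theta> \<delta> p a e M A B R l j h =
     A ^ (M - l - j - h) / fact (M - l - j - h) * (B ^ h / fact h) * (hagen j \<delta> * (A + B) ^ j) * (R ^ l / fact l) *
     (pochhammer \<theta> (p + 2 * (M - l - j)) / pochhammer \<theta> (p + a + (M - l - j)) *
      (pochhammer (\<theta> + \<delta>) (p + a + e + (M - l)) / pochhammer (\<theta> + \<delta>) (p + 2 * (M - l))))"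

text \<open>The sums collapse from the inside: h by the binomial theorem to powers of A + B, j by
  \<open>central_convolution\<close>, l by \<open>exp_binomial_shift\<close>. Essential are that c
  does not depend on M, hence not on the degree of the kernel, and the value of its top
  entry.\<close>

lemma cone_triple_sum:
  assumes \<theta>: "\<theta> > 0" and \<delta>: "\<delta> \<ge> 0"
  shows "\<exists>c. c (a + e) = (if a = 0 then 1 else 0) \<and>
    (\<forall>A B R M. (\<Sum>l\<le>M. \<Sum>j\<le>M - l. \<Sum>h\<le>M - l - j. cone_term \<theta> \<delta> p a e M A B R l j h) =
      (\<Sum>i\<le>a + e. c i * ((A + B) ^ i * (A + B + R) ^ (M - i) * inv_fact_diff M i)))"
proof -
  define \<phi> where "\<phi> = \<theta> + real p"
  have \<phi>: "\<phi> > 0" "\<phi> + \<delta> > 0" using assms by (simp_all add: \<phi>_def)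
  have th: "pochhammer \<theta> (p + x) = pochhammer \<theta> p * pochhammer \<phi> x"
    "pochhammer (\<theta> + \<delta>) (p + x) = pochhammer (\<theta> + \<delta>) p * pochhammer (\<phi> + \<delta>) x" for x
    using pochhammer_product'[of \<theta> p x] pochhammer_product'[of "\<theta> + \<delta>" p x] by (simp_all add: \<phi>_def algebra_simps)
  have nz: "pochhammer \<theta> p > 0" "pochhammer (\<theta> + \<delta>) p > 0" using assms by (simp_all add: pochhammer_pos)
  have r1: "pochhammer \<theta> (p + 2 * b) / pochhammer \<theta> (p + a + b) = pochhammer \<phi> (2 * b) / pochhammer \<phi> (a + b)" for b
    unfolding add.assoc th using nz by simp
  have r2: "pochhammer (\<theta> + \<delta>) (p + a + e + N) / pochhammer (\<theta> + \<delta>) (p + 2 * N) =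
      pochhammer (\<phi> + \<delta>) (a + e + N) / pochhammer (\<phi> + \<delta>) (2 * N)" for N
    unfolding add.assoc th using nz by simp
  obtain f where f: "fall_poly a f (if a = 0 then 1 else 0)"
    "\<And>N. (\<Sum>b\<le>N. central a \<phi> b * hagen (N - b) \<delta>) = f N * central a (\<phi> + \<delta>) N"
    using central_convolution[OF \<phi>(1) \<delta>] by blast
  \<comment> \<open>The rising factorial of length e comes from the factor t^(2e) of the monomial;
    it raises the degree by e and keeps the leading coefficient.\<close>
  have "fall_poly (a + e) (\<lambda>N. pochhammer (\<phi> + \<delta> + real a + real N) e * f N) (if a = 0 then 1 else 0)"
    by (rule fall_poly_pochhammer) (rule f)
  then obtain c where c: "c (a + e) = (if a = 0 then 1 else 0)"
    "\<And>N. pochhammer (\<phi> + \<delta> + real a + real N) e * f N / fact N = (\<Sum>i\<le>a + e. c i * inv_fact_diff N i)"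
    unfolding fall_poly_def by blast
  \<comment> \<open>The sum over j is the convolution at N, proportional to
    \<open>central a (\<phi> + \<delta>) N\<close>. Its numerator and most of its denominator cancel
    against the quotient outside the sum.\<close>
  have inner: "(\<Sum>j\<le>N. hagen j \<delta> / fact (N - j) * (pochhammer \<phi> (2 * (N - j)) / pochhammer \<phi> (a + (N - j)))) *
      (pochhammer (\<phi> + \<delta>) (a + e + N) / pochhammer (\<phi> + \<delta>) (2 * N)) = (\<Sum>i\<le>a + e. c i * inv_fact_diff N i)" for N
  proof -
    have "(\<Sum>j\<le>N. hagen j \<delta> / fact (N - j) * (pochhammer \<phi> (2 * (N - j)) / pochhammer \<phi> (a + (N - j)))) =
       (\<Sum>j\<le>N. hagen j \<delta> * central a \<phi> (N - j))"
      by (simp add: central_def mult_ac)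
    also have "\<dots> = (\<Sum>b\<le>N. central a \<phi> b * hagen (N - b) \<delta>)"
      by (rule sum.reindex_bij_witness[of _ "\<lambda>b. N - b" "\<lambda>b. N - b"]) (auto simp: mult.commute)
    also have "\<dots> = f N * central a (\<phi> + \<delta>) N" by (rule f)
    finally have s: "(\<Sum>j\<le>N. hagen j \<delta> / fact (N - j) * (pochhammer \<phi> (2 * (N - j)) / pochhammer \<phi> (a + (N - j)))) =
       f N * central a (\<phi> + \<delta>) N" .
    have q: "pochhammer (\<phi> + \<delta>) (a + e + N) = pochhammer (\<phi> + \<delta>) (a + N) * pochhammer (\<phi> + \<delta> + real a + real N) e"
      using pochhammer_product'[of "\<phi> + \<delta>" "a + N" e] by (simp add: algebra_simps)
    have "pochhammer (\<phi> + \<delta>) (a + N) > 0" "pochhammer (\<phi> + \<delta>) (2 * N) > 0"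
      using \<phi>(2) by (simp_all add: pochhammer_pos)
    then show ?thesis unfolding s q c(2)[symmetric] central_def by simp
  qed
  show ?thesis
  proof (intro exI[of _ c] conjI allI)
    fix A B R :: real and M :: nat
    have "(\<Sum>l\<le>M. \<Sum>j\<le>M - l. \<Sum>h\<le>M - l - j. cone_term \<theta> \<delta> p a e M A B R l j h) =
      (\<Sum>l\<le>M. \<Sum>j\<le>M - l. (A + B) ^ (M - l - j) / fact (M - l - j) * (hagen j \<delta> * (A + B) ^ j) * (R ^ l / fact l) *
       (pochhammer \<phi> (2 * (M - l - j)) / pochhammer \<phi> (a + (M - l - j)) *
        (pochhammer (\<phi> + \<delta>) (a + e + (M - l)) / pochhammer (\<phi> + \<delta>) (2 * (M - l)))))"
      unfolding cone_term_def r1 r2 sum_distrib_right[symmetric] exp_binomial ..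
    also have "\<dots> = (\<Sum>l\<le>M. (A + B) ^ (M - l) * (R ^ l / fact l) *
       ((\<Sum>j\<le>M - l. hagen j \<delta> / fact (M - l - j) * (pochhammer \<phi> (2 * (M - l - j)) / pochhammer \<phi> (a + (M - l - j)))) *
        (pochhammer (\<phi> + \<delta>) (a + e + (M - l)) / pochhammer (\<phi> + \<delta>) (2 * (M - l)))))"
      unfolding sum_distrib_left sum_distrib_right
    proof (intro sum.cong refl)
      fix l j assume "j \<in> {..M - l}"
      then have "(A + B) ^ (M - l) = (A + B) ^ (M - l - j) * (A + B) ^ j"
        by (metis atMost_iff le_add_diff_inverse2 power_add)
      then show "(A + B) ^ (M - l - j) / fact (M - l - j) * (hagen j \<delta> * (A + B) ^ j) * (R ^ l / fact l) *
       (pochhammer \<phi> (2 * (M - l - j)) / pochhammer \<phi> (a + (M - l - j)) *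
        (pochhammer (\<phi> + \<delta>) (a + e + (M - l)) / pochhammer (\<phi> + \<delta>) (2 * (M - l)))) =
        (A + B) ^ (M - l) * (R ^ l / fact l) *
       (hagen j \<delta> / fact (M - l - j) * (pochhammer \<phi> (2 * (M - l - j)) / pochhammer \<phi> (a + (M - l - j))) *
        (pochhammer (\<phi> + \<delta>) (a + e + (M - l)) / pochhammer (\<phi> + \<delta>) (2 * (M - l))))"
        by (simp only:) (simp add: mult.assoc mult.left_commute)
    qed
    also have "\<dots> = (\<Sum>l\<le>M. \<Sum>i\<le>a + e. c i * ((A + B) ^ (M - l) * inv_fact_diff (M - l) i * (R ^ l / fact l)))"
      unfolding inner by (simp only: sum_distrib_left mult_ac)
    also have "\<dots> = (\<Sum>i\<le>a + e. c i * ((A + B) ^ i * (A + B + R) ^ (M - i) * inv_fact_diff M i))"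
      by (subst sum.swap) (simp only: sum_distrib_left[symmetric] exp_binomial_shift)
    finally show "(\<Sum>l\<le>M. \<Sum>j\<le>M - l. \<Sum>h\<le>M - l - j. cone_term \<theta> \<delta> p a e M A B R l j h) =
      (\<Sum>i\<le>a + e. c i * ((A + B) ^ i * (A + B + R) ^ (M - i) * inv_fact_diff M i))" .
  qed (rule c)
qed

section \<open>The kernel of the exponential series\<close>

text \<open>\<open>exp_full\<close> is the average of \<open>\<zeta>\<^sup>n / n!\<close>, taken successively over \<open>u\<close>, over \<open>z\<close> and over \<open>v\<close>, with
  \<open>P\<close>, \<open>W\<close>, \<open>T\<close>, \<open>R\<close> for \<open>\<langle>x, y\<rangle>\<close>, \<open>(t\<^sup>2 - |x|\<^sup>2)(s\<^sup>2 - |y|\<^sup>2)\<close>, \<open>t\<^sup>2 s\<^sup>2\<close>, \<open>(1 - t\<^sup>2)(1 - s\<^sup>2)\<close>. It makes sense also when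
  an exponent of the weights equals -1.\<close>

definition exp_ball :: "real \<Rightarrow> nat \<Rightarrow> real \<Rightarrow> real \<Rightarrow> real" where
  "exp_ball \<mu> i P W = (\<Sum>h\<le>i div 2. P ^ (i - 2 * h) / fact (i - 2 * h) * ((W / 4) ^ h / (fact h * pochhammer (\<mu> + 1/2) h)))"

definition exp_cone :: "nat \<Rightarrow> real \<Rightarrow> real \<Rightarrow> nat \<Rightarrow> real \<Rightarrow> real \<Rightarrow> real \<Rightarrow> real" where
  "exp_cone d \<beta> \<mu> k P W T = (\<Sum>j\<le>k div 2. exp_ball \<mu> (k - 2 * j) P W *
     (pochhammer (\<mu> + (real d + 1) / 2) (k - 2 * j) * hagen j (\<beta> - 1/2) / (4 ^ j * pochhammer (alpha d \<beta> \<mu> + 1/2) k) * T ^ j))"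

definition exp_full :: "nat \<Rightarrow> real \<Rightarrow> real \<Rightarrow> real \<Rightarrow> nat \<Rightarrow> real \<Rightarrow> real \<Rightarrow> real \<Rightarrow> real \<Rightarrow> real" where
  "exp_full d \<beta> \<gamma> \<mu> n P W T R = (\<Sum>l\<le>n div 2. exp_cone d \<beta> \<mu> (n - 2 * l) P W T *
     ((R / 4) ^ l / (fact l * pochhammer (\<gamma> + 1/2) l)))"

definition exp_kernel :: "real \<Rightarrow> real \<Rightarrow> real \<Rightarrow> nat \<Rightarrow> (real ^ 'd) \<times> real \<Rightarrow> (real ^ 'd) \<times> real \<Rightarrow> real" where
  "exp_kernel \<beta> \<gamma> \<mu> n p q = exp_full CARD('d) \<beta> \<gamma> \<mu> n (fst p \<bullet> fst q)
     (((snd p)\<^sup>2 - (norm (fst p))\<^sup>2) * ((snd q)\<^sup>2 - (norm (fst q))\<^sup>2)) ((snd p)\<^sup>2 * (snd q)\<^sup>2)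
     ((1 - (snd p)\<^sup>2) * (1 - (snd q)\<^sup>2))"

abbreviation exp_mean :: "real \<Rightarrow> real \<Rightarrow> real \<Rightarrow> nat \<Rightarrow> ((real ^ 'd) \<times> real \<Rightarrow> real) \<Rightarrow> (real ^ 'd) \<times> real \<Rightarrow> real" where
  "exp_mean \<beta> \<gamma> \<mu> n f q \<equiv> cmean \<beta> \<gamma> \<mu> (\<lambda>p. f p * exp_kernel \<beta> \<gamma> \<mu> n p q)"

definition even_monom :: "('d::finite \<Rightarrow> nat) \<Rightarrow> nat \<Rightarrow> (real ^ 'd) \<times> real \<Rightarrow> real" where
  "even_monom k e p = vmonom k (fst p) * ((snd p)\<^sup>2) ^ e"

definition exp_coeff :: "nat \<Rightarrow> real \<Rightarrow> real \<Rightarrow> real \<Rightarrow> nat \<Rightarrow> (real ^ 'd) \<times> real \<Rightarrow> nat \<Rightarrow> nat \<Rightarrow> nat \<Rightarrow> real" where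
  "exp_coeff d \<beta> \<gamma> \<mu> n q l j h = (((snd q)\<^sup>2 - (norm (fst q))\<^sup>2) / 4) ^ h / (fact h * pochhammer (\<mu> + 1/2) h) *
    (pochhammer (\<mu> + (real d + 1) / 2) (n - 2 * l - 2 * j) * hagen j (\<beta> - 1/2) /
      (4 ^ j * pochhammer (alpha d \<beta> \<mu> + 1/2) (n - 2 * l)) * ((snd q)\<^sup>2) ^ j) *
    (((1 - (snd q)\<^sup>2) / 4) ^ l / (fact l * pochhammer (\<gamma> + 1/2) l))"

text \<open>Separates the variables. The power of <x, y> stays with p, inside
  \<open>mono_fun\<close>, so that its mean becomes a \<open>gauss_moment\<close>; the rest of the
  dependence on q is in \<open>exp_coeff\<close>.\<close>

lemma even_monom_exp_kernel:
  "even_monom k e p * exp_kernel \<beta> \<gamma> \<mu> n p q =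
    (\<Sum>l\<le>n div 2. \<Sum>j\<le>(n - 2 * l) div 2. \<Sum>h\<le>(n - 2 * l - 2 * j) div 2.
       (exp_coeff CARD('d) \<beta> \<gamma> \<mu> n q l j h / fact (n - 2 * l - 2 * j - 2 * h)) *
       mono_fun (\<lambda>x. vmonom k x * (x \<bullet> fst q) ^ (n - 2 * l - 2 * j - 2 * h)) h (j + e) l p)"
  for p q :: "(real ^ 'd) \<times> real"
  unfolding exp_kernel_def exp_full_def exp_cone_def exp_ball_def sum_distrib_left sum_distrib_right
proof (intro sum.cong refl)
  fix l j h
  show "even_monom k e p * ((fst p \<bullet> fst q) ^ (n - 2 * l - 2 * j - 2 * h) / fact (n - 2 * l - 2 * j - 2 * h) *
       ((((snd p)\<^sup>2 - (norm (fst p))\<^sup>2) * ((snd q)\<^sup>2 - (norm (fst q))\<^sup>2) / 4) ^ h / (fact h * pochhammer (\<mu> + 1/2) h)) *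
       (pochhammer (\<mu> + (real CARD('d) + 1) / 2) (n - 2 * l - 2 * j) * hagen j (\<beta> - 1/2) /
         (4 ^ j * pochhammer (alpha CARD('d) \<beta> \<mu> + 1/2) (n - 2 * l)) * ((snd p)\<^sup>2 * (snd q)\<^sup>2) ^ j) *
       (((1 - (snd p)\<^sup>2) * (1 - (snd q)\<^sup>2) / 4) ^ l / (fact l * pochhammer (\<gamma> + 1/2) l))) =
     (exp_coeff CARD('d) \<beta> \<gamma> \<mu> n q l j h / fact (n - 2 * l - 2 * j - 2 * h)) *
       mono_fun (\<lambda>x. vmonom k x * (x \<bullet> fst q) ^ (n - 2 * l - 2 * j - 2 * h)) h (j + e) l p"
    unfolding exp_coeff_def mono_fun_def even_monom_def times_divide_eq_right[symmetric] power_mult_distrib power_add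
    by (simp only: mult_ac times_divide_eq_right times_divide_eq_left divide_divide_eq_left divide_divide_eq_right)
qed

lemma vmonom_continuous [continuous_intros]: "continuous_on S f \<Longrightarrow> continuous_on S (\<lambda>x. vmonom k (f x))"
  unfolding vmonom_def by (intro continuous_intros)

lemma mono_fun_continuous:
  assumes "continuous_on UNIV g"
  shows "continuous_on UNIV (mono_fun g h u l)"
proof -
  have "continuous_on UNIV (\<lambda>p. g (fst p))"
    by (rule continuous_on_compose2[OF assms continuous_on_fst[OF continuous_on_id]]) simp
  then show ?thesis unfolding mono_fun_def[abs_def] by (intro continuous_intros)
qed

lemma vmonom_scaleR: "vmonom k (c *\<^sub>R x) = c ^ sum k UNIV * vmonom k x"
  by (simp add: vmonom_def power_mult_distrib prod.distrib power_sum)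

text \<open>For even n + j this is 1 / ((n - j)/2 + a)!, read as 0 when the argument is
  negative.\<close>

definition inv_fact_step :: "nat \<Rightarrow> nat \<Rightarrow> nat \<Rightarrow> real" where
  "inv_fact_step n j a = (if j \<le> n + 2 * a then 1 / fact ((n + 2 * a - j) div 2) else 0)"

text \<open>The point is that one \<open>F\<close> serves all n: with the rising factorial and the
  power of 2 multiplied out, n enters the right-hand side through \<open>inv_fact_step\<close> only.
  The degree j is an assigned one and may exceed the true degree of f.\<close>

definition has_expansion ::
  "real \<Rightarrow> real \<Rightarrow> real \<Rightarrow> nat \<Rightarrow> ((real ^ 'd) \<times> real \<Rightarrow> real) \<Rightarrow> (nat \<Rightarrow> (real ^ 'd) \<times> real \<Rightarrow> real) \<Rightarrow> bool" where
  "has_expansion \<beta> \<gamma> \<mu> j f F \<longleftrightarrow> F 0 = f \<and>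
    (\<forall>n q. (odd (n + j) \<longrightarrow> exp_mean \<beta> \<gamma> \<mu> n f q = 0) \<and>
     (even (n + j) \<longrightarrow> exp_mean \<beta> \<gamma> \<mu> n f q *
        pochhammer (alpha CARD('d) \<beta> \<mu> + \<gamma> + 1) ((n + j) div 2) * 2 ^ n =
        (\<Sum>a\<le>j div 2. F a q * inv_fact_step n j a)))"

text \<open>Beyond l + j + h = M the exponential terms will have negative degree, so the range given
  by n reduces to a simplex of size M.\<close>

lemma triple_sum_shrink:
  fixes f :: "nat \<Rightarrow> nat \<Rightarrow> nat \<Rightarrow> real"
  assumes "2 * M \<le> n" and "\<And>l j h. M < l + j + h \<Longrightarrow> 2 * (l + j + h) \<le> n \<Longrightarrow> f l j h = 0"
  shows "(\<Sum>l\<le>n div 2. \<Sum>j\<le>(n - 2 * l) div 2. \<Sum>h\<le>(n - 2 * l - 2 * j) div 2. f l j h) =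
    (\<Sum>l\<le>M. \<Sum>j\<le>M - l. \<Sum>h\<le>M - l - j. f l j h)"
proof -
  have h: "(\<Sum>h\<le>(n - 2 * l - 2 * j) div 2. f l j h) = (\<Sum>h\<le>M - l - j. f l j h)" if "l + j \<le> M" for l j
    using that assms(1) by (intro sum.mono_neutral_right ballI assms(2)) auto
  have h0: "(\<Sum>h\<le>(n - 2 * l - 2 * j) div 2. f l j h) = 0" if "l + j > M" "2 * (l + j) \<le> n" for l j
    using that by (intro sum.neutral ballI assms(2)) auto
  have j: "(\<Sum>j\<le>(n - 2 * l) div 2. \<Sum>h\<le>(n - 2 * l - 2 * j) div 2. f l j h) =
      (\<Sum>j\<le>M - l. \<Sum>h\<le>M - l - j. f l j h)" if "l \<le> M" for l
  proof -
    have "(\<Sum>j\<le>(n - 2 * l) div 2. \<Sum>h\<le>(n - 2 * l - 2 * j) div 2. f l j h) =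
      (\<Sum>j\<le>M - l. \<Sum>h\<le>(n - 2 * l - 2 * j) div 2. f l j h)"
      using that assms(1) by (intro sum.mono_neutral_right ballI h0) auto
    also have "\<dots> = (\<Sum>j\<le>M - l. \<Sum>h\<le>M - l - j. f l j h)"
      by (intro sum.cong refl h) (use that in auto)
    finally show ?thesis .
  qed
  have j0: "(\<Sum>j\<le>(n - 2 * l) div 2. \<Sum>h\<le>(n - 2 * l - 2 * j) div 2. f l j h) = 0" if "l > M" "2 * l \<le> n" for l
    using that by (intro sum.neutral ballI h0) auto
  have "(\<Sum>l\<le>n div 2. \<Sum>j\<le>(n - 2 * l) div 2. \<Sum>h\<le>(n - 2 * l - 2 * j) div 2. f l j h) =
     (\<Sum>l\<le>M. \<Sum>j\<le>(n - 2 * l) div 2. \<Sum>h\<le>(n - 2 * l - 2 * j) div 2. f l j h)"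
    using assms(1) by (intro sum.mono_neutral_right ballI j0) auto
  also have "\<dots> = (\<Sum>l\<le>M. \<Sum>j\<le>M - l. \<Sum>h\<le>M - l - j. f l j h)"
    by (intro sum.cong refl j) auto
  finally show ?thesis .
qed

text \<open>Sorts by b = a + e - i, which is going to be the index of the coefficient in the
  expansion.\<close>

lemma sum_antidiagonal:
  fixes G :: "nat \<Rightarrow> nat \<Rightarrow> real"
  shows "(\<Sum>a\<le>m. \<Sum>i\<le>a + e. G a i) = (\<Sum>b\<le>m + e. \<Sum>a\<in>{a. a \<le> m \<and> b \<le> a + e}. G a (a + e - b))"
proof -
  have "(\<Sum>a\<le>m. \<Sum>i\<le>a + e. G a i) = (\<Sum>a\<le>m. \<Sum>b\<le>a + e. G a (a + e - b))"
  proof (rule sum.cong[OF refl])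
    fix a
    show "(\<Sum>i\<le>a + e. G a i) = (\<Sum>b\<le>a + e. G a (a + e - b))"
      by (rule sum.reindex_bij_witness[of _ "\<lambda>b. a + e - b" "\<lambda>b. a + e - b"]) auto
  qed
  also have "\<dots> = (\<Sum>b\<le>m + e. \<Sum>a\<in>{a. a \<le> m \<and> b \<le> a + e}. G a (a + e - b))"
    unfolding sum.Sigma[OF finite_atMost, OF ballI, OF finite_atMost]
    by (subst sum.Sigma, simp, simp, rule sum.reindex_bij_witness[of _ prod.swap prod.swap]) auto
  finally show ?thesis .
qed

context
  fixes \<beta> \<gamma> \<mu> :: real
  assumes b: "\<beta> \<ge> 1/2" and g: "\<gamma> > - 1/2" and m: "\<mu> > - 1/2"
begin

lemma alpha_pos: "alpha CARD('d::finite) \<beta> \<mu> > 0"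
proof -
  have "(real CARD('d) - 1) / 2 \<ge> 0" by (simp add: Suc_le_eq)
  moreover have "\<beta> + \<mu> > 0" using b m by linarith
  ultimately show ?thesis unfolding alpha_def by linarith
qed

lemma cmean_even_monom_exp_kernel:
  fixes k :: "'d::finite \<Rightarrow> nat" and q :: "(real ^ 'd) \<times> real"
  defines "J \<equiv> sum k UNIV"
  shows "exp_mean \<beta> \<gamma> \<mu> n (even_monom k e) q =
    (\<Sum>l\<le>n div 2. \<Sum>j\<le>(n - 2 * l) div 2. \<Sum>h\<le>(n - 2 * l - 2 * j) div 2.
       exp_coeff CARD('d) \<beta> \<gamma> \<mu> n q l j h *
       (cone_moment CARD('d) \<beta> \<gamma> \<mu> ((J + (n - 2 * l - 2 * j - 2 * h)) div 2) h (j + e) l *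
       (gauss_moment k (n - 2 * l - 2 * j - 2 * h) (fst q) / fact (n - 2 * l - 2 * j - 2 * h))))"
proof -
  have al: "alpha CARD('d) \<beta> \<mu> > - 1/2" using alpha_pos[where 'd='d] by simp
  let ?g = "\<lambda>i x. vmonom k x * (x \<bullet> fst q) ^ i"
  have cont: "continuous_on UNIV (?g i)" for i by (intro continuous_intros)
  have cm: "continuous_on UNIV (\<lambda>p. c * mono_fun (?g i) h u l p)" for c i h u l
    by (intro continuous_intros mono_fun_continuous[OF cont])
  have val: "cmean \<beta> \<gamma> \<mu> (mono_fun (?g i) h u l) =
      cone_moment CARD('d) \<beta> \<gamma> \<mu> ((J + i) div 2) h u l * gauss_moment k i (fst q)" for i h u l
  proof -
    have gm: "?g i \<in> borel_measurable borel" by (rule borel_measurable_continuous_onI) (rule cont)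
    have hom: "?g i (c *\<^sub>R x) = c ^ (J + i) * ?g i x" for c x
      unfolding J_def by (simp add: vmonom_scaleR power_add power_mult_distrib)
    show ?thesis
    proof (cases "even (J + i)")
      case True
      then show ?thesis
        unfolding gauss_moment_def by (intro cmean_mono_fun(1)[OF gm hom integrable_vmonom_inner g m al])
    next
      case False
      \<comment> \<open>For odd total degree every \<open>exp_term\<close> in the Gaussian expansion
        has an odd index, so the moment is 0.\<close>
      obtain P :: "nat \<Rightarrow> real ^ 'd \<Rightarrow> real" where "\<And>i y. gauss_moment k i y / fact i =
        (\<Sum>a\<le>J. P a y * exp_term ((norm y)\<^sup>2 / 2) (int i - int J + 2 * int a))"
        using gauss_moment_expansion[of k] unfolding J_def by blast
      from this[of i "fst q"] have "gauss_moment k i (fst q) = 0"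
        using False by (simp add: exp_term_def)
      then show ?thesis using cmean_mono_fun(2)[OF gm hom integrable_vmonom_inner g m al]
        by (simp add: gauss_moment_def)
    qed
  qed
  let ?t = "\<lambda>l j h p. (exp_coeff CARD('d) \<beta> \<gamma> \<mu> n q l j h / fact (n - 2 * l - 2 * j - 2 * h)) *
       mono_fun (?g (n - 2 * l - 2 * j - 2 * h)) h (j + e) l p"
  have "exp_mean \<beta> \<gamma> \<mu> n (even_monom k e) q =
    (\<Sum>l\<le>n div 2. cmean \<beta> \<gamma> \<mu> (\<lambda>p. \<Sum>j\<le>(n - 2 * l) div 2. \<Sum>h\<le>(n - 2 * l - 2 * j) div 2. ?t l j h p))"
    unfolding even_monom_exp_kernel by (intro cmean_sum[OF g m al] continuous_on_sum cm)
  also have "\<dots> = (\<Sum>l\<le>n div 2. \<Sum>j\<le>(n - 2 * l) div 2. cmean \<beta> \<gamma> \<mu> (\<lambda>p. \<Sum>h\<le>(n - 2 * l - 2 * j) div 2. ?t l j h p))"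
    by (intro sum.cong refl cmean_sum[OF g m al] continuous_on_sum cm)
  also have "\<dots> = (\<Sum>l\<le>n div 2. \<Sum>j\<le>(n - 2 * l) div 2. \<Sum>h\<le>(n - 2 * l - 2 * j) div 2. cmean \<beta> \<gamma> \<mu> (?t l j h))"
    by (intro sum.cong refl cmean_sum[OF g m al] continuous_on_sum cm)
  finally show ?thesis unfolding cmean_cmult[OF g m] val by (simp only: mult_ac times_divide_eq_right times_divide_eq_left)
qed

end

context
  fixes \<beta> \<gamma> \<mu> :: real
  assumes b: "\<beta> \<ge> 1/2" and g: "\<gamma> > - 1/2" and m: "\<mu> > - 1/2"
begin

text \<open>The rising factorials of \<mu> + 1/2 and \<gamma> + 1/2 from the moments cancel those in
  the denominators of the kernel, and the normalizing factor cancels the one in \<alpha> + \<gamma>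
  + 1. What remains depends on q through the quarters of |y|^2, s^2 - |y|^2 and 1 - s^2.\<close>

lemma exp_coeff_cone_moment:
  fixes q :: "(real ^ 'd) \<times> real"
  defines "y2 \<equiv> (norm (fst q))\<^sup>2" and "s2 \<equiv> (snd q)\<^sup>2" and "\<theta> \<equiv> \<mu> + (real CARD('d) + 1) / 2" and "\<delta> \<equiv> \<beta> - 1/2"
  assumes n: "n = p + 2 * M" and le: "l + j + h \<le> M"
  shows "exp_coeff CARD('d) \<beta> \<gamma> \<mu> n q l j h *
      (cone_moment CARD('d) \<beta> \<gamma> \<mu> (p + a + (M - l - j - h)) h (j + e) l * ((y2 / 2) ^ (M - l - j - h) / fact (M - l - j - h))) *
      pochhammer (alpha CARD('d) \<beta> \<mu> + \<gamma> + 1) (p + a + e + M) * 2 ^ n =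
     4 ^ M / 2 ^ a * cone_term \<theta> \<delta> p a e M (y2 / 4) ((s2 - y2) / 4) ((1 - s2) / 4) l j h"
proof -
  define c where "c = M - l - j - h"
  define \<Lambda> where "\<Lambda> = alpha CARD('d) \<beta> \<mu> + \<gamma> + 1"
  have al: "alpha CARD('d) \<beta> \<mu> + 1/2 = \<theta> + \<delta>" by (simp add: alpha_def \<theta>_def \<delta>_def field_simps)
  have ix: "n - 2 * l - 2 * j = p + 2 * (M - l - j)" "n - 2 * l = p + 2 * (M - l)"
    "p + a + c + h = p + a + (M - l - j)" "p + a + (M - l - j) + (j + e) = p + a + e + (M - l)"
    "p + a + e + (M - l) + l = p + a + e + M"
    "p + 2 * (M - l) - 2 * j = p + 2 * (M - l - j)"
    using n le by (auto simp: c_def)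
  have nz: "pochhammer (\<mu> + 1/2) h > 0" "pochhammer (\<gamma> + 1/2) l > 0" "pochhammer \<Lambda> (p + a + e + M) > 0"
  proof -
    have "\<Lambda> > 0" using g alpha_pos[OF b g m, where 'd='d] unfolding \<Lambda>_def by linarith
    then show "pochhammer (\<mu> + 1/2) h > 0" "pochhammer (\<gamma> + 1/2) l > 0" "pochhammer \<Lambda> (p + a + e + M) > 0"
      using g m by (simp_all add: pochhammer_pos)
  qed
  \<comment> \<open>Since n = p + 2 M, the powers of 2 turn the halves of the Gaussian expansion
    into quarters and leave 4^M / 2^a.\<close>
  have two: "(2::real) ^ n / 2 ^ (p + a + c) * (y2 / 2) ^ c = 4 ^ M / 2 ^ a * (y2 / 4) ^ c"
  proof -
    have "(4::real) ^ k = 2 ^ k * 2 ^ k" for k by (simp add: power_mult_distrib[symmetric])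
    then show ?thesis unfolding n by (simp add: power_add power_mult power_divide mult_2)
  qed
  have sj: "s2 ^ j / 4 ^ j = (y2 / 4 + (s2 - y2) / 4) ^ j" by (simp add: power_divide add_divide_distrib[symmetric])
  have gen: "(B / (fh * mh) * (t1 * H / (fj * A1) * S) * (R / (fl * gl))) *
      (mh / (pw * t2) * (A2 * gl / L) * (Y / fc)) * L * N =
     (N / pw * Y) / fc * (B / fh) * (H * (S / fj)) * (R / fl) * (t1 / t2 * (A2 / A1))"
    if "mh > 0" "gl > 0" "L > 0"
    for B fh mh t1 H fj A1 S R fl gl pw t2 A2 L Y fc N :: real
    using that by (simp add: mult_ac)
  show ?thesis
    unfolding cone_term_def exp_coeff_def cone_moment_def c_def[symmetric] y2_def[symmetric] s2_def[symmetric] al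
      \<theta>_def[symmetric] \<delta>_def[symmetric] \<Lambda>_def[symmetric] ix gen[OF nz] two sj
    by (simp only: times_divide_eq_left times_divide_eq_right mult.assoc)
qed

text \<open>Here the counterpart of |q| = 1 enters: A + B = s^2 / 4 and A + B + R = 1/4, so that
  \<open>4 ^ M\<close> absorbs every power of 1/4 and only s^(2i) is left.\<close>

lemma cone_exp_term_sum:
  fixes k :: "'d::finite \<Rightarrow> nat" and q :: "(real ^ 'd) \<times> real" and C :: "nat \<Rightarrow> real"
  defines "J \<equiv> sum k UNIV" and "y2 \<equiv> (norm (fst q))\<^sup>2" and "\<theta> \<equiv> \<mu> + (real CARD('d) + 1) / 2" and "\<delta> \<equiv> \<beta> - 1/2"
  assumes aJ: "2 * a \<le> J" and ev: "even (n + J)"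
    and C: "\<And>A B R M. (\<Sum>l\<le>M. \<Sum>j\<le>M - l. \<Sum>h\<le>M - l - j. cone_term \<theta> \<delta> (J - 2 * a) a e M A B R l j h) =
      (\<Sum>i\<le>a + e. C i * ((A + B) ^ i * (A + B + R) ^ (M - i) * inv_fact_diff M i))"
  shows "(\<Sum>l\<le>n div 2. \<Sum>j\<le>(n - 2 * l) div 2. \<Sum>h\<le>(n - 2 * l - 2 * j) div 2.
       exp_coeff CARD('d) \<beta> \<gamma> \<mu> n q l j h *
       (cone_moment CARD('d) \<beta> \<gamma> \<mu> ((J + (n - 2 * l - 2 * j - 2 * h)) div 2) h (j + e) l *
       exp_term (y2 / 2) (int (n - 2 * l - 2 * j - 2 * h) - int J + 2 * int a))) *
      pochhammer (alpha CARD('d) \<beta> \<mu> + \<gamma> + 1) ((n + (J + 2 * e)) div 2) * 2 ^ n =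
    (\<Sum>i\<le>a + e. C i * ((snd q)\<^sup>2) ^ i / 2 ^ a * inv_fact_step n (J + 2 * e) (a + e - i))"
    (is "(\<Sum>l\<le>_. \<Sum>j\<le>_. \<Sum>h\<le>_. ?f l j h) * ?L * _ = _")
proof (cases "J \<le> n + 2 * a")
  case False
  have f0: "?f l j h = 0" for l j h
  proof -
    have "int (n - 2 * l - 2 * j - 2 * h) \<le> int n" by simp
    moreover have "int n - int J + 2 * int a < 0" using False by linarith
    ultimately have "int (n - 2 * l - 2 * j - 2 * h) - int J + 2 * int a < 0" by linarith
    then have "exp_term (y2 / 2) (int (n - 2 * l - 2 * j - 2 * h) - int J + 2 * int a) = 0"
      by (simp add: exp_term_def)
    then show ?thesis by simp
  qed
  have i0: "inv_fact_step n (J + 2 * e) (a + e - i) = 0" if "i \<le> a + e" for i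
    using False that by (simp add: inv_fact_step_def)
  have "(\<Sum>i\<le>a + e. C i * ((snd q)\<^sup>2) ^ i / 2 ^ a * inv_fact_step n (J + 2 * e) (a + e - i)) = 0"
    by (intro sum.neutral ballI) (simp add: i0)
  then show ?thesis unfolding f0 by simp
next
  case True
  \<comment> \<open>Half the index of \<open>exp_term\<close> in the summand l = j = h = 0. The case
    of a negative index, where both sides vanish, is already done.\<close>
  define M where "M = (n + 2 * a - J) div 2"
  have M: "n + 2 * a = J + 2 * M"
  proof -
    have "even (n + 2 * a - J)" using ev True by simp
    then show ?thesis using True by (auto simp: M_def)
  qed
  define p where "p = J - 2 * a"
  have n: "n = p + 2 * M" using M aJ by (simp add: p_def)
  have Jp: "J = p + 2 * a" using aJ by (simp add: p_def)
  define s2 where "s2 = (snd q)\<^sup>2"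
  have L: "(n + (J + 2 * e)) div 2 = p + a + e + M" using n Jp by simp
  have "(\<Sum>l\<le>n div 2. \<Sum>j\<le>(n - 2 * l) div 2. \<Sum>h\<le>(n - 2 * l - 2 * j) div 2. ?f l j h) =
     (\<Sum>l\<le>M. \<Sum>j\<le>M - l. \<Sum>h\<le>M - l - j. ?f l j h)"
  proof (rule triple_sum_shrink)
    show "2 * M \<le> n" using n by simp
    show "?f l j h = 0" if "M < l + j + h" "2 * (l + j + h) \<le> n" for l j h
    proof -
      have "int (n - 2 * l - 2 * j - 2 * h) - int J + 2 * int a < 0" using that n Jp by auto
      then have "exp_term (y2 / 2) (int (n - 2 * l - 2 * j - 2 * h) - int J + 2 * int a) = 0"
        by (simp add: exp_term_def)
      then show ?thesis by simp
    qed
  qed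
  then have "(\<Sum>l\<le>n div 2. \<Sum>j\<le>(n - 2 * l) div 2. \<Sum>h\<le>(n - 2 * l - 2 * j) div 2. ?f l j h) * ?L * 2 ^ n =
      (\<Sum>l\<le>M. \<Sum>j\<le>M - l. \<Sum>h\<le>M - l - j. ?f l j h * ?L * 2 ^ n)"
    by (simp only: sum_distrib_right)
  also have "\<dots> = (\<Sum>l\<le>M. \<Sum>j\<le>M - l. \<Sum>h\<le>M - l - j. 4 ^ M / 2 ^ a * cone_term \<theta> \<delta> p a e M (y2 / 4) ((s2 - y2) / 4) ((1 - s2) / 4) l j h)"
  proof (intro sum.cong refl)
    fix l j h assume "l \<in> {..M}" "j \<in> {..M - l}" "h \<in> {..M - l - j}"
    then have le: "l + j + h \<le> M" by auto
    define c where "c = M - l - j - h"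
    have i: "n - 2 * l - 2 * j - 2 * h = p + 2 * c" using le n by (simp add: c_def)
    have i2: "(J + (p + 2 * c)) div 2 = p + a + c" using Jp by simp
    have i3: "int (p + 2 * c) - int J + 2 * int a = 2 * int c" using Jp by simp
    have i4: "exp_term (y2 / 2) (2 * int c) = (y2 / 2) ^ c / fact c" by (simp add: exp_term_def)
    show "?f l j h * ?L * 2 ^ n = 4 ^ M / 2 ^ a * cone_term \<theta> \<delta> p a e M (y2 / 4) ((s2 - y2) / 4) ((1 - s2) / 4) l j h"
      unfolding i i2 i3 i4 L
      using exp_coeff_cone_moment[OF n le, where 'd='d, of q a e] unfolding c_def[symmetric] y2_def s2_def \<theta>_def \<delta>_def .
  qed
  also have "\<dots> = 4 ^ M / 2 ^ a * (\<Sum>i\<le>a + e. C i *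
      ((y2 / 4 + (s2 - y2) / 4) ^ i * (y2 / 4 + (s2 - y2) / 4 + (1 - s2) / 4) ^ (M - i) * inv_fact_diff M i))"
    unfolding sum_distrib_left[symmetric] C[where A = "y2 / 4" and B = "(s2 - y2) / 4" and R = "(1 - s2) / 4" and M = M, folded p_def] ..
  also have "\<dots> = (\<Sum>i\<le>a + e. C i * s2 ^ i / 2 ^ a * inv_fact_step n (J + 2 * e) (a + e - i))"
    unfolding sum_distrib_left
  proof (intro sum.cong refl)
    fix i assume "i \<in> {..a + e}"
    then have ia: "i \<le> a + e" by simp
    have "y2 / 4 + (s2 - y2) / 4 = s2 / 4" "s2 / 4 + (1 - s2) / 4 = 1 / 4" by (simp_all add: field_simps)
    moreover have "4 ^ M / 2 ^ a * (C i * ((s2 / 4) ^ i * (1 / 4) ^ (M - i) * inv_fact_diff M i)) =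
        C i * s2 ^ i / 2 ^ a * inv_fact_step n (J + 2 * e) (a + e - i)"
    proof (cases "i \<le> M")
      case True
      have "(4::real) ^ M = 4 ^ i * 4 ^ (M - i)" using True by (simp add: power_add[symmetric])
      then have "4 ^ M * ((s2 / 4) ^ i * (1 / 4) ^ (M - i)) = s2 ^ i" by (simp add: power_divide)
      moreover have "inv_fact_step n (J + 2 * e) (a + e - i) = inv_fact_diff M i"
      proof -
        have "n + 2 * (a + e - i) = J + 2 * e + 2 * (M - i)" using M ia True by auto
        then have "(n + 2 * (a + e - i) - (J + 2 * e)) div 2 = M - i" "J + 2 * e \<le> n + 2 * (a + e - i)"
          by auto
        then show ?thesis using True by (simp add: inv_fact_step_def inv_fact_diff_def)
      qed
      ultimately show ?thesis by (simp add: mult_ac) 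
    next
      case False
      then have "\<not> J + 2 * e \<le> n + 2 * (a + e - i)" using M ia by auto
      then show ?thesis using False by (simp add: inv_fact_step_def inv_fact_diff_def)
    qed
    ultimately show "4 ^ M / 2 ^ a * (C i * ((y2 / 4 + (s2 - y2) / 4) ^ i *
        (y2 / 4 + (s2 - y2) / 4 + (1 - s2) / 4) ^ (M - i) * inv_fact_diff M i)) =
      C i * s2 ^ i / 2 ^ a * inv_fact_step n (J + 2 * e) (a + e - i)" by (simp only:)
  qed
  finally show ?thesis unfolding s2_def .
qed

lemma even_monom_has_expansion:
  fixes k :: "'d::finite \<Rightarrow> nat"
  shows "\<exists>F. has_expansion \<beta> \<gamma> \<mu> (sum k UNIV + 2 * e) (even_monom k e) F"
proof -
  define J where "J = sum k UNIV"
  define \<theta> where "\<theta> = \<mu> + (real CARD('d) + 1) / 2"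
  define \<delta> where "\<delta> = \<beta> - 1/2"
  have \<theta>: "\<theta> > 0" using m by (simp add: \<theta>_def add_pos_pos field_simps)
  have \<delta>: "\<delta> \<ge> 0" using b by (simp add: \<delta>_def)
  obtain P where P0: "P 0 = vmonom k" and PJ: "\<And>a y. 2 * a > J \<Longrightarrow> P a y = 0"
    and P: "\<And>i y. gauss_moment k i y / fact i =
        (\<Sum>a\<le>J. P a y * exp_term ((norm y)\<^sup>2 / 2) (int i - int J + 2 * int a))"
    using gauss_moment_expansion[of k] unfolding J_def by blast
  define Q where "Q a c \<longleftrightarrow> c (a + e) = (if a = 0 then 1 else 0) \<and> (\<forall>A B R M. (\<Sum>l\<le>M. \<Sum>j\<le>M - l. \<Sum>h\<le>M - l - j. cone_term \<theta> \<delta> (J - 2 * a) a e M A B R l j h) =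
      (\<Sum>i\<le>a + e. c i * ((A + B) ^ i * (A + B + R) ^ (M - i) * inv_fact_diff M i)))" for a c
  have "\<forall>a. \<exists>c. Q a c"
    unfolding Q_def by (intro allI cone_triple_sum[OF \<theta> \<delta>])
  from choice[OF this] obtain C where C: "\<And>a. Q a (C a)" by blast
  have C1: "C a (a + e) = (if a = 0 then 1 else 0)" for a
    using C[of a] unfolding Q_def by (rule conjunct1)
  have C2: "(\<Sum>l\<le>M. \<Sum>j\<le>M - l. \<Sum>h\<le>M - l - j. cone_term \<theta> \<delta> (J - 2 * a) a e M A B R l j h) =
      (\<Sum>i\<le>a + e. C a i * ((A + B) ^ i * (A + B + R) ^ (M - i) * inv_fact_diff M i))" for a A B R M
    using C[of a] unfolding Q_def by (elim conjE allE)
  \<comment> \<open>The Gaussian index a and the power i of s^2 contribute to r = a + e - i. For r =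
    0 this forces i = a + e, and \<open>C1\<close> leaves only a = 0, which is the monomial
    itself.\<close>
  define F where "F r q = (\<Sum>a\<in>{a. a \<le> J div 2 \<and> r \<le> a + e}.
      P a (fst q) * (C a (a + e - r) * ((snd q)\<^sup>2) ^ (a + e - r) / 2 ^ a))" for r and q :: "(real ^ 'd) \<times> real"
  have "has_expansion \<beta> \<gamma> \<mu> (J + 2 * e) (even_monom k e) F"
    unfolding has_expansion_def
  proof (intro conjI allI impI)
    show "F 0 = even_monom k e"
    proof
      fix q :: "(real ^ 'd) \<times> real"
      have "F 0 q = (\<Sum>a\<in>{..J div 2}. if a = 0 then P 0 (fst q) * ((snd q)\<^sup>2) ^ e else 0)"
        unfolding F_def by (intro sum.cong) (auto simp: C1)
      then show "F 0 q = even_monom k e q" by (simp add: even_monom_def P0)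
    qed
  next
    fix n and q :: "(real ^ 'd) \<times> real"
    assume odd: "odd (n + (J + 2 * e))"
    have "gauss_moment k (n - 2 * l - 2 * j - 2 * h) (fst q) / fact (n - 2 * l - 2 * j - 2 * h) = 0"
      if "h \<le> (n - 2 * l - 2 * j) div 2" "j \<le> (n - 2 * l) div 2" "l \<le> n div 2" for l j h
    proof -
      have "2 * h \<le> n - 2 * l - 2 * j" "2 * j \<le> n - 2 * l" "2 * l \<le> n" using that by auto
      then have "odd (n - 2 * l - 2 * j - 2 * h + J)" using odd by auto
      then show ?thesis unfolding P by (intro sum.neutral) (auto simp: exp_term_def)
    qed
    then show "exp_mean \<beta> \<gamma> \<mu> n (even_monom k e) q = 0"
      unfolding cmean_even_monom_exp_kernel[OF b g m] by (intro sum.neutral ballI) simp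
  next
    fix n and q :: "(real ^ 'd) \<times> real"
    assume ev: "even (n + (J + 2 * e))"
    define L where "L = pochhammer (alpha CARD('d) \<beta> \<mu> + \<gamma> + 1) ((n + (J + 2 * e)) div 2) * 2 ^ n"
    define X where "X a l j h = exp_coeff CARD('d) \<beta> \<gamma> \<mu> n q l j h *
       (cone_moment CARD('d) \<beta> \<gamma> \<mu> ((J + (n - 2 * l - 2 * j - 2 * h)) div 2) h (j + e) l *
       exp_term ((norm (fst q))\<^sup>2 / 2) (int (n - 2 * l - 2 * j - 2 * h) - int J + 2 * int a))" for a l j h
    have "exp_mean \<beta> \<gamma> \<mu> n (even_monom k e) q =
      (\<Sum>l\<le>n div 2. \<Sum>j\<le>(n - 2 * l) div 2. \<Sum>h\<le>(n - 2 * l - 2 * j) div 2. \<Sum>a\<le>J. P a (fst q) * X a l j h)"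
      unfolding cmean_even_monom_exp_kernel[OF b g m] P X_def J_def[symmetric]
      by (simp only: sum_distrib_left mult_ac)
    also have "\<dots> = (\<Sum>a\<le>J. P a (fst q) *
        (\<Sum>l\<le>n div 2. \<Sum>j\<le>(n - 2 * l) div 2. \<Sum>h\<le>(n - 2 * l - 2 * j) div 2. X a l j h))"
    proof -
      have "(\<Sum>l\<le>n div 2. \<Sum>j\<le>(n - 2 * l) div 2. \<Sum>h\<le>(n - 2 * l - 2 * j) div 2. \<Sum>a\<le>J. P a (fst q) * X a l j h) =
        (\<Sum>l\<le>n div 2. \<Sum>j\<le>(n - 2 * l) div 2. \<Sum>a\<le>J. \<Sum>h\<le>(n - 2 * l - 2 * j) div 2. P a (fst q) * X a l j h)"
        by (intro sum.cong refl sum.swap)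
      also have "\<dots> = (\<Sum>l\<le>n div 2. \<Sum>a\<le>J. \<Sum>j\<le>(n - 2 * l) div 2. \<Sum>h\<le>(n - 2 * l - 2 * j) div 2. P a (fst q) * X a l j h)"
        by (intro sum.cong refl sum.swap)
      also have "\<dots> = (\<Sum>a\<le>J. \<Sum>l\<le>n div 2. \<Sum>j\<le>(n - 2 * l) div 2. \<Sum>h\<le>(n - 2 * l - 2 * j) div 2. P a (fst q) * X a l j h)"
        by (rule sum.swap)
      finally show ?thesis by (simp only: sum_distrib_left)
    qed
    also have "\<dots> = (\<Sum>a\<le>J div 2. P a (fst q) *
        (\<Sum>l\<le>n div 2. \<Sum>j\<le>(n - 2 * l) div 2. \<Sum>h\<le>(n - 2 * l - 2 * j) div 2. X a l j h))"
      by (rule sum.mono_neutral_right) (auto simp: PJ)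
    finally have "exp_mean \<beta> \<gamma> \<mu> n (even_monom k e) q * L =
       (\<Sum>a\<le>J div 2. P a (fst q) *
        ((\<Sum>l\<le>n div 2. \<Sum>j\<le>(n - 2 * l) div 2. \<Sum>h\<le>(n - 2 * l - 2 * j) div 2. X a l j h) * L))"
      by (simp only: sum_distrib_right mult.assoc)
    also have "\<dots> = (\<Sum>a\<le>J div 2. P a (fst q) *
        (\<Sum>i\<le>a + e. C a i * ((snd q)\<^sup>2) ^ i / 2 ^ a * inv_fact_step n (J + 2 * e) (a + e - i)))"
    proof (intro sum.cong refl arg_cong2[where f="(*)"])
      fix a assume "a \<in> {..J div 2}"
      then have aJ: "2 * a \<le> sum k UNIV" by (auto simp: J_def)
      have ev': "even (n + sum k UNIV)" using ev by (simp add: J_def)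
      show "(\<Sum>l\<le>n div 2. \<Sum>j\<le>(n - 2 * l) div 2. \<Sum>h\<le>(n - 2 * l - 2 * j) div 2. X a l j h) * L =
        (\<Sum>i\<le>a + e. C a i * ((snd q)\<^sup>2) ^ i / 2 ^ a * inv_fact_step n (J + 2 * e) (a + e - i))"
        using cone_exp_term_sum[OF aJ ev' C2[unfolded J_def \<theta>_def \<delta>_def], of q]
        unfolding X_def L_def J_def by (simp only: mult.assoc)
    qed
    also have "\<dots> = (\<Sum>a\<le>J div 2. \<Sum>i\<le>a + e. P a (fst q) * (C a i * ((snd q)\<^sup>2) ^ i / 2 ^ a) * inv_fact_step n (J + 2 * e) (a + e - i))"
      by (simp only: sum_distrib_left mult.assoc)
    also have "\<dots> = (\<Sum>r\<le>J div 2 + e. \<Sum>a\<in>{a. a \<le> J div 2 \<and> r \<le> a + e}.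
        P a (fst q) * (C a (a + e - r) * ((snd q)\<^sup>2) ^ (a + e - r) / 2 ^ a) * inv_fact_step n (J + 2 * e) (a + e - (a + e - r)))"
      by (rule sum_antidiagonal)
    also have "\<dots> = (\<Sum>r\<le>J div 2 + e. F r q * inv_fact_step n (J + 2 * e) r)"
      unfolding F_def sum_distrib_right by (intro sum.cong refl) auto
    finally have sum_eq: "exp_mean \<beta> \<gamma> \<mu> n (even_monom k e) q * L =
        (\<Sum>r\<le>J div 2 + e. F r q * inv_fact_step n (J + 2 * e) r)" .
    have "(J + 2 * e) div 2 = J div 2 + e" by simp
    with sum_eq show "exp_mean \<beta> \<gamma> \<mu> n (even_monom k e) q *
        pochhammer (alpha CARD('d) \<beta> \<mu> + \<gamma> + 1) ((n + (J + 2 * e)) div 2) * 2 ^ n =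
        (\<Sum>a\<le>(J + 2 * e) div 2. F a q * inv_fact_step n (J + 2 * e) a)"
      by (simp only: L_def mult.assoc)
  qed
  then show ?thesis unfolding J_def by blast
qed

end

section \<open>Polynomials on the double cone\<close>

lemma finite_poly_index: "finite {(k :: 'd::finite \<Rightarrow> nat, m). (\<Sum>i\<in>UNIV. k i) + m \<le> n}"
proof (rule finite_subset)
  show "finite ((UNIV \<rightarrow>\<^sub>E {..n}) \<times> {..n} :: (('d \<Rightarrow> nat) \<times> nat) set)"
    by (intro finite_cartesian_product finite_PiE) auto
  show "{(k :: 'd \<Rightarrow> nat, m). (\<Sum>i\<in>UNIV. k i) + m \<le> n} \<subseteq> (UNIV \<rightarrow>\<^sub>E {..n}) \<times> {..n}"
  proof -
    have "k i \<le> n" if "sum k UNIV + m \<le> n" for k :: "'d \<Rightarrow> nat" and m i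
      using that member_le_sum[of i UNIV k] by simp
    then show ?thesis by (auto simp: PiE_iff)
  qed
qed

definition full_monom :: "('d::finite \<Rightarrow> nat) \<Rightarrow> nat \<Rightarrow> (real ^ 'd) \<times> real \<Rightarrow> real" where
  "full_monom k m p = vmonom k (fst p) * snd p ^ m"

lemma poly_deg_leE:
  assumes "f \<in> poly_deg_le n"
  obtains c where "f = (\<lambda>p. \<Sum>(k, m)\<in>{(k, m). (\<Sum>i\<in>UNIV. k i) + m \<le> n}. c (k, m) * full_monom k m p)"
proof -
  obtain c where c: "\<And>x t. f (x, t) = (\<Sum>(k, m) \<in> {(k, m). (\<Sum>i\<in>UNIV. k i) + m \<le> n}.
                   c (k, m) * (\<Prod>i\<in>UNIV. (x $ i) ^ k i) * t ^ m)"
    using assms unfolding poly_deg_le_def by blast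
  have "f p = (\<Sum>(k, m)\<in>{(k, m). (\<Sum>i\<in>UNIV. k i) + m \<le> n}. c (k, m) * full_monom k m p)" for p
    using c[of "fst p" "snd p"] by (simp add: full_monom_def vmonom_def mult.assoc)
  then show ?thesis by (intro that ext)
qed

lemma poly_deg_leI:
  assumes "\<And>p. f p = (\<Sum>(k, m)\<in>{(k, m). (\<Sum>i\<in>UNIV. k i) + m \<le> n}. c (k, m) * full_monom k m p)"
  shows "f \<in> poly_deg_le n"
  unfolding poly_deg_le_def by (auto simp: assms full_monom_def vmonom_def mult.assoc intro!: exI[of _ c])

lemma poly_deg_le_monom:
  assumes "sum k UNIV + m \<le> n"
  shows "(\<lambda>p. a * full_monom k m p) \<in> poly_deg_le n"
proof (rule poly_deg_leI[where c = "\<lambda>km. if km = (k, m) then a else 0"])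
  fix p
  have "(\<Sum>(k', m')\<in>{(k, m). (\<Sum>i\<in>UNIV. k i) + m \<le> n}. (if (k', m') = (k, m) then a else 0) * full_monom k' m' p) =
    (\<Sum>km\<in>{(k, m). (\<Sum>i\<in>UNIV. k i) + m \<le> n}. if km = (k, m) then a * full_monom k m p else 0)"
    by (intro sum.cong) (auto split: if_splits)
  also have "\<dots> = a * full_monom k m p"
    using assms finite_poly_index[of n] by (subst sum.delta) auto
  finally show "a * full_monom k m p = (\<Sum>(k', m')\<in>{(k, m). (\<Sum>i\<in>UNIV. k i) + m \<le> n}.
      (if (k', m') = (k, m) then a else 0) * full_monom k' m' p)" ..
qed

lemma poly_deg_le_add:
  assumes "f \<in> poly_deg_le n" "h \<in> poly_deg_le n"
  shows "(\<lambda>p. f p + h p) \<in> poly_deg_le n"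
proof -
  obtain c where c: "f = (\<lambda>p. \<Sum>(k, m)\<in>{(k, m). (\<Sum>i\<in>UNIV. k i) + m \<le> n}. c (k, m) * full_monom k m p)"
    using assms(1) by (rule poly_deg_leE)
  obtain c' where c': "h = (\<lambda>p. \<Sum>(k, m)\<in>{(k, m). (\<Sum>i\<in>UNIV. k i) + m \<le> n}. c' (k, m) * full_monom k m p)"
    using assms(2) by (rule poly_deg_leE)
  show ?thesis
    by (rule poly_deg_leI[where c = "\<lambda>km. c km + c' km"])
      (simp add: c c' sum.distrib[symmetric] case_prod_unfold distrib_right)
qed

lemma poly_deg_le_zero: "(\<lambda>_. 0) \<in> poly_deg_le n"
  by (rule poly_deg_leI[where c = "\<lambda>_. 0"]) (simp add: case_prod_unfold)

lemma poly_deg_le_sum: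
  assumes "\<And>i. i \<in> I \<Longrightarrow> f i \<in> poly_deg_le n"
  shows "(\<lambda>p. \<Sum>i\<in>I. f i p) \<in> poly_deg_le n"
  using assms by (induction I rule: infinite_finite_induct) (simp_all add: poly_deg_le_zero poly_deg_le_add)

lemma full_monom_mult: "full_monom k m p * full_monom k' m' p = full_monom (\<lambda>i. k i + k' i) (m + m') p"
  by (simp add: full_monom_def vmonom_def power_add prod.distrib)

lemma poly_deg_le_mult:
  assumes "f \<in> poly_deg_le n" "h \<in> poly_deg_le n'" "n + n' \<le> N"
  shows "(\<lambda>p. f p * h p) \<in> poly_deg_le N"
proof -
  let ?I = "\<lambda>n. {(k :: 'a \<Rightarrow> nat, m). (\<Sum>i\<in>UNIV. k i) + m \<le> n}"
  obtain c where c: "f = (\<lambda>p. \<Sum>(k, m)\<in>?I n. c (k, m) * full_monom k m p)"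
    using assms(1) by (rule poly_deg_leE)
  obtain c' where c': "h = (\<lambda>p. \<Sum>(k, m)\<in>?I n'. c' (k, m) * full_monom k m p)"
    using assms(2) by (rule poly_deg_leE)
  have "(\<lambda>p. f p * h p) = (\<lambda>p. \<Sum>u\<in>?I n. \<Sum>v\<in>?I n'. (c u * c' v) * full_monom (\<lambda>i. fst u i + fst v i) (snd u + snd v) p)"
    unfolding c c' sum_product full_monom_mult[symmetric] case_prod_unfold by (simp add: mult_ac)
  also have "\<dots> \<in> poly_deg_le N"
    using assms(3) by (intro poly_deg_le_sum poly_deg_le_monom) (auto simp: sum.distrib)
  finally show ?thesis .
qed

lemma poly_deg_le_const: "(\<lambda>_. a) \<in> poly_deg_le n"
  using poly_deg_le_monom[of "\<lambda>_. 0" 0 n a] by (simp add: full_monom_def vmonom_def)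

lemma poly_deg_le_cmult: "f \<in> poly_deg_le n \<Longrightarrow> (\<lambda>p. a * f p) \<in> poly_deg_le n"
  by (rule poly_deg_le_mult[OF poly_deg_le_const[of a 0], where n' = n]) simp_all

lemma poly_deg_le_diff:
  "f \<in> poly_deg_le n \<Longrightarrow> h \<in> poly_deg_le n \<Longrightarrow> (\<lambda>p. f p - h p) \<in> poly_deg_le n"
  using poly_deg_le_add[of f n "\<lambda>p. (-1) * h p"] poly_deg_le_cmult[of h n "-1"] by simp

lemma poly_deg_le_power: "f \<in> poly_deg_le m \<Longrightarrow> m * k \<le> n \<Longrightarrow> (\<lambda>p. f p ^ k) \<in> poly_deg_le n"
proof (induction k arbitrary: n)
  case (Suc k)
  have "(\<lambda>p. f p * f p ^ k) \<in> poly_deg_le n"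
    by (rule poly_deg_le_mult[OF Suc.prems(1) Suc.IH[OF Suc.prems(1) order_refl]]) (use Suc.prems(2) in simp)
  then show ?case by simp
qed (simp add: poly_deg_le_const)

lemma poly_deg_le_component: "(\<lambda>p. fst p $ i) \<in> poly_deg_le 1"
proof -
  have "vmonom (\<lambda>j. if j = i then 1 else 0) x = x $ i" for x :: "real ^ 'a"
    unfolding vmonom_def prod_UNIV_remove[of _ i] by simp
  then show ?thesis
    using poly_deg_le_monom[of "\<lambda>j. if j = i then 1 else 0" 0 1 1] by (simp add: full_monom_def)
qed

lemma poly_deg_le_inner: "(\<lambda>p. fst p \<bullet> y) \<in> poly_deg_le 1"
  unfolding inner_vec_sum by (intro poly_deg_le_sum poly_deg_le_cmult poly_deg_le_component)

lemma poly_deg_le_snd2: "(\<lambda>p. (snd p)\<^sup>2) \<in> poly_deg_le 2"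
  using poly_deg_le_monom[of "\<lambda>_. 0" 2 2 1] by (simp add: full_monom_def vmonom_def)

lemma poly_deg_le_norm2: "(\<lambda>p. (norm (fst p))\<^sup>2) \<in> poly_deg_le 2"
  unfolding power2_norm_eq_inner inner_vec_sum
  by (intro poly_deg_le_sum poly_deg_le_mult[OF poly_deg_le_component poly_deg_le_component]) simp

lemma poly_deg_le_exp_ball:
  assumes "P \<in> poly_deg_le 1" "W \<in> poly_deg_le 2" "i \<le> n"
  shows "(\<lambda>p. exp_ball \<mu> i (P p) (W p)) \<in> poly_deg_le n"
proof -
  have "(\<lambda>p. (1 / fact (i - 2 * h) * P p ^ (i - 2 * h)) * ((1 / (4 ^ h * (fact h * pochhammer (\<mu> + 1/2) h))) * W p ^ h)) \<in> poly_deg_le n"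
    if "h \<in> {..i div 2}" for h
    using that assms(3) by (intro poly_deg_le_mult[OF poly_deg_le_cmult[OF poly_deg_le_power[OF assms(1) order_refl]]
      poly_deg_le_cmult[OF poly_deg_le_power[OF assms(2) order_refl]]]) auto
  then have "(\<lambda>p. \<Sum>h\<le>i div 2. (1 / fact (i - 2 * h) * P p ^ (i - 2 * h)) * ((1 / (4 ^ h * (fact h * pochhammer (\<mu> + 1/2) h))) * W p ^ h)) \<in> poly_deg_le n"
    by (rule poly_deg_le_sum)
  then show ?thesis by (simp add: exp_ball_def power_divide)
qed

lemma poly_deg_le_exp_cone:
  assumes "P \<in> poly_deg_le 1" "W \<in> poly_deg_le 2" "T \<in> poly_deg_le 2" "k \<le> n"
  shows "(\<lambda>p. exp_cone d \<beta> \<mu> k (P p) (W p) (T p)) \<in> poly_deg_le n"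
  unfolding exp_cone_def
proof (rule poly_deg_le_sum)
  fix j assume j: "j \<in> {..k div 2}"
  show "(\<lambda>p. exp_ball \<mu> (k - 2 * j) (P p) (W p) * (pochhammer (\<mu> + (real d + 1) / 2) (k - 2 * j) *
      hagen j (\<beta> - 1/2) / (4 ^ j * pochhammer (alpha d \<beta> \<mu> + 1/2) k) * T p ^ j)) \<in> poly_deg_le n"
    using j assms(4) by (intro poly_deg_le_mult[OF poly_deg_le_exp_ball[OF assms(1,2) order_refl]
      poly_deg_le_cmult[OF poly_deg_le_power[OF assms(3) order_refl]]]) auto
qed

text \<open>With q fixed, the four arguments of \<open>exp_full\<close> are polynomials in p of
  degrees 1, 2, 2, 2, and every term has weighted degree m.\<close>

lemma poly_deg_le_exp_kernel:
  assumes "m \<le> n"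
  shows "(\<lambda>p. exp_kernel \<beta> \<gamma> \<mu> m p q) \<in> poly_deg_le n"
  unfolding exp_kernel_def exp_full_def
proof (rule poly_deg_le_sum)
  fix l assume l: "l \<in> {..m div 2}"
  have 1: "(\<lambda>p. ((snd p)\<^sup>2 - (norm (fst p))\<^sup>2) * a) \<in> poly_deg_le 2" "(\<lambda>p. (snd p)\<^sup>2 * a) \<in> poly_deg_le 2"
    "(\<lambda>p. (1 - (snd p)\<^sup>2) * a) \<in> poly_deg_le 2" for a :: real
    by (subst mult.commute, intro poly_deg_le_cmult poly_deg_le_diff poly_deg_le_const poly_deg_le_snd2 poly_deg_le_norm2)+
  have "(\<lambda>p. ((1 - (snd p)\<^sup>2) * a / 4) ^ l / D) \<in> poly_deg_le (2 * l)" for a D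
  proof -
    have "(\<lambda>p. (1 / D) * ((1 - (snd p)\<^sup>2) * (a / 4)) ^ l) \<in> poly_deg_le (2 * l)"
      by (intro poly_deg_le_cmult poly_deg_le_power[OF 1(3)]) simp
    then show ?thesis by simp
  qed
  then show "(\<lambda>p. exp_cone CARD('a) \<beta> \<mu> (m - 2 * l) (fst p \<bullet> fst q)
      (((snd p)\<^sup>2 - (norm (fst p))\<^sup>2) * ((snd q)\<^sup>2 - (norm (fst q))\<^sup>2)) ((snd p)\<^sup>2 * (snd q)\<^sup>2) *
     (((1 - (snd p)\<^sup>2) * (1 - (snd q)\<^sup>2) / 4) ^ l / (fact l * pochhammer (\<gamma> + 1/2) l))) \<in> poly_deg_le n"
    using l assms
    by (intro poly_deg_le_mult[OF poly_deg_le_exp_cone[OF poly_deg_le_inner 1(1,2) order_refl]]) auto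
qed

lemma full_monom_continuous [continuous_intros]: "continuous_on S (full_monom k m)"
  unfolding full_monom_def[abs_def] by (intro continuous_intros)

lemma poly_deg_le_continuous:
  assumes "f \<in> poly_deg_le n"
  shows "continuous_on S f"
proof -
  obtain c where "f = (\<lambda>p. \<Sum>(k, m)\<in>{(k, m). (\<Sum>i\<in>UNIV. k i) + m \<le> n}. c (k, m) * full_monom k m p)"
    using assms by (rule poly_deg_leE)
  then show ?thesis by (auto simp: case_prod_unfold intro!: continuous_intros)
qed

lemma exp_kernel_continuous [continuous_intros]: "continuous_on S (\<lambda>p. exp_kernel \<beta> \<gamma> \<mu> n p q)"
  by (rule poly_deg_le_continuous[OF poly_deg_le_exp_kernel[OF order_refl]])

section \<open>Parity in t\<close>

lemma cmean_odd:
  assumes odd: "\<And>x t. f (x, - t) = - f (x :: real ^ 'd, t)"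
  shows "cmean \<beta> \<gamma> \<mu> f = 0"
proof -
  define h where "h p = indicator double_cone p * (f p * cone_weight \<beta> \<gamma> \<mu> p)" for p
  have hodd: "h (x, - t) = - h (x, t)" for x t
    by (simp add: h_def odd cone_weight_def indicator_def double_cone_def) auto
  have "(LINT p|lborel. h p) = 0"
  \<comment> \<open>Reflection in t settles the integrable case; otherwise the Bochner integral is 0
    by convention.\<close>
  proof (cases "integrable lborel h")
    case True
    then have "integrable (lborel \<Otimes>\<^sub>M lborel) h" by (simp add: lborel_prod)
    then have "(LINT p|(lborel \<Otimes>\<^sub>M lborel). h p) = (LINT x|lborel. LINT t|lborel. h (x, t))"
      using lborel_pair.integral_fst[of "\<lambda>x t. h (x, t)"] by (simp add: case_prod_unfold)
    also have "(\<lambda>x. LINT t|lborel. h (x, t)) = (\<lambda>x. 0)"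
    proof
      fix x
      have "(LINT t|lborel. h (x, t)) = (LINT t|lborel. h (x, 0 + (- 1) * t))"
        using lborel_integral_real_affine[of "-1" "\<lambda>t. h (x, t)" 0] by simp
      also have "\<dots> = - (LINT t|lborel. h (x, t))" by (simp add: hodd)
      finally show "(LINT t|lborel. h (x, t)) = 0" by simp
    qed
    finally show ?thesis by (simp add: lborel_prod)
  qed (rule not_integrable_integral_eq)
  then show ?thesis by (simp add: cmean_def wint_def set_lebesgue_integral_def h_def)
qed

lemma poly_deg_le_flip:
  assumes "h \<in> poly_deg_le k"
  shows "(\<lambda>p. h (fst p, - snd p)) \<in> poly_deg_le k"
proof -
  obtain c where c: "h = (\<lambda>p. \<Sum>(k', m)\<in>{(k', m). (\<Sum>i\<in>UNIV. k' i) + m \<le> k}. c (k', m) * full_monom k' m p)"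
    using assms by (rule poly_deg_leE)
  show ?thesis
  proof (rule poly_deg_leI[where c = "\<lambda>u. (- 1) ^ snd u * c u"])
    fix p
    show "h (fst p, - snd p) = (\<Sum>(k', m)\<in>{(k', m). (\<Sum>i\<in>UNIV. k' i) + m \<le> k}. (- 1) ^ snd (k', m) * c (k', m) * full_monom k' m p)"
      unfolding c by (intro sum.cong refl) (auto simp: full_monom_def power_minus[of "snd p"])
  qed
qed

text \<open>Reduces orthogonality to all polynomials of lower degree to those of one parity;
  \<open>cmean_odd\<close> disposes of the other.\<close>

lemma poly_deg_le_parity_split:
  assumes h: "h \<in> poly_deg_le k"
  obtains h1 h2 where "h = (\<lambda>p. h1 p + h2 p)" "h1 \<in> poly_deg_le k" "h2 \<in> poly_deg_le k"
    "\<And>x t. h1 (x, - t) = h1 (x, t)" "\<And>x t. h2 (x, - t) = - h2 (x, t)"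
proof -
  let ?f = "\<lambda>p. h (fst p, - snd p)"
  show ?thesis
  proof (rule that[of "\<lambda>p. 1/2 * (h p + ?f p)" "\<lambda>p. 1/2 * (h p - ?f p)"])
    show "(\<lambda>p. 1/2 * (h p + ?f p)) \<in> poly_deg_le k" "(\<lambda>p. 1/2 * (h p - ?f p)) \<in> poly_deg_le k"
      by (intro poly_deg_le_cmult poly_deg_le_add poly_deg_le_diff poly_deg_le_flip h)+
    show "h = (\<lambda>p. 1/2 * (h p + ?f p) + 1/2 * (h p - ?f p))" by (simp add: fun_eq_iff field_simps)
  qed (simp_all add: diff_divide_distrib)
qed

text \<open>Antisymmetrizing in t discards the even powers from whatever representation
  \<open>c\<close> is chosen, and t divides the remaining monomials. For n = 0 none remain.\<close>

lemma odd_poly_factor: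
  assumes h: "h \<in> poly_deg_le n" and odd: "\<And>x t. h (x, - t) = - h (x, t)"
  shows "n = 0 \<Longrightarrow> h = (\<lambda>_. 0)"
    and "n > 0 \<Longrightarrow> \<exists>f \<in> poly_deg_le (n - 1). (\<forall>x t. f (x, - t) = f (x, t)) \<and> h = (\<lambda>p. snd p * f p)"
proof -
  obtain c where c: "h = (\<lambda>p. \<Sum>(k, m)\<in>{(k, m). (\<Sum>i\<in>UNIV. k i) + m \<le> n}. c (k, m) * full_monom k m p)"
    using h by (rule poly_deg_leE)
  let ?I = "{(k :: 'a \<Rightarrow> nat, m). (\<Sum>i\<in>UNIV. k i) + m \<le> n}"
  define I where "I = {u \<in> ?I. odd (snd u)}"
  define f where "f p = (\<Sum>u\<in>I. c u * full_monom (fst u) (snd u - 1) p)" for p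
  have "h p = snd p * f p" for p
  proof -
    obtain x t where p: "p = (x, t)" by (cases p)
    have sgn: "full_monom k m (x, - t) = (if even m then 1 else - 1) * full_monom k m (x, t)" for k m
      by (simp add: full_monom_def)
    have red: "full_monom k m p = snd p * full_monom k (m - 1) p" if "odd m" for k m
      using that by (cases m) (simp_all add: full_monom_def)
    have "h p = (h (x, t) - h (x, - t)) / 2" by (simp add: p odd)
    also have "\<dots> = (\<Sum>u\<in>?I. (c u * full_monom (fst u) (snd u) (x, t) - c u * full_monom (fst u) (snd u) (x, - t)) / 2)"
      unfolding c by (simp add: sum_subtractf[symmetric] sum_divide_distrib[symmetric] case_prod_unfold)
    also have "\<dots> = (\<Sum>u\<in>?I. if odd (snd u) then c u * full_monom (fst u) (snd u) p else 0)"
      by (intro sum.cong refl) (auto simp: sgn p)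
    also have "\<dots> = (\<Sum>u\<in>I. c u * full_monom (fst u) (snd u) p)"
      unfolding I_def by (rule sum.inter_filter[OF finite_poly_index, symmetric])
    also have "\<dots> = (\<Sum>u\<in>I. snd p * (c u * full_monom (fst u) (snd u - 1) p))"
      by (intro sum.cong refl) (simp add: I_def red)
    finally show ?thesis by (simp add: f_def sum_distrib_left)
  qed
  then have eq: "h = (\<lambda>p. snd p * f p)" by (rule ext)
  show "h = (\<lambda>_. 0)" if "n = 0"
  proof -
    have "I = {}" using that by (auto simp: I_def)
    then show ?thesis by (simp add: eq f_def)
  qed
  show "\<exists>f \<in> poly_deg_le (n - 1). (\<forall>x t. f (x, - t) = f (x, t)) \<and> h = (\<lambda>p. snd p * f p)" if "n > 0"
  proof (intro bexI[of _ f] conjI allI eq)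
    show "f \<in> poly_deg_le (n - 1)"
      unfolding f_def[abs_def]
    proof (intro poly_deg_le_sum poly_deg_le_monom)
      fix u assume "u \<in> I"
      then have "sum (fst u) UNIV + snd u \<le> n" "snd u > 0" by (auto simp: I_def elim!: oddE)
      then show "sum (fst u) UNIV + (snd u - 1) \<le> n - 1" by linarith
    qed
    show "f (x, - t) = f (x, t)" for x t
      unfolding f_def by (intro sum.cong refl) (auto simp: I_def full_monom_def)
  qed
qed

section \<open>The reproducing kernel\<close>

text \<open>With N = (n - j)/2 + a this combines (n + j)/2 = (j - a) + N and N / N! = 1 / (N - 1)!.
  For negative N everything is 0.\<close>

lemma inv_fact_step_Suc:
  assumes "even (n + j)"
  shows "(real (n + j) / 2) * inv_fact_step n j a =
    (real j - real a) * inv_fact_step n (j + 2) (Suc a) + inv_fact_step n (j + 2) a"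
proof (cases "j \<le> n + 2 * a")
  case True
  have "even (n + 2 * a - j)" using assms True by simp
  then obtain N where N: "n + 2 * a - j = 2 * N" by blast
  then have n: "n + 2 * a = j + 2 * N" using True by simp
  have 1: "inv_fact_step n j a = 1 / fact N" "inv_fact_step n (j + 2) (Suc a) = 1 / fact N"
    using n True by (simp_all add: inv_fact_step_def)
  have 2: "inv_fact_step n (j + 2) a = real N / fact N"
  proof (cases N)
    case (Suc M)
    then have "(n + 2 * a - (j + 2)) div 2 = M" "j + 2 \<le> n + 2 * a" using n by auto
    then show ?thesis using Suc by (simp add: inv_fact_step_def field_simps del: of_nat_Suc)
  qed (use n in \<open>simp add: inv_fact_step_def\<close>)
  have "real n + 2 * real a = real j + 2 * real N"
    using arg_cong[OF n, of real] by simp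
  then have "real (n + j) / 2 = (real j - real a) + real N" by simp
  then show ?thesis unfolding 1 2 by (simp add: add_divide_distrib)
qed (auto simp: inv_fact_step_def)

text \<open>At n = j - 2 a the terms below a drop out, so an expansion is a triangular system for
  its coefficients.\<close>

lemma inv_fact_step_self: "inv_fact_step (j - 2 * a) j r = (if a \<le> r then 1 / fact (r - a) else 0)"
  if "2 * a \<le> j"
proof -
  have "j - 2 * a + 2 * r - j = 2 * (r - a)" using that by auto
  then show ?thesis using that by (simp add: inv_fact_step_def) linarith
qed

lemma has_expansionD:
  fixes f :: "(real ^ 'd) \<times> real \<Rightarrow> real"
  assumes "has_expansion \<beta> \<gamma> \<mu> j f F"
  shows "F 0 = f"
    and "odd (n + j) \<Longrightarrow> exp_mean \<beta> \<gamma> \<mu> n f q = 0"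
    and "even (n + j) \<Longrightarrow> exp_mean \<beta> \<gamma> \<mu> n f q *
        pochhammer (alpha CARD('d) \<beta> \<mu> + \<gamma> + 1) ((n + j) div 2) * 2 ^ n =
        (\<Sum>a\<le>j div 2. F a q * inv_fact_step n j a)"
  using assms unfolding has_expansion_def by blast+

section \<open>Expandable polynomials\<close>

context
  fixes \<beta> \<gamma> \<mu> :: real
  assumes b: "\<beta> \<ge> 1/2" and g: "\<gamma> > - 1/2" and m: "\<mu> > - 1/2"
begin

lemma alpha_gt: "alpha CARD('d::finite) \<beta> \<mu> > - 1/2"
  using alpha_pos[OF b g m, where 'd='d] by simp

text \<open>Continuity is part of the notion because additivity of \<open>cmean\<close> is stated
  for continuous functions.\<close>

definition expandable :: "nat \<Rightarrow> ((real ^ 'd) \<times> real \<Rightarrow> real) \<Rightarrow> bool" where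
  "expandable j f \<longleftrightarrow> continuous_on UNIV f \<and> (\<exists>F. has_expansion \<beta> \<gamma> \<mu> j f F)"

lemma expandable_zero: "expandable j (\<lambda>_ :: (real ^ 'd) \<times> real. 0)"
  unfolding expandable_def has_expansion_def
  by (auto intro!: exI[of _ "\<lambda>_ _. 0"] simp: cmean_def wint_def)

lemma expandable_add:
  fixes f f' :: "(real ^ 'd) \<times> real \<Rightarrow> real"
  assumes "expandable j f" "expandable j f'"
  shows "expandable j (\<lambda>p. f p + f' p)"
proof -
  obtain F F' where F: "has_expansion \<beta> \<gamma> \<mu> j f F" "has_expansion \<beta> \<gamma> \<mu> j f' F'"
    and c: "continuous_on UNIV f" "continuous_on UNIV f'"
    using assms unfolding expandable_def by blast
  have "cmean \<beta> \<gamma> \<mu> (\<lambda>p. (f p + f' p) * exp_kernel \<beta> \<gamma> \<mu> n p q) =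
      exp_mean \<beta> \<gamma> \<mu> n f q + exp_mean \<beta> \<gamma> \<mu> n f' q" for n q
    unfolding distrib_right by (intro cmean_add[OF g m alpha_gt] continuous_intros c)
  then have "has_expansion \<beta> \<gamma> \<mu> j (\<lambda>p. f p + f' p) (\<lambda>a p. F a p + F' a p)"
    using F unfolding has_expansion_def by (simp add: distrib_right sum.distrib)
  then show ?thesis using c unfolding expandable_def by (auto intro!: continuous_intros)
qed

lemma expandable_cmult:
  fixes f :: "(real ^ 'd) \<times> real \<Rightarrow> real"
  assumes "expandable j f"
  shows "expandable j (\<lambda>p. c * f p)"
proof -
  obtain F where F: "has_expansion \<beta> \<gamma> \<mu> j f F" and cf: "continuous_on UNIV f"
    using assms unfolding expandable_def by blast
  have "cmean \<beta> \<gamma> \<mu> (\<lambda>p. c * f p * exp_kernel \<beta> \<gamma> \<mu> n p q) =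
      c * exp_mean \<beta> \<gamma> \<mu> n f q" for n q
    unfolding mult.assoc by (rule cmean_cmult[OF g m])
  then have "has_expansion \<beta> \<gamma> \<mu> j (\<lambda>p. c * f p) (\<lambda>a p. c * F a p)"
    using F unfolding has_expansion_def by (simp add: sum_distrib_left mult.assoc)
  then show ?thesis using cf unfolding expandable_def by (auto intro!: continuous_intros)
qed

lemma expandable_sum:
  fixes f :: "'i \<Rightarrow> (real ^ 'd) \<times> real \<Rightarrow> real"
  assumes "\<And>i. i \<in> I \<Longrightarrow> expandable j (f i)"
  shows "expandable j (\<lambda>p. \<Sum>i\<in>I. f i p)"
  using assms by (induction I rule: infinite_finite_induct) (simp_all add: expandable_zero expandable_add)

text \<open>On the sphere a polynomial of degree \<open>j\<close> is also one of degree \<open>j + 2\<close>.\<close>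

lemma expandable_add2:
  fixes f :: "(real ^ 'd) \<times> real \<Rightarrow> real"
  assumes "expandable j f"
  shows "expandable (j + 2) f"
proof -
  obtain F where F: "has_expansion \<beta> \<gamma> \<mu> j f F" and cf: "continuous_on UNIV f"
    using assms unfolding expandable_def by blast
  define \<Lambda> where "\<Lambda> = alpha CARD('d) \<beta> \<mu> + \<gamma> + 1"
  \<comment> \<open>Passing to j + 2 multiplies the rising factorial by \<Lambda> + (n + j)/2. By
    \<open>inv_fact_step_Suc\<close> this acts as \<Lambda> + j - a on index a + 1 and as 1 on index
    a.\<close>
  define F' where "F' a q = (if a \<le> j div 2 then F a q else 0) +
     (if a = 0 then 0 else (\<Lambda> + real j - real (a - 1)) * F (a - 1) q)" for a q
  have "has_expansion \<beta> \<gamma> \<mu> (j + 2) f F'"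
    unfolding has_expansion_def
  proof (intro conjI allI impI)
    show "F' 0 = f" using has_expansionD(1)[OF F] by (auto simp: F'_def)
    fix n q
    show "exp_mean \<beta> \<gamma> \<mu> n f q = 0" if "odd (n + (j + 2))"
      by (rule has_expansionD(2)[OF F]) (use that in simp)
    assume "even (n + (j + 2))"
    then have ev: "even (n + j)" by simp
    let ?c = "exp_mean \<beta> \<gamma> \<mu> n f q"
    have s: "(n + (j + 2)) div 2 = Suc ((n + j) div 2)" by simp
    have r: "real ((n + j) div 2) = real (n + j) / 2" 
      using real_of_nat_div[OF ev] by (simp only: of_nat_numeral)
    have "?c * pochhammer \<Lambda> ((n + (j + 2)) div 2) * 2 ^ n =
        (\<Lambda> + real (n + j) / 2) * (?c * pochhammer \<Lambda> ((n + j) div 2) * 2 ^ n)"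
      unfolding s pochhammer_Suc r by (simp add: mult_ac)
    also have "?c * pochhammer \<Lambda> ((n + j) div 2) * 2 ^ n = (\<Sum>a\<le>j div 2. F a q * inv_fact_step n j a)"
      unfolding \<Lambda>_def by (rule has_expansionD(3)[OF F ev])
    also have "(\<Lambda> + real (n + j) / 2) * \<dots> = (\<Sum>a\<le>j div 2. F a q * (\<Lambda> * inv_fact_step n (j + 2) (Suc a)
        + (real (n + j) / 2) * inv_fact_step n j a))"
      unfolding sum_distrib_left by (intro sum.cong refl) (simp add: inv_fact_step_def algebra_simps)
    also have "\<dots> = (\<Sum>a\<le>j div 2. (\<Lambda> + real j - real a) * F a q * inv_fact_step n (j + 2) (Suc a))
        + (\<Sum>a\<le>j div 2. F a q * inv_fact_step n (j + 2) a)"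
      unfolding inv_fact_step_Suc[OF ev] sum.distrib[symmetric] by (intro sum.cong refl) (simp add: algebra_simps)
    also have "(\<Sum>a\<le>j div 2. (\<Lambda> + real j - real a) * F a q * inv_fact_step n (j + 2) (Suc a)) =
        (\<Sum>a\<le>Suc (j div 2). (if a = 0 then 0 else (\<Lambda> + real j - real (a - 1)) * F (a - 1) q) * inv_fact_step n (j + 2) a)"
      by (subst sum.atMost_Suc_shift) simp
    also have "(\<Sum>a\<le>j div 2. F a q * inv_fact_step n (j + 2) a) =
        (\<Sum>a\<le>Suc (j div 2). (if a \<le> j div 2 then F a q else 0) * inv_fact_step n (j + 2) a)"
      by simp
    finally have "?c * pochhammer \<Lambda> ((n + (j + 2)) div 2) * 2 ^ n =
       (\<Sum>a\<le>Suc (j div 2). F' a q * inv_fact_step n (j + 2) a)"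
      unfolding F'_def distrib_right sum.distrib by linarith
    then show "?c * pochhammer (alpha CARD('d) \<beta> \<mu> + \<gamma> + 1) ((n + (j + 2)) div 2) * 2 ^ n =
        (\<Sum>a\<le>(j + 2) div 2. F' a q * inv_fact_step n (j + 2) a)"
      by (simp add: \<Lambda>_def)
  qed
  then show ?thesis using cf unfolding expandable_def by blast
qed

lemma expandable_even_monom:
  assumes "sum k UNIV + 2 * e \<le> n" "even (n + sum k UNIV)"
  shows "expandable n (even_monom k e)"
proof -
  obtain s where s: "n = sum k UNIV + 2 * e + 2 * s"
  proof -
    have "even (n - (sum k UNIV + 2 * e))" using assms by simp
    then obtain s where "n - (sum k UNIV + 2 * e) = 2 * s" by blast
    then show ?thesis using that[of s] assms(1) by simp
  qed
  have "expandable (sum k UNIV + 2 * e + 2 * s) (even_monom k e)"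
  proof (induction s)
    case 0
    have "continuous_on UNIV (even_monom k e)" unfolding even_monom_def[abs_def] by (intro continuous_intros)
    then show ?case using even_monom_has_expansion[OF b g m] unfolding expandable_def by auto
  next
    case (Suc s)
    have "sum k UNIV + 2 * e + 2 * Suc s = sum k UNIV + 2 * e + 2 * s + 2" by simp
    then show ?case using expandable_add2[OF Suc] by (simp only:)
  qed
  then show ?thesis by (simp add: s)
qed

text \<open>\<open>f1\<close> and \<open>f2\<close> collect the monomials whose degree has, or has not, the parity of \<open>n\<close>.\<close>

lemma even_poly_decompose:
  assumes f: "f \<in> poly_deg_le n" and even: "\<And>x t. f (x, - t) = f (x, t)"
  obtains f1 f2 where "f = (\<lambda>p. f1 p + f2 p)" "expandable n f1" "n = 0 \<Longrightarrow> f2 = (\<lambda>_. 0)"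
    "n > 0 \<Longrightarrow> expandable (n - 1) f2"
proof -
  obtain c where c: "f = (\<lambda>p. \<Sum>(k, m)\<in>{(k, m). (\<Sum>i\<in>UNIV. k i) + m \<le> n}. c (k, m) * full_monom k m p)"
    using f by (rule poly_deg_leE)
  let ?I = "{(k :: 'a \<Rightarrow> nat, m). (\<Sum>i\<in>UNIV. k i) + m \<le> n}"
  define g where "g u p = c u * even_monom (fst u) (snd u div 2) p" for u :: "('a \<Rightarrow> nat) \<times> nat" and p
  define I1 where "I1 = {u \<in> ?I. even (snd u) \<and> even (n + sum (fst u) UNIV)}"
  define I2 where "I2 = {u \<in> ?I. even (snd u) \<and> odd (n + sum (fst u) UNIV)}"
  have fin: "finite I1" "finite I2" "I1 \<inter> I2 = {}"
    unfolding I1_def I2_def using finite_poly_index[of n] by auto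
  have "f p = (\<Sum>u\<in>I1 \<union> I2. g u p)" for p
  proof -
    obtain x t where p: "p = (x, t)" by (cases p)
    have sgn: "full_monom k m (x, - t) = (if even m then 1 else - 1) * full_monom k m (x, t)" for k m
      by (simp add: full_monom_def)
    have "f p = (f (x, t) + f (x, - t)) / 2" by (simp add: p even)
    also have "\<dots> = (\<Sum>u\<in>?I. (c u * full_monom (fst u) (snd u) (x, t) + c u * full_monom (fst u) (snd u) (x, - t)) / 2)"
      unfolding c by (simp add: sum.distrib[symmetric] sum_divide_distrib[symmetric] case_prod_unfold)
    also have "\<dots> = (\<Sum>u\<in>?I. if even (snd u) then g u p else 0)"
      by (intro sum.cong refl) (auto simp: sgn g_def p full_monom_def even_monom_def power_mult[symmetric] elim!: evenE)
    also have "\<dots> = (\<Sum>u\<in>{u \<in> ?I. even (snd u)}. g u p)"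
      by (rule sum.inter_filter[OF finite_poly_index, symmetric])
    also have "{u \<in> ?I. even (snd u)} = I1 \<union> I2" unfolding I1_def I2_def by blast
    finally show ?thesis .
  qed
  then have eq: "f = (\<lambda>p. (\<Sum>u\<in>I1. g u p) + (\<Sum>u\<in>I2. g u p))"
    using fin by (auto simp: sum.union_disjoint)
  show ?thesis
  proof (rule that[OF eq])
    show "expandable n (\<lambda>p. \<Sum>u\<in>I1. g u p)"
      unfolding g_def by (intro expandable_sum expandable_cmult expandable_even_monom) (auto simp: I1_def elim!: evenE)
    have I2: "sum (fst u) UNIV + 2 * (snd u div 2) \<le> n - 1 \<and> n > 0 \<and> even (n - 1 + sum (fst u) UNIV)" if "u \<in> I2" for u
    proof -
      have u: "sum (fst u) UNIV + snd u \<le> n" "even (snd u)" "odd (n + sum (fst u) UNIV)"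
        using that by (auto simp: I2_def)
      \<comment> \<open>Parity excludes degree n, since the degree plus n is odd.\<close>
      then have "sum (fst u) UNIV + snd u \<noteq> n" by auto
      with u have "sum (fst u) UNIV + snd u < n" by simp
      with u show ?thesis by auto
    qed
    show "(\<lambda>p. \<Sum>u\<in>I2. g u p) = (\<lambda>_. 0)" if "n = 0"
    proof -
      have "I2 = {}" using I2 that by blast
      then show ?thesis by simp
    qed
    show "expandable (n - 1) (\<lambda>p. \<Sum>u\<in>I2. g u p)" if "n > 0"
      unfolding g_def using I2 by (intro expandable_sum expandable_cmult expandable_even_monom) auto
  qed
qed

text \<open>Testing in degree j - 2 a leaves the indices r \<ge> a, and those above a vanish by
  downward induction. With s = 0 this shows that the function itself is 0; with s = 1 it removes all
  coefficients but the zeroth.\<close>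

lemma has_expansion_vanish:
  fixes f :: "(real ^ 'd) \<times> real \<Rightarrow> real"
  assumes F: "has_expansion \<beta> \<gamma> \<mu> j f F"
    and z: "\<And>k q. k + 2 * s \<le> j \<Longrightarrow> exp_mean \<beta> \<gamma> \<mu> k f q = 0"
    and "s \<le> a" "a \<le> j div 2"
  shows "F a q = 0"
  using assms(3,4)
proof (induction "j div 2 - a" arbitrary: a rule: less_induct)
  case less
  define k where "k = j - 2 * a"
  have k: "even (k + j)" "k + 2 * s \<le> j" "2 * a \<le> j" using less.prems by (auto simp: k_def)
  have "(\<Sum>r\<le>j div 2. F r q * inv_fact_step k j r) = 0"
    using has_expansionD(3)[OF F k(1), of q] z[OF k(2), of q] by simp
  moreover have single: "F r q * inv_fact_step k j r = (if r = a then F a q else 0)" if "r \<in> {..j div 2}" for r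
  proof (cases "r > a")
    case True
    then have "F r q = 0" using that less.prems by (intro less.hyps) auto
    then show ?thesis using True by simp
  qed (use inv_fact_step_self[OF k(3), of r] in \<open>auto simp: k_def\<close>)
  moreover have "(\<Sum>r\<le>j div 2. F r q * inv_fact_step k j r) = (\<Sum>r\<le>j div 2. if r = a then F a q else 0)"
    by (rule sum.cong[OF refl single])
  ultimately have "(\<Sum>r\<le>j div 2. if r = a then F a q else 0) = 0" by simp
  then show ?case using less.prems by simp
qed

end

text \<open>\<open>Z_poly\<close> with each r^m / m! replaced by \<open>exp_kernel\<close> of degree
  m. It makes sense on the closed parameter region of the theorem.\<close>

definition zonal_kernel :: "real \<Rightarrow> real \<Rightarrow> real \<Rightarrow> nat \<Rightarrow> (real ^ 'd) \<times> real \<Rightarrow> (real ^ 'd) \<times> real \<Rightarrow> real" where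
  "zonal_kernel \<beta> \<gamma> \<mu> n p q = (let \<nu> = alpha CARD('d) \<beta> \<mu> + \<gamma> in
     \<Sum>k\<le>n div 2. (real n + \<nu>) / \<nu> * ((-1) ^ k * pochhammer \<nu> (n - k) / fact k * 2 ^ (n - 2 * k)) *
       exp_kernel \<beta> \<gamma> \<mu> (n - 2 * k) p q)"

text \<open>With N = (n - j)/2 > 0 the quotient of the rising factorials is \<nu> times a polynomial
  of degree N - 1 in k, while the reciprocal factorials form a binomial coefficient of order N + a.
  For j = n and a = 0 only the term k = 0 survives.\<close>

lemma gegenbauer_projection_sum:
  fixes \<nu> :: real
  assumes \<nu>: "\<nu> > 0" and ev: "even (n + j)" and jn: "j \<le> n" and aj: "a \<le> j div 2"
  defines "S \<equiv> (\<Sum>k\<le>n div 2. (real n + \<nu>) / \<nu> * ((-1) ^ k * pochhammer \<nu> (n - k) / fact k) *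
       (inv_fact_step (n - 2 * k) j a / pochhammer (\<nu> + 1) ((n - 2 * k + j) div 2)))"
  shows "j < n \<Longrightarrow> S = 0" and "j = n \<Longrightarrow> a = 0 \<Longrightarrow> S = 1"
proof -
  have "even (n - j)" using ev jn by simp
  then obtain N where "n - j = 2 * N" by blast
  then have N: "n = j + 2 * N" using jn by simp
  let ?f = "\<lambda>k. (real n + \<nu>) / \<nu> * ((-1) ^ k * pochhammer \<nu> (n - k) / fact k) *
       (inv_fact_step (n - 2 * k) j a / pochhammer (\<nu> + 1) ((n - 2 * k + j) div 2))"
  have fs: "inv_fact_step (n - 2 * k) j a = (if k \<le> N + a then 1 / fact (N + a - k) else 0)" if "k \<le> n div 2" for k
  proof -
    have "2 * k \<le> n" using that by simp
    then have "n - 2 * k + 2 * a - j = 2 * (N + a - k)" "j \<le> n - 2 * k + 2 * a \<longleftrightarrow> k \<le> N + a" using N by auto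
    then show ?thesis by (simp add: inv_fact_step_def)
  qed
  show "S = 0" if "j < n"
  proof -
    have N0: "N > 0" using that N by simp
    \<comment> \<open>Chosen so that \<nu> + 1 + M becomes x - k for M = j + N - k, the length of
      the rising factorial in the denominator.\<close>
    define x where "x = \<nu> + 1 + real (j + N)"
    have "S = (\<Sum>k\<le>N + a. ?f k)"
      unfolding S_def
    proof (rule sum.mono_neutral_right)
      show "{..N + a} \<subseteq> {..n div 2}" using N aj by auto
      show "\<forall>k\<in>{..n div 2} - {..N + a}. ?f k = 0" by (simp add: fs)
    qed simp
    also have "\<dots> = (\<Sum>k\<le>N + a. (real n + \<nu>) / fact (N + a) *
        ((-1) ^ k * of_nat (N + a choose k) * pochhammer (x - real k) (N - 1)))"
    proof (intro sum.cong refl)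
      fix k assume "k \<in> {..N + a}"
      then have k: "k \<le> N + a" by simp
      then have k2: "k \<le> n div 2" "k \<le> j + N" using N aj by auto
      define M where "M = j + N - k"
      have "n - k = M + N" "(n - 2 * k + j) div 2 = M" using N k2 by (auto simp: M_def)
      moreover have "pochhammer \<nu> (M + N) = \<nu> * (pochhammer (\<nu> + 1) M * pochhammer (x - real k) (N - 1))"
      proof -
        have "pochhammer \<nu> (M + N) = pochhammer \<nu> (Suc (M + (N - 1)))" using N0 by simp
        also have "\<dots> = \<nu> * (pochhammer (\<nu> + 1) M * pochhammer (\<nu> + 1 + real M) (N - 1))"
          unfolding pochhammer_rec pochhammer_product' ..
        also have "\<nu> + 1 + real M = x - real k" using k2 by (simp add: x_def M_def of_nat_diff)
        finally show ?thesis .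
      qed
      moreover have "pochhammer (\<nu> + 1) M > 0" using \<nu> by (simp add: pochhammer_pos)
      moreover have "real (N + a choose k) = fact (N + a) / (fact k * fact (N + a - k))"
        using k by (rule binomial_fact)
      ultimately show "?f k = (real n + \<nu>) / fact (N + a) *
        ((-1) ^ k * of_nat (N + a choose k) * pochhammer (x - real k) (N - 1))"
        using k \<nu> by (simp add: fs[OF k2(1)])
    qed
    also have "\<dots> = (real n + \<nu>) / fact (N + a) *
        (\<Sum>k\<le>N + a. (-1) ^ k * of_nat (N + a choose k) * pochhammer (x - real k) (N - 1))"
      by (simp only: sum_distrib_left)
    also have "\<dots> = 0" using N0 by (subst finite_difference_pochhammer) auto
    finally show ?thesis .
  qed
  show "S = 1" if "j = n" "a = 0"
  proof -
    have "N = 0" using that N by simp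
    have "S = (\<Sum>k\<in>{0}. ?f k)"
      unfolding S_def
    proof (rule sum.mono_neutral_right)
      show "\<forall>k\<in>{..n div 2} - {0}. ?f k = 0"
      proof
        fix k assume "k \<in> {..n div 2} - {0}"
        then show "?f k = 0" using fs[of k] \<open>N = 0\<close> that by simp
      qed
    qed simp_all
    also have "\<dots> = (real n + \<nu>) / \<nu> * pochhammer \<nu> n / pochhammer (\<nu> + 1) n"
      using \<open>N = 0\<close> that N by (simp add: inv_fact_step_def)
    also have "(real n + \<nu>) / \<nu> * pochhammer \<nu> n = pochhammer (\<nu> + 1) n"
    proof -
      have "(\<nu> + real n) * pochhammer \<nu> n = \<nu> * pochhammer (\<nu> + 1) n"
        using pochhammer_rec[of \<nu> n] pochhammer_rec'[of \<nu> n] by simp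
      then show ?thesis using \<nu> by (simp add: field_simps)
    qed
    also have "pochhammer (\<nu> + 1) n / pochhammer (\<nu> + 1) n = 1"
      using pochhammer_pos[of "\<nu> + 1" n] \<nu> by simp
    finally show ?thesis .
  qed
qed

text \<open>Uniqueness needs no positivity: each of two kernels reproduces the other one.\<close>

lemma reproducing_kernel_unique:
  assumes sym: "\<And>f h. ip f h = ip h f" and K: "is_reproducing_kernel ip V K" 
  shows "reproducing_kernel ip V = K"
  unfolding reproducing_kernel_def
proof (rule the_equality[of "is_reproducing_kernel ip V", OF K])
  fix L assume L: "is_reproducing_kernel ip V L"
  have KV: "(\<lambda>p. K p q) \<in> V" "(\<lambda>p. L p q) \<in> V" for q
    using K L unfolding is_reproducing_kernel_def by blast+
  have rK: "ip f (\<lambda>p. K p q) = f q" "ip f (\<lambda>p. L p q) = f q" if "f \<in> V" for f q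
    using K L that unfolding is_reproducing_kernel_def by blast+
  have "L p q = ip (\<lambda>p. L p q) (\<lambda>r. K r p)" for p q using rK(1)[OF KV(2)] by simp
  also have "ip (\<lambda>p. L p q) (\<lambda>r. K r p) = K q p" for p q using rK(2)[OF KV(1)] sym by metis
  finally have 1: "L p q = K q p" for p q .
  have "K p q = K q p" for p q using rK(1)[OF KV(1)] sym by metis
  with 1 show "L = K" by (intro ext) metis
qed

context
  fixes \<beta> \<gamma> \<mu> :: real
  assumes b: "\<beta> \<ge> 1/2" and g: "\<gamma> > - 1/2" and m: "\<mu> > - 1/2"
begin

text \<open>Inserting the expansion reduces the mean to the sums of
  \<open>gegenbauer_projection_sum\<close>. For j < n these vanish for every a; for j = n only a = 0
  is evaluated there, so the other coefficients have to be 0.\<close>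

lemma cmean_zonal_kernel:
  fixes f :: "(real ^ 'd) \<times> real \<Rightarrow> real"
  assumes F: "has_expansion \<beta> \<gamma> \<mu> j f F" and c: "continuous_on UNIV f" and lam: "alpha CARD('d) \<beta> \<mu> + \<gamma> > 0"
    and j: "j \<le> n"
  shows "j < n \<Longrightarrow> cmean \<beta> \<gamma> \<mu> (\<lambda>p. f p * zonal_kernel \<beta> \<gamma> \<mu> n p q) = 0"
    and "j = n \<Longrightarrow> (\<And>a. 1 \<le> a \<Longrightarrow> a \<le> j div 2 \<Longrightarrow> F a q = 0) \<Longrightarrow>
       cmean \<beta> \<gamma> \<mu> (\<lambda>p. f p * zonal_kernel \<beta> \<gamma> \<mu> n p q) = f q"
proof -
  define \<nu> where "\<nu> = alpha CARD('d) \<beta> \<mu> + \<gamma>"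
  have \<nu>: "\<nu> > 0" using lam by (simp add: \<nu>_def)
  let ?z = "\<lambda>k. (real n + \<nu>) / \<nu> * ((-1) ^ k * pochhammer \<nu> (n - k) / fact k * 2 ^ (n - 2 * k))"
  let ?w = "\<lambda>k. (real n + \<nu>) / \<nu> * ((-1) ^ k * pochhammer \<nu> (n - k) / fact k)"
  have expand: "f p * zonal_kernel \<beta> \<gamma> \<mu> n p q = (\<Sum>k\<le>n div 2. ?z k * (f p * exp_kernel \<beta> \<gamma> \<mu> (n - 2 * k) p q))" for p
    unfolding zonal_kernel_def \<nu>_def[symmetric] Let_def sum_distrib_left by (simp only: mult_ac)
  have s: "cmean \<beta> \<gamma> \<mu> (\<lambda>p. f p * zonal_kernel \<beta> \<gamma> \<mu> n p q) =
      (\<Sum>k\<le>n div 2. ?z k * exp_mean \<beta> \<gamma> \<mu> (n - 2 * k) f q)"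
  proof -
    have "cmean \<beta> \<gamma> \<mu> (\<lambda>p. f p * zonal_kernel \<beta> \<gamma> \<mu> n p q) =
        cmean \<beta> \<gamma> \<mu> (\<lambda>p. \<Sum>k\<le>n div 2. ?z k * (f p * exp_kernel \<beta> \<gamma> \<mu> (n - 2 * k) p q))"
      by (simp only: expand)
    also have "\<dots> = (\<Sum>k\<le>n div 2. cmean \<beta> \<gamma> \<mu> (\<lambda>p. ?z k * (f p * exp_kernel \<beta> \<gamma> \<mu> (n - 2 * k) p q)))"
      by (intro cmean_sum[OF g m alpha_gt[OF b g m]] continuous_intros c)
    finally show ?thesis by (simp only: cmean_cmult[OF g m])
  qed
  have odd: "cmean \<beta> \<gamma> \<mu> (\<lambda>p. f p * zonal_kernel \<beta> \<gamma> \<mu> n p q) = 0" if "odd (n + j)"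
  proof -
    have od: "odd (n - 2 * k + j)" if "k \<le> n div 2" for k
      using \<open>odd (n + j)\<close> that by auto
    have "exp_mean \<beta> \<gamma> \<mu> (n - 2 * k) f q = 0" if "k \<le> n div 2" for k
      by (rule has_expansionD(2)[OF F]) (rule od[OF that])
    then show ?thesis unfolding s by simp
  qed
  have even: "cmean \<beta> \<gamma> \<mu> (\<lambda>p. f p * zonal_kernel \<beta> \<gamma> \<mu> n p q) =
     (\<Sum>a\<le>j div 2. F a q * (\<Sum>k\<le>n div 2. ?w k *
        (inv_fact_step (n - 2 * k) j a / pochhammer (\<nu> + 1) ((n - 2 * k + j) div 2))))" if "even (n + j)"
  proof -
    have "?z k * exp_mean \<beta> \<gamma> \<mu> (n - 2 * k) f q =
      (\<Sum>a\<le>j div 2. F a q * (?w k * (inv_fact_step (n - 2 * k) j a / pochhammer (\<nu> + 1) ((n - 2 * k + j) div 2))))"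
      if "k \<le> n div 2" for k
    proof -
      have "even (n - 2 * k + j)" using \<open>even (n + j)\<close> that by auto
      then have "exp_mean \<beta> \<gamma> \<mu> (n - 2 * k) f q *
        pochhammer (\<nu> + 1) ((n - 2 * k + j) div 2) * 2 ^ (n - 2 * k) =
        (\<Sum>a\<le>j div 2. F a q * inv_fact_step (n - 2 * k) j a)"
        unfolding \<nu>_def by (rule has_expansionD(3)[OF F])
      moreover have "pochhammer (\<nu> + 1) ((n - 2 * k + j) div 2) > 0" using \<nu> by (simp add: pochhammer_pos)
      ultimately have "2 ^ (n - 2 * k) * exp_mean \<beta> \<gamma> \<mu> (n - 2 * k) f q =
        (\<Sum>a\<le>j div 2. F a q * inv_fact_step (n - 2 * k) j a) / pochhammer (\<nu> + 1) ((n - 2 * k + j) div 2)"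
        by (simp add: eq_divide_eq mult_ac)
      moreover have "?z k * x = ?w k * (2 ^ (n - 2 * k) * x)" for x by (simp add: mult_ac)
      ultimately have "?z k * exp_mean \<beta> \<gamma> \<mu> (n - 2 * k) f q =
         ?w k * ((\<Sum>a\<le>j div 2. F a q * inv_fact_step (n - 2 * k) j a) / pochhammer (\<nu> + 1) ((n - 2 * k + j) div 2))"
        by metis
      then show ?thesis by (simp add: sum_distrib_left sum_divide_distrib mult_ac)
    qed
    then have "cmean \<beta> \<gamma> \<mu> (\<lambda>p. f p * zonal_kernel \<beta> \<gamma> \<mu> n p q) = (\<Sum>k\<le>n div 2. \<Sum>a\<le>j div 2.
        F a q * (?w k * (inv_fact_step (n - 2 * k) j a / pochhammer (\<nu> + 1) ((n - 2 * k + j) div 2))))"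
      unfolding s by (intro sum.cong) auto
    then show ?thesis unfolding sum_distrib_left by (subst sum.swap)
  qed
  show "cmean \<beta> \<gamma> \<mu> (\<lambda>p. f p * zonal_kernel \<beta> \<gamma> \<mu> n p q) = 0" if "j < n"
  proof (cases "even (n + j)")
    case True
    have "F a q * (\<Sum>k\<le>n div 2. ?w k *
        (inv_fact_step (n - 2 * k) j a / pochhammer (\<nu> + 1) ((n - 2 * k + j) div 2))) = 0" if "a \<in> {..j div 2}" for a
      using gegenbauer_projection_sum(1)[OF \<nu> True j, of a] that \<open>j < n\<close> by simp
    then show ?thesis unfolding even[OF True] by (intro sum.neutral) blast
  qed (rule odd)
  show "cmean \<beta> \<gamma> \<mu> (\<lambda>p. f p * zonal_kernel \<beta> \<gamma> \<mu> n p q) = f q"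
    if jn: "j = n" and z: "\<And>a. 1 \<le> a \<Longrightarrow> a \<le> j div 2 \<Longrightarrow> F a q = 0"
  proof -
    have ev: "even (n + j)" using jn by simp
    have "F a q * (\<Sum>k\<le>n div 2. ?w k *
        (inv_fact_step (n - 2 * k) j a / pochhammer (\<nu> + 1) ((n - 2 * k + j) div 2))) = (if a = 0 then F 0 q else 0)"
      if "a \<in> {..j div 2}" for a
    proof (cases "a = 0")
      case True
      then show ?thesis using gegenbauer_projection_sum(2)[OF \<nu> ev j _ jn, of a] by simp
    next
      case False
      then have "F a q = 0" using that by (intro z) auto
      then show ?thesis using False by simp
    qed
    then have "cmean \<beta> \<gamma> \<mu> (\<lambda>p. f p * zonal_kernel \<beta> \<gamma> \<mu> n p q) = (\<Sum>a\<le>j div 2. if a = 0 then F 0 q else 0)"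
      unfolding even[OF ev] by (intro sum.cong) blast+
    then show ?thesis using has_expansionD(1)[OF F] by simp
  qed
qed

text \<open>The kernel lies in the space by the case j < n, applied to the two expandable parts of
  an even test polynomial, whose assigned degrees are k and k - 1. The reproducing property is the
  case j = n.\<close>

lemma zonal_kernel_reproducing:
  assumes lam: "alpha CARD('d) \<beta> \<mu> + \<gamma> > 0"
  shows "is_reproducing_kernel (cone_inner (cone_weight \<beta> \<gamma> \<mu>))
     (orth_poly_even (cone_weight \<beta> \<gamma> \<mu>) n :: ((real ^ 'd) \<times> real \<Rightarrow> real) set) (zonal_kernel \<beta> \<gamma> \<mu> n)"
  unfolding is_reproducing_kernel_def
proof (intro conjI allI ballI)
  fix q :: "(real ^ 'd) \<times> real"
  define K where "K p = zonal_kernel \<beta> \<gamma> \<mu> n p q" for p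
  have Kp: "K \<in> poly_deg_le n"
    unfolding K_def[abs_def] zonal_kernel_def Let_def
    by (intro poly_deg_le_sum poly_deg_le_cmult poly_deg_le_exp_kernel) simp
  have Ke: "K (x, - t) = K (x, t)" for x t
    unfolding K_def zonal_kernel_def exp_kernel_def by simp
  have orth: "cmean \<beta> \<gamma> \<mu> (\<lambda>p. K p * h p) = 0" if h: "h \<in> poly_deg_le k" and k: "k < n" for h k
  proof -
    obtain h1 h2 where h12: "h = (\<lambda>p. h1 p + h2 p)" and h1: "h1 \<in> poly_deg_le k" and h2: "h2 \<in> poly_deg_le k"
      and h1e: "\<And>x t. h1 (x, - t) = h1 (x, t)" and h2o: "\<And>x t. h2 (x, - t) = - h2 (x, t)"
      using poly_deg_le_parity_split[OF h] by blast
    have "cmean \<beta> \<gamma> \<mu> (\<lambda>p. K p * h p) = cmean \<beta> \<gamma> \<mu> (\<lambda>p. K p * h1 p + K p * h2 p)"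
      unfolding h12 distrib_left ..
    also have "\<dots> = cmean \<beta> \<gamma> \<mu> (\<lambda>p. K p * h1 p) + cmean \<beta> \<gamma> \<mu> (\<lambda>p. K p * h2 p)"
      by (intro cmean_add[OF g m alpha_gt[OF b g m]] continuous_intros poly_deg_le_continuous[OF Kp]
          poly_deg_le_continuous[OF h1] poly_deg_le_continuous[OF h2])
    also have "cmean \<beta> \<gamma> \<mu> (\<lambda>p. K p * h2 p) = 0"
      by (rule cmean_odd) (simp add: Ke h2o)
    also have "cmean \<beta> \<gamma> \<mu> (\<lambda>p. K p * h1 p) = 0"
    proof -
      obtain f1 f2 where f: "h1 = (\<lambda>p. f1 p + f2 p)" "expandable \<beta> \<gamma> \<mu> k f1" "k = 0 \<Longrightarrow> f2 = (\<lambda>_. 0)"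
          "k > 0 \<Longrightarrow> expandable \<beta> \<gamma> \<mu> (k - 1) f2"
        using even_poly_decompose[OF b g m h1 h1e] by blast
      have z: "cmean \<beta> \<gamma> \<mu> (\<lambda>p. f p * K p) = 0" if "expandable \<beta> \<gamma> \<mu> j f" "j < n" for f j
        using that cmean_zonal_kernel(1)[OF _ _ lam, of j f _ n q] unfolding expandable_def[OF b g m] K_def by auto
      have c2: "continuous_on UNIV f2"
        using f(3,4) unfolding expandable_def[OF b g m] by (cases "k = 0") auto
      have "cmean \<beta> \<gamma> \<mu> (\<lambda>p. K p * h1 p) = cmean \<beta> \<gamma> \<mu> (\<lambda>p. f1 p * K p + f2 p * K p)"
        by (simp add: f(1) algebra_simps)
      also have "\<dots> = cmean \<beta> \<gamma> \<mu> (\<lambda>p. f1 p * K p) + cmean \<beta> \<gamma> \<mu> (\<lambda>p. f2 p * K p)"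
        using f(2) unfolding expandable_def[OF b g m]
        by (intro cmean_add[OF g m alpha_gt[OF b g m]] continuous_intros poly_deg_le_continuous[OF Kp] c2) auto
      also have "cmean \<beta> \<gamma> \<mu> (\<lambda>p. f1 p * K p) = 0" by (rule z[OF f(2) k])
      also have "cmean \<beta> \<gamma> \<mu> (\<lambda>p. f2 p * K p) = 0"
      proof (cases "k = 0")
        case True
        then show ?thesis using f(3) by (simp add: cmean_def wint_def)
      next
        case False
        then show ?thesis using z[OF f(4)] k by simp
      qed
      finally show ?thesis by simp
    qed
    finally show ?thesis by simp
  qed
  show "(\<lambda>p. zonal_kernel \<beta> \<gamma> \<mu> n p q) \<in> orth_poly_even (cone_weight \<beta> \<gamma> \<mu>) n"
    unfolding orth_poly_even_def orth_poly_def K_def[symmetric, abs_def]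
    using Kp Ke orth by (auto simp: cone_inner_conv_cmean)
next
  fix q :: "(real ^ 'd) \<times> real" and f :: "(real ^ 'd) \<times> real \<Rightarrow> real"
  assume fV: "f \<in> orth_poly_even (cone_weight \<beta> \<gamma> \<mu>) n"
  then have f: "f \<in> poly_deg_le n" "\<And>x t. f (x, - t) = f (x, t)"
    and o: "\<And>k h. k < n \<Longrightarrow> h \<in> poly_deg_le k \<Longrightarrow> cmean \<beta> \<gamma> \<mu> (\<lambda>p. f p * h p) = 0"
    unfolding orth_poly_even_def orth_poly_def cone_inner_conv_cmean by auto
  obtain f1 f2 where d: "f = (\<lambda>p. f1 p + f2 p)" "expandable \<beta> \<gamma> \<mu> n f1" "n = 0 \<Longrightarrow> f2 = (\<lambda>_. 0)"
          "n > 0 \<Longrightarrow> expandable \<beta> \<gamma> \<mu> (n - 1) f2"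
    using even_poly_decompose[OF b g m f] by blast
  obtain F1 where F1: "has_expansion \<beta> \<gamma> \<mu> n f1 F1" "continuous_on UNIV f1"
    using d(2) unfolding expandable_def[OF b g m] by blast
  \<comment> \<open>The part of the wrong parity is removed by testing with
    \<open>exp_kernel\<close> in degrees below n. In degrees of the parity of n - 1 the part f1 has
    mean 0, so f2 inherits orthogonality from f; in the others f2 has mean 0 by parity. All its
    coefficients then vanish, in particular the zeroth.\<close>
  have f2: "f2 = (\<lambda>_. 0)"
  proof (cases "n = 0")
    case False
    then obtain F2 where F2: "has_expansion \<beta> \<gamma> \<mu> (n - 1) f2 F2" "continuous_on UNIV f2"
      using d(4) unfolding expandable_def[OF b g m] by blast
    have "F2 0 q = 0" for q
    proof (rule has_expansion_vanish[OF b g m F2(1), of 0])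
      fix k and q :: "(real ^ 'd) \<times> real" assume "k + 2 * 0 \<le> n - 1"
      then have k: "k < n" using False by simp
      show "exp_mean \<beta> \<gamma> \<mu> k f2 q = 0"
      proof (cases "odd (k + (n - 1))")
        case True
        then show ?thesis by (rule has_expansionD(2)[OF F2(1)])
      next
        case ev: False
        then have "odd (k + n)" using False by simp
        then have "exp_mean \<beta> \<gamma> \<mu> k f1 q = 0"
          by (rule has_expansionD(2)[OF F1(1)])
        moreover have "exp_mean \<beta> \<gamma> \<mu> k f q =
            exp_mean \<beta> \<gamma> \<mu> k f1 q + exp_mean \<beta> \<gamma> \<mu> k f2 q"
          unfolding d(1) distrib_right by (intro cmean_add[OF g m alpha_gt[OF b g m]] continuous_intros F1(2) F2(2))
        moreover have "exp_mean \<beta> \<gamma> \<mu> k f q = 0"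
          by (rule o[OF k poly_deg_le_exp_kernel[OF order_refl]])
        ultimately show ?thesis by simp
      qed
    qed auto
    then show ?thesis using has_expansionD(1)[OF F2(1)] by auto
  qed (rule d(3))
  have f1: "f1 = f" using d(1) f2 by simp
  have "cmean \<beta> \<gamma> \<mu> (\<lambda>p. f1 p * zonal_kernel \<beta> \<gamma> \<mu> n p q) = f1 q"
  proof (rule cmean_zonal_kernel(2)[OF F1 lam order_refl refl])
    \<comment> \<open>For a \<ge> 1 the test degrees are at most n - 2, where f is orthogonal to
      \<open>exp_kernel\<close>.\<close>
    fix a assume "1 \<le> a" "a \<le> n div 2"
    then show "F1 a q = 0"
    proof (intro has_expansion_vanish[OF b g m F1(1), of 1])
      fix k and q :: "(real ^ 'd) \<times> real" assume "k + 2 * 1 \<le> n"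
      then have "k < n" by simp
      then show "exp_mean \<beta> \<gamma> \<mu> k f1 q = 0"
        unfolding f1 by (rule o[OF _ poly_deg_le_exp_kernel[OF order_refl]])
    qed
  qed
  then show "cone_inner (cone_weight \<beta> \<gamma> \<mu>) f (\<lambda>p. zonal_kernel \<beta> \<gamma> \<mu> n p q) = f q"
    by (simp add: cone_inner_conv_cmean f1)
qed

lemma kernel_even_eq_zonal_kernel:
  assumes "alpha CARD('d) \<beta> \<mu> + \<gamma> > 0"
  shows "kernel_even n (cone_weight \<beta> \<gamma> \<mu>) = (zonal_kernel \<beta> \<gamma> \<mu> n :: (real ^ 'd) \<times> real \<Rightarrow> _)"
  unfolding kernel_even_def
  by (rule reproducing_kernel_unique[OF _ zonal_kernel_reproducing[OF assms]])
    (simp add: cone_inner_def mult_ac)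

end

section \<open>The odd kernel\<close>

lemma alpha_add_one: "alpha d (\<beta> + 1) \<mu> = alpha d \<beta> \<mu> + 1"
  by (simp add: alpha_def)

lemma cone_weight_add_one: "cone_weight (\<beta> + 1) \<gamma> \<mu> p = (snd p)\<^sup>2 * cone_weight \<beta> \<gamma> \<mu> p"
proof -
  have "\<bar>t\<bar>\<^sup>2 * \<bar>t\<bar> powr (2 * \<beta>) = \<bar>t\<bar> powr (2 * (\<beta> + 1))" for t :: real
    using power_mult_powr[of "\<bar>t\<bar>" 2 "2 * \<beta>"] by simp
  then have "\<bar>t\<bar> powr (2 * (\<beta> + 1)) = t\<^sup>2 * \<bar>t\<bar> powr (2 * \<beta>)" for t :: real
    by (metis power2_abs)
  then show ?thesis by (simp add: cone_weight_def case_prod_unfold)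
qed

context
  fixes \<beta> \<gamma> \<mu> :: real
  assumes g: "\<gamma> > - 1/2" and m: "\<mu> > - 1/2"
begin

text \<open>The constant is the mean of t^2, the ratio of the total masses for \<beta> + 1 and
  \<beta>. Its reciprocal is the constant in front of the odd kernel.\<close>

lemma cmean_mult_snd2:
  fixes f :: "(real ^ 'd) \<times> real \<Rightarrow> real"
  assumes a: "alpha CARD('d) \<beta> \<mu> > - 1/2"
  shows "cmean \<beta> \<gamma> \<mu> (\<lambda>p. (snd p)\<^sup>2 * f p) =
    (alpha CARD('d) \<beta> \<mu> + 1/2) / (alpha CARD('d) \<beta> \<mu> + \<gamma> + 1) * cmean (\<beta> + 1) \<gamma> \<mu> f"
proof -
  have w: "wint \<beta> \<gamma> \<mu> (\<lambda>p. (snd p)\<^sup>2 * f p) = wint (\<beta> + 1) \<gamma> \<mu> f" for f :: "(real ^ 'd) \<times> real \<Rightarrow> real"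
    by (simp add: wint_def cone_weight_add_one mult_ac)
  have a1: "alpha CARD('d) (\<beta> + 1) \<mu> > - 1/2" using a by (simp add: alpha_add_one)
  have pos: "wint (\<beta> + 1) \<gamma> \<mu> (\<lambda>_ :: (real ^ 'd) \<times> real. 1) > 0" by (rule wint_one(2)[OF g m a1])
  have "wint (\<beta> + 1) \<gamma> \<mu> (\<lambda>_ :: (real ^ 'd) \<times> real. 1) / wint \<beta> \<gamma> \<mu> (\<lambda>_ :: (real ^ 'd) \<times> real. 1) =
      cmean \<beta> \<gamma> \<mu> (mono_fun (vmonom (\<lambda>_::'d. 0)) 0 1 0)"
    unfolding w[symmetric] by (simp add: cmean_def mono_fun_def[abs_def] vmonom_def)
  also have "\<dots> = cone_moment CARD('d) \<beta> \<gamma> \<mu> (0 div 2) 0 1 0 * gauss_mean (vmonom (\<lambda>_::'d. 0))"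
    by (rule cmean_mono_fun(1)[OF _ _ gauss_mean_vmonom(1) g m a])
      (auto simp: vmonom_def intro!: borel_measurable_continuous_onI continuous_intros)
  also have "\<dots> = (alpha CARD('d) \<beta> \<mu> + 1/2) / (alpha CARD('d) \<beta> \<mu> + \<gamma> + 1)"
    using normal_moment_even[of 0] by (simp add: cone_moment_def gauss_mean_vmonom)
  finally have r: "wint (\<beta> + 1) \<gamma> \<mu> (\<lambda>_ :: (real ^ 'd) \<times> real. 1) / wint \<beta> \<gamma> \<mu> (\<lambda>_ :: (real ^ 'd) \<times> real. 1) =
      (alpha CARD('d) \<beta> \<mu> + 1/2) / (alpha CARD('d) \<beta> \<mu> + \<gamma> + 1)" .
  show ?thesis unfolding r[symmetric] using pos by (simp add: cmean_def w)
qed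

text \<open>Multiplication by t carries the even space for \<beta> + 1 and n - 1 to the odd space
  for \<beta> and n and preserves inner products up to the mean of t^2.\<close>

lemma kernel_odd_eq:
  assumes b: "\<beta> > - 1/2" and a: "alpha CARD('d) \<beta> \<mu> > - 1/2" and n: "n \<ge> 1"
  shows "kernel_odd n (cone_weight \<beta> \<gamma> \<mu>) p q =
    (alpha CARD('d) \<beta> \<mu> + \<gamma> + 1) / (alpha CARD('d) \<beta> \<mu> + 1/2) * snd q * snd p *
      kernel_even (n - 1) (cone_weight (\<beta> + 1) \<gamma> \<mu>) p (q :: (real ^ 'd) \<times> real)"
proof -
  let ?W = "cone_weight \<beta> \<gamma> \<mu> :: (real ^ 'd) \<times> real \<Rightarrow> real"
  let ?W1 = "cone_weight (\<beta> + 1) \<gamma> \<mu> :: (real ^ 'd) \<times> real \<Rightarrow> real"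
  define r where "r = (alpha CARD('d) \<beta> \<mu> + 1/2) / (alpha CARD('d) \<beta> \<mu> + \<gamma> + 1)"
  have r: "r > 0" using a g by (simp add: r_def)
  have cr: "(alpha CARD('d) \<beta> \<mu> + \<gamma> + 1) / (alpha CARD('d) \<beta> \<mu> + 1/2) = 1 / r" by (simp add: r_def)
  have lam: "alpha CARD('d) (\<beta> + 1) \<mu> + \<gamma> > 0" using a g by (simp add: alpha_add_one)
  \<comment> \<open>This is why the zonal kernel, studied for parameters at least 1/2, covers every
    \<beta> > -1/2 here.\<close>
  have b1: "\<beta> + 1 \<ge> 1/2" using b by simp
  define K where "K = (zonal_kernel (\<beta> + 1) \<gamma> \<mu> (n - 1) :: (real ^ 'd) \<times> real \<Rightarrow> _)"
  have Keq: "kernel_even (n - 1) ?W1 = K"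
    unfolding K_def by (rule kernel_even_eq_zonal_kernel[OF b1 g m lam])
  have "is_reproducing_kernel (cone_inner ?W1) (orth_poly_even ?W1 (n - 1)) K"
    unfolding K_def by (rule zonal_kernel_reproducing[OF b1 g m lam])
  then have KV: "(\<lambda>p. K p q) \<in> orth_poly_even ?W1 (n - 1)"
    and Kr: "f \<in> orth_poly_even ?W1 (n - 1) \<Longrightarrow> cmean (\<beta> + 1) \<gamma> \<mu> (\<lambda>p. f p * K p q) = f q" for f q
    unfolding is_reproducing_kernel_def cone_inner_conv_cmean by blast+
  have Kp: "(\<lambda>p. K p q) \<in> poly_deg_le (n - 1)" and Ke: "K (x, - t) q = K (x, t) q"
    and Ko: "k < n - 1 \<Longrightarrow> h \<in> poly_deg_le k \<Longrightarrow> cmean (\<beta> + 1) \<gamma> \<mu> (\<lambda>p. K p q * h p) = 0" for x t q k h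
    using KV[of q] unfolding orth_poly_even_def orth_poly_def cone_inner_conv_cmean by auto
  have snd1: "(\<lambda>p :: (real ^ 'd) \<times> real. snd p) \<in> poly_deg_le 1"
    using poly_deg_le_monom[of "\<lambda>_. 0" 1 1 1] by (simp add: full_monom_def vmonom_def)
  have times_snd: "(\<lambda>p. snd p * h p) \<in> poly_deg_le (Suc k)" if "h \<in> poly_deg_le k" for h :: "(real ^ 'd) \<times> real \<Rightarrow> real" and k
    by (rule poly_deg_le_mult[OF snd1 that]) simp
  have half: "cmean \<beta> \<gamma> \<mu> (\<lambda>p. snd p * f p * (snd p * h p)) = r * cmean (\<beta> + 1) \<gamma> \<mu> (\<lambda>p. f p * h p)"
    for f h :: "(real ^ 'd) \<times> real \<Rightarrow> real"
    using cmean_mult_snd2[OF a, of "\<lambda>p. f p * h p"] unfolding r_def by (simp add: power2_eq_square mult_ac)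
  define L where "L p q = 1 / r * snd q * snd p * K p q" for p q
  have "is_reproducing_kernel (cone_inner ?W) (orth_poly_odd ?W n) L"
    unfolding is_reproducing_kernel_def cone_inner_conv_cmean
  proof (intro conjI allI ballI)
    fix q :: "(real ^ 'd) \<times> real"
    have Lp: "(\<lambda>p. L p q) \<in> poly_deg_le n"
      using poly_deg_le_cmult[OF times_snd[OF Kp[of q]], of "1 / r * snd q"] n by (simp add: L_def[abs_def] mult.assoc)
    have "cmean \<beta> \<gamma> \<mu> (\<lambda>p. L p q * h p) = 0" if k: "k < n" and h: "h \<in> poly_deg_le k" for k h
    proof -
      obtain h1 h2 where h12: "h = (\<lambda>p. h1 p + h2 p)" and h1: "h1 \<in> poly_deg_le k" and h2: "h2 \<in> poly_deg_le k"
        and h1e: "\<And>x t. h1 (x, - t) = h1 (x, t)" and h2o: "\<And>x t. h2 (x, - t) = - h2 (x, t)"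
        using poly_deg_le_parity_split[OF h] by blast
      have "cmean \<beta> \<gamma> \<mu> (\<lambda>p. L p q * h p) = cmean \<beta> \<gamma> \<mu> (\<lambda>p. L p q * h1 p + L p q * h2 p)"
        unfolding h12 distrib_left ..
      also have "\<dots> = cmean \<beta> \<gamma> \<mu> (\<lambda>p. L p q * h1 p) + cmean \<beta> \<gamma> \<mu> (\<lambda>p. L p q * h2 p)"
        by (intro cmean_add[OF g m a] continuous_intros poly_deg_le_continuous[OF Lp]
            poly_deg_le_continuous[OF h1] poly_deg_le_continuous[OF h2])
      also have "cmean \<beta> \<gamma> \<mu> (\<lambda>p. L p q * h1 p) = 0"
        by (rule cmean_odd) (simp add: L_def Ke h1e)
      also have "cmean \<beta> \<gamma> \<mu> (\<lambda>p. L p q * h2 p) = 0"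
      proof (cases "k = 0")
        case True
        then have "h2 = (\<lambda>_. 0)" using odd_poly_factor(1)[OF h2 h2o] by simp
        then show ?thesis by (simp add: cmean_def wint_def)
      next
        case False
        then obtain h3 where h3: "h3 \<in> poly_deg_le (k - 1)" "h2 = (\<lambda>p. snd p * h3 p)"
          using odd_poly_factor(2)[OF h2 h2o] by blast
        have "cmean \<beta> \<gamma> \<mu> (\<lambda>p. L p q * h2 p) = 1 / r * snd q * cmean \<beta> \<gamma> \<mu> (\<lambda>p. snd p * K p q * (snd p * h3 p))"
          unfolding cmean_cmult[OF g m, symmetric] h3(2) L_def by (simp only: mult_ac)
        also have "\<dots> = 0" unfolding half using Ko[OF _ h3(1), of q] k False by simp
        finally show ?thesis .
      qed
      finally show ?thesis by simp
    qed
    then show "(\<lambda>p. L p q) \<in> orth_poly_odd ?W n"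
      unfolding orth_poly_odd_def orth_poly_def cone_inner_conv_cmean using Lp by (auto simp: L_def Ke)
  next
    fix q :: "(real ^ 'd) \<times> real" and f :: "(real ^ 'd) \<times> real \<Rightarrow> real"
    assume "f \<in> orth_poly_odd ?W n"
    then have f: "f \<in> poly_deg_le n" "\<And>x t. f (x, - t) = - f (x, t)"
      and o: "\<And>k h. k < n \<Longrightarrow> h \<in> poly_deg_le k \<Longrightarrow> cmean \<beta> \<gamma> \<mu> (\<lambda>p. f p * h p) = 0"
      unfolding orth_poly_odd_def orth_poly_def cone_inner_conv_cmean by auto
    obtain f3 where f3: "f3 \<in> poly_deg_le (n - 1)" "\<And>x t. f3 (x, - t) = f3 (x, t)" "f = (\<lambda>p. snd p * f3 p)"
      using odd_poly_factor(2)[OF f] n by auto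
    have "cmean (\<beta> + 1) \<gamma> \<mu> (\<lambda>p. f3 p * h p) = 0" if "k < n - 1" "h \<in> poly_deg_le k" for k h
    proof -
      have "cmean \<beta> \<gamma> \<mu> (\<lambda>p. f p * (snd p * h p)) = 0"
        by (rule o[OF _ times_snd[OF that(2)]]) (use that(1) in simp)
      then show ?thesis using half[of f3 h] r by (simp add: f3(3))
    qed
    then have "f3 \<in> orth_poly_even ?W1 (n - 1)"
      unfolding orth_poly_even_def orth_poly_def cone_inner_conv_cmean using f3 by auto
    then have "cmean (\<beta> + 1) \<gamma> \<mu> (\<lambda>p. f3 p * K p q) = f3 q" by (rule Kr)
    moreover have "cmean \<beta> \<gamma> \<mu> (\<lambda>p. f p * L p q) = 1 / r * snd q * cmean \<beta> \<gamma> \<mu> (\<lambda>p. snd p * f3 p * (snd p * K p q))"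
      unfolding cmean_cmult[OF g m, symmetric] f3(3) L_def by (simp only: mult_ac)
    ultimately show "cmean \<beta> \<gamma> \<mu> (\<lambda>p. f p * L p q) = f q"
      unfolding half using r by (simp add: f3(3))
  qed
  then have "kernel_odd n ?W = L"
    unfolding kernel_odd_def by (intro reproducing_kernel_unique) (simp_all add: cone_inner_def mult_ac)
  then show ?thesis unfolding Keq cr by (simp add: L_def)
qed

end

section \<open>The integral representation\<close>

lemma has_bochner_integral_lborel_product:
  fixes f :: "'a::euclidean_space \<Rightarrow> real" and h :: "'b::euclidean_space \<Rightarrow> real"
  assumes "has_bochner_integral lborel f I" "has_bochner_integral lborel h J"
  shows "has_bochner_integral lborel (\<lambda>p. f (fst p) * h (snd p)) (I * J)"
proof -
  have f: "integrable lborel f" "(LINT x|lborel. f x) = I" and h: "integrable lborel h" "(LINT x|lborel. h x) = J"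
    using assms by (simp_all add: has_bochner_integral_iff)
  have [measurable]: "f \<in> borel_measurable borel" "h \<in> borel_measurable borel"
    using borel_measurable_integrable[OF f(1)] borel_measurable_integrable[OF h(1)] by simp_all
  have int: "integrable (lborel \<Otimes>\<^sub>M lborel) (\<lambda>p. f (fst p) * h (snd p))"
  proof (rule lborel_pair.Fubini_integrable)
    show "(\<lambda>p. f (fst p) * h (snd p)) \<in> borel_measurable (lborel \<Otimes>\<^sub>M lborel)" by measurable
    show "integrable lborel (\<lambda>x. LINT y|lborel. norm (f (fst (x, y)) * h (snd (x, y))))"
      using f(1) by (simp add: abs_mult integrable_mult_left)
    show "AE x in lborel. integrable lborel (\<lambda>y. f (fst (x, y)) * h (snd (x, y)))"
      using h(1) by simp
  qed
  have "(LINT p|(lborel \<Otimes>\<^sub>M lborel). f (fst p) * h (snd p)) = (LINT x|lborel. LINT y|lborel. f x * h y)"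
    using lborel_pair.integral_fst[of "\<lambda>x y. f x * h y"] int by (simp add: case_prod_unfold)
  also have "\<dots> = I * J" by (simp add: f h)
  finally show ?thesis using int by (simp add: has_bochner_integral_iff lborel_prod)
qed

definition sym_weight :: "real \<Rightarrow> real \<Rightarrow> real" where
  "sym_weight e u = indicator {-1..1} u * (1 - u\<^sup>2) powr e"

text \<open>The k-th moment of \<open>sym_weight (\<nu> - 1)\<close> divided by its total mass,
  which is the reciprocal of \<open>c_geg (\<nu> - 1/2)\<close>.\<close>

definition sym_moment :: "real \<Rightarrow> nat \<Rightarrow> real" where
  "sym_moment \<nu> k = (if even k then pochhammer (1/2) (k div 2) / pochhammer (\<nu> + 1/2) (k div 2) else 0)"

lemma sym_weight_borel [measurable]: "sym_weight e \<in> borel_measurable borel"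
  unfolding sym_weight_def[abs_def] by simp

lemma c_geg_pos: "\<nu> > 0 \<Longrightarrow> c_geg (\<nu> - 1/2) > 0"
  by (simp add: c_geg_def Gamma_real_pos)

text \<open>Even moments are instances of \<open>ball_integral_abs_powr\<close>; odd ones vanish by
  reflection.\<close>

lemma has_bochner_integral_sym_weight:
  assumes \<nu>: "\<nu> > 0"
  shows "has_bochner_integral lborel (\<lambda>u. u ^ k * sym_weight (\<nu> - 1) u) (sym_moment \<nu> k / c_geg (\<nu> - 1/2))"
proof -
  have even: "has_bochner_integral lborel (\<lambda>u. u ^ (2 * h) * sym_weight (\<nu> - 1) u) (sym_moment \<nu> (2 * h) / c_geg (\<nu> - 1/2))" for h
  proof -
    have "(\<integral>\<^sup>+u. ennreal (u ^ (2 * h) * sym_weight (\<nu> - 1) u) \<partial>lborel) =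
        ball_integral (\<lambda>t::real. \<bar>t\<bar> powr (2 * real h)) (\<nu> - 1)"
      unfolding ball_integral_def
    proof (intro nn_integral_cong_AE)
      have "AE u in lborel. u \<noteq> (0::real)" by (rule AE_lborel_singleton)
      then show "AE u in lborel. ennreal (u ^ (2 * h) * sym_weight (\<nu> - 1) u) =
          ennreal (indicator (cball 0 1) u * (\<bar>u\<bar> powr (2 * real h) * (1 - (norm u)\<^sup>2) powr (\<nu> - 1)))"
      proof eventually_elim
        case (elim u)
        have "\<bar>u\<bar> powr (2 * real h) = \<bar>u\<bar> powr real (2 * h)" by simp
        also have "\<dots> = \<bar>u\<bar> ^ (2 * h)" using elim by (intro powr_realpow) simp
        also have "\<dots> = u ^ (2 * h)" by (simp add: power_even_abs)
        finally have p: "\<bar>u\<bar> powr (2 * real h) = u ^ (2 * h)" .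
        have "indicator (cball 0 1) u = (indicator {-1..1} u :: real)"
          by (auto simp: indicator_def)
        then show ?case unfolding p sym_weight_def by (simp add: mult_ac)
      qed
    qed
    also have "\<dots> = ennreal (Gamma \<nu> * Gamma (real h + 1/2) / Gamma (real h + 1/2 + \<nu>))"
    proof -
      have e: "\<nu> - 1 + 1 = \<nu>" "real h + 1/2 + (\<nu> - 1) + 1 = real h + 1/2 + \<nu>" "(2 * real h + 1) / 2 = real h + 1/2"
        by (simp_all add: field_simps)
      have "2 * real h > - 1" "\<nu> - 1 > - 1" using \<nu> by simp_all
      from ball_integral_abs_powr[OF this] show ?thesis unfolding e(3) unfolding e .
    qed
    also have "Gamma \<nu> * Gamma (real h + 1/2) / Gamma (real h + 1/2 + \<nu>) = sym_moment \<nu> (2 * h) / c_geg (\<nu> - 1/2)"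
    proof -
      have 1: "Gamma (real h + 1/2) = pochhammer (1/2) h * Gamma (1/2)"
        using Gamma_add_nat[of "1/2" h] by (simp add: add.commute)
      have 2: "Gamma (real h + 1/2 + \<nu>) = pochhammer (\<nu> + 1/2) h * Gamma (\<nu> + 1/2)"
      proof -
        have "real h + 1/2 + \<nu> = \<nu> + 1/2 + real h" by simp
        then show ?thesis using Gamma_add_nat[of "\<nu> + 1/2" h] \<nu> by (simp only:)
      qed
      have 3: "\<nu> - 1/2 + 1 = \<nu> + 1/2" "\<nu> - 1/2 + 1/2 = \<nu>" by simp_all
      show ?thesis unfolding 1 2 sym_moment_def c_geg_def 3 by (simp add: mult_ac)
    qed
    finally have nn: "(\<integral>\<^sup>+u. ennreal (u ^ (2 * h) * sym_weight (\<nu> - 1) u) \<partial>lborel) =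
        ennreal (sym_moment \<nu> (2 * h) / c_geg (\<nu> - 1/2))" .
    have "sym_moment \<nu> (2 * h) \<ge> 0"
      unfolding sym_moment_def using \<nu> by (simp add: pochhammer_nonneg)
    then show ?thesis using nn c_geg_pos[OF \<nu>]
      by (intro has_bochner_integral_nn_integral) (simp_all add: sym_weight_def)
  qed
  show ?thesis
  proof (cases "even k")
    case True
    then show ?thesis using even[of "k div 2"] by simp
  next
    case False
    have i0: "integrable lborel (sym_weight (\<nu> - 1))"
      using even[of 0] by (simp add: has_bochner_integral_iff)
    have i: "integrable lborel (\<lambda>u. u ^ k * sym_weight (\<nu> - 1) u)"
    proof (rule Bochner_Integration.integrable_bound[OF i0])
      show "AE u in lborel. norm (u ^ k * sym_weight (\<nu> - 1) u) \<le> norm (sym_weight (\<nu> - 1) u)"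
      proof (rule AE_I2)
        fix u :: real
        show "norm (u ^ k * sym_weight (\<nu> - 1) u) \<le> norm (sym_weight (\<nu> - 1) u)"
        proof (cases "u \<in> {-1..1}")
          case True
          then have "\<bar>u\<bar> ^ k \<le> 1" by (intro power_le_one) auto
          then have "\<bar>u\<bar> ^ k * norm (sym_weight (\<nu> - 1) u) \<le> 1 * norm (sym_weight (\<nu> - 1) u)"
            by (intro mult_right_mono) auto
          then show ?thesis by (simp add: abs_mult power_abs)
        qed (simp add: sym_weight_def)
      qed
    qed simp
    have "(LINT u|lborel. u ^ k * sym_weight (\<nu> - 1) u) = (LINT u|lborel. (0 + (-1) * u) ^ k * sym_weight (\<nu> - 1) (0 + (-1) * u))"
      using lborel_integral_real_affine[of "-1" "\<lambda>u. u ^ k * sym_weight (\<nu> - 1) u" 0] by simp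
    also have "\<dots> = - (LINT u|lborel. u ^ k * sym_weight (\<nu> - 1) u)"
    proof -
      have "sym_weight (\<nu> - 1) (- u) = sym_weight (\<nu> - 1) u" for u by (auto simp: sym_weight_def indicator_def)
      then show ?thesis using False by simp
    qed
    finally have "(LINT u|lborel. u ^ k * sym_weight (\<nu> - 1) u) = 0" by simp
    then show ?thesis using i False by (simp add: has_bochner_integral_iff sym_moment_def)
  qed
qed

definition jac_weight :: "real \<Rightarrow> real \<Rightarrow> real \<Rightarrow> real" where
  "jac_weight a b z = indicator {-1..1} z * ((1 - z) powr a * (1 + z) powr b)"

text \<open>z = 2 t - 1 leads to a Beta integral. The power of 2 stems from this substitution;
  \<open>c_jac\<close> does not contain it, and it becomes the factor 2^(\<alpha> - 1/2) of the cube
  integral.\<close>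

lemma has_bochner_integral_jac_weight:
  assumes a: "a > - 1" and b: "b > - 1"
  shows "has_bochner_integral lborel (\<lambda>z. ((1 - z) / 2) ^ i * ((1 + z) / 2) ^ j * jac_weight a b z)
    (2 powr (a + b + 1) * (pochhammer (a + 1) i * pochhammer (b + 1) j / pochhammer (a + b + 2) (i + j)) / c_jac a b)"
proof -
  define B where "B = Beta (b + 1 + real j) (a + 1 + real i)"
  have Bpos: "B > 0" unfolding B_def Beta_def using a b by simp
  have "((\<lambda>t. t powr (b + 1 + real j - 1) * (1 - t) powr (a + 1 + real i - 1)) has_integral B) {0..1}"
    unfolding B_def by (rule has_integral_Beta_real) (use a b in auto)
  from nn_integral_has_integral_lebesgue[OF _ this] have
    "(\<integral>\<^sup>+t. ennreal (indicator {0..1} t * (t powr (b + 1 + real j - 1) * (1 - t) powr (a + 1 + real i - 1))) \<partial>lborel) = ennreal B"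
    by simp
  then have beta: "has_bochner_integral lborel (\<lambda>t. indicator {0..1} t * (t powr (b + 1 + real j - 1) * (1 - t) powr (a + 1 + real i - 1))) B"
    using Bpos by (intro has_bochner_integral_nn_integral) simp_all
  have eq: "((1 - (2 * t - 1)) / 2) ^ i * ((1 + (2 * t - 1)) / 2) ^ j * jac_weight a b (2 * t - 1) =
     2 powr (a + b) * (indicator {0..1} t * (t powr (b + 1 + real j - 1) * (1 - t) powr (a + 1 + real i - 1)))" for t
  proof (cases "t \<in> {0..1}")
    case True
    have e: "(1 - t) powr (a + 1 + real i - 1) = (1 - t) ^ i * (1 - t) powr a" "t powr (b + 1 + real j - 1) = t ^ j * t powr b"
      using power_mult_powr[of "1 - t" i a] power_mult_powr[of t j b] True by simp_all
    have "(1 - (2 * t - 1)) powr a = 2 powr a * (1 - t) powr a" "(1 + (2 * t - 1)) powr b = 2 powr b * t powr b"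
      using powr_mult[of 2 "1 - t" a] powr_mult[of 2 t b] True by (simp_all add: algebra_simps)
    moreover have "(1 - (2 * t - 1)) / 2 = 1 - t" "(1 + (2 * t - 1)) / 2 = t" by simp_all
    moreover have "indicator {-1..1} (2 * t - 1) = (1::real)" "indicator {0..1} t = (1::real)" using True by auto
    ultimately show ?thesis unfolding jac_weight_def e by (simp only: powr_add mult_ac mult_1)
  next
    case False
    then have "2 * t - 1 \<notin> {-1..1}" by auto
    then show ?thesis using False by (simp add: jac_weight_def)
  qed
  have "has_bochner_integral lborel (\<lambda>t. 2 powr (a + b) * (indicator {0..1} t * (t powr (b + 1 + real j - 1) * (1 - t) powr (a + 1 + real i - 1))))
      (2 powr (a + b) * B)"
    by (rule has_bochner_integral_mult_right) (rule beta)
  then have "has_bochner_integral lborel (\<lambda>t. ((1 - (2 * t - 1)) / 2) ^ i * ((1 + (2 * t - 1)) / 2) ^ j * jac_weight a b (2 * t - 1)) (2 powr (a + b) * B)"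
    unfolding eq .
  then have "has_bochner_integral lborel (\<lambda>t. ((1 - ((-1) + 2 * t)) / 2) ^ i * ((1 + ((-1) + 2 * t)) / 2) ^ j * jac_weight a b ((-1) + 2 * t)) (2 powr (a + b) * B)"
    by (simp add: algebra_simps)
  then have "has_bochner_integral lborel (\<lambda>z. ((1 - z) / 2) ^ i * ((1 + z) / 2) ^ j * jac_weight a b z) (2 * (2 powr (a + b) * B))"
    using lborel_has_bochner_integral_real_affine_iff[of 2 "\<lambda>z. ((1 - z) / 2) ^ i * ((1 + z) / 2) ^ j * jac_weight a b z" "2 * (2 powr (a + b) * B)" "-1"]
    by simp
  moreover have "2 * (2 powr (a + b) * B) =
      2 powr (a + b + 1) * (pochhammer (a + 1) i * pochhammer (b + 1) j / pochhammer (a + b + 2) (i + j)) / c_jac a b"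
  proof -
    have "b + 1 + real j + (a + 1 + real i) = a + b + 2 + real (i + j)" by simp
    then have "B = Gamma (b + 1 + real j) * Gamma (a + 1 + real i) / Gamma (a + b + 2 + real (i + j))"
      unfolding B_def Beta_def by (simp only:)
    also have "\<dots> = pochhammer (b + 1) j * Gamma (b + 1) * (pochhammer (a + 1) i * Gamma (a + 1)) /
        (pochhammer (a + b + 2) (i + j) * Gamma (a + b + 2))"
      using a b by (simp only: Gamma_add_nat[of "b + 1"] Gamma_add_nat[of "a + 1"] Gamma_add_nat[of "a + b + 2"])
    finally show ?thesis by (simp add: c_jac_def powr_add mult_ac)
  qed
  ultimately show ?thesis by simp
qed

lemma sum_even_terms:
  fixes f :: "nat \<Rightarrow> real"
  assumes "\<And>l. odd l \<Longrightarrow> f l = 0"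
  shows "(\<Sum>l\<le>n. f l) = (\<Sum>l\<le>n div 2. f (2 * l))"
proof -
  have "(\<Sum>l\<le>n div 2. f (2 * l)) = (\<Sum>l\<in>(\<lambda>l. 2 * l) ` {..n div 2}. f l)"
    by (subst sum.reindex) (auto simp: inj_on_def)
  also have "\<dots> = (\<Sum>l\<le>n. f l)"
    by (rule sum.mono_neutral_left) (auto intro!: assms elim!: evenE)
  finally show ?thesis ..
qed

lemma pochhammer_half_fact: "pochhammer (1/2) k / fact (2 * k) = (1 / (4 ^ k * fact k) :: real)"
proof -
  have "fact (2 * k) = 4 ^ k * (pochhammer (1/2) k * fact k :: real)"
    using fact_double[of k, where 'a = real] by (simp add: power_mult)
  moreover have "pochhammer (1/2 :: real) k > 0" by (simp add: pochhammer_pos)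
  ultimately show ?thesis by (simp add: field_simps)
qed

text \<open>By (2k)! = 4^k (1/2)_k k! the numerator of the moment cancels; this is the origin of the
  quarters in \<open>exp_ball\<close> and \<open>exp_full\<close>.\<close>

lemma sym_moment_term:
  "sym_moment \<nu> (2 * k) * (c ^ (2 * k) / fact (2 * k)) = (c\<^sup>2 / 4) ^ k / (fact k * pochhammer (\<nu> + 1/2) k)"
proof -
  have "sym_moment \<nu> (2 * k) * (c ^ (2 * k) / fact (2 * k)) =
     (pochhammer (1/2) k / fact (2 * k)) * c ^ (2 * k) / pochhammer (\<nu> + 1/2) k"
    by (simp add: sym_moment_def)
  also have "\<dots> = (c\<^sup>2 / 4) ^ k / (fact k * pochhammer (\<nu> + 1/2) k)"
    unfolding pochhammer_half_fact by (simp add: power_mult power_divide)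
  finally show ?thesis .
qed

lemma sym_moment_odd: "odd k \<Longrightarrow> sym_moment \<nu> k = 0"
  by (simp add: sym_moment_def)

lemma exp_ball_conv_moments:
  "(\<Sum>h\<le>i. sym_moment \<mu> h * (P ^ (i - h) / fact (i - h) * (Q ^ h / fact h))) = exp_ball \<mu> i P (Q\<^sup>2)"
proof -
  have "(\<Sum>h\<le>i. sym_moment \<mu> h * (P ^ (i - h) / fact (i - h) * (Q ^ h / fact h))) =
     (\<Sum>h\<le>i div 2. P ^ (i - 2 * h) / fact (i - 2 * h) * (sym_moment \<mu> (2 * h) * (Q ^ (2 * h) / fact (2 * h))))"
    by (subst sum_even_terms) (simp_all add: sym_moment_odd mult_ac)
  then show ?thesis unfolding exp_ball_def sym_moment_term .
qed

text \<open>The moment in z1 contributes a rising factorial of \<beta> - 1/2; the one in z2 removes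
  odd j and divides by a rising factorial of \<beta> + 1/2. Together they form \<open>hagen\<close>,
  which is how the Rothe--Hagen coefficients arise.\<close>

lemma exp_cone_conv_moments:
  assumes "\<beta> \<ge> 1/2"
  shows "(\<Sum>j\<le>k. sym_moment \<beta> j * (S ^ j / fact j) *
      (pochhammer (\<mu> + (real d + 1) / 2) (k - j) * pochhammer (\<beta> - 1/2) j / pochhammer (alpha d \<beta> \<mu> + 1/2) k) *
      exp_ball \<mu> (k - j) P W) = exp_cone d \<beta> \<mu> k P W (S\<^sup>2)"
proof -
  have hag: "(S\<^sup>2 / 4) ^ j / (fact j * pochhammer (\<beta> + 1/2) j) * pochhammer (\<beta> - 1/2) (2 * j) =
      hagen j (\<beta> - 1/2) / 4 ^ j * (S\<^sup>2) ^ j" for j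
  proof -
    have e: "\<beta> - 1/2 + 1 = \<beta> + 1/2" by simp
    have "hagen j (\<beta> - 1/2) = pochhammer (\<beta> - 1/2) (2 * j) / (fact j * pochhammer (\<beta> + 1/2) j)"
      using hagen_conv_pochhammer[of "\<beta> - 1/2" j] assms unfolding e by simp
    then show ?thesis by (simp add: power_divide mult_ac)
  qed
  have "(\<Sum>j\<le>k. sym_moment \<beta> j * (S ^ j / fact j) *
      (pochhammer (\<mu> + (real d + 1) / 2) (k - j) * pochhammer (\<beta> - 1/2) j / pochhammer (alpha d \<beta> \<mu> + 1/2) k) *
      exp_ball \<mu> (k - j) P W) =
     (\<Sum>j\<le>k div 2. exp_ball \<mu> (k - 2 * j) P W *
      (pochhammer (\<mu> + (real d + 1) / 2) (k - 2 * j) / pochhammer (alpha d \<beta> \<mu> + 1/2) k *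
       (sym_moment \<beta> (2 * j) * (S ^ (2 * j) / fact (2 * j)) * pochhammer (\<beta> - 1/2) (2 * j))))"
    by (subst sum_even_terms) (simp_all add: sym_moment_odd mult_ac)
  also have "\<dots> = exp_cone d \<beta> \<mu> k P W (S\<^sup>2)"
    unfolding exp_cone_def sym_moment_term hag by (intro sum.cong refl) (simp add: mult_ac)
  finally show ?thesis .
qed

lemma exp_full_conv_moments:
  "(\<Sum>l\<le>n. sym_moment \<gamma> l * (V ^ l / fact l) * exp_cone d \<beta> \<mu> (n - l) P W T) =
     exp_full d \<beta> \<gamma> \<mu> n P W T (V\<^sup>2)"
proof -
  have "(\<Sum>l\<le>n. sym_moment \<gamma> l * (V ^ l / fact l) * exp_cone d \<beta> \<mu> (n - l) P W T) =
     (\<Sum>l\<le>n div 2. exp_cone d \<beta> \<mu> (n - 2 * l) P W T * (sym_moment \<gamma> (2 * l) * (V ^ (2 * l) / fact (2 * l))))"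
    by (subst sum_even_terms) (simp_all add: sym_moment_odd mult_ac)
  then show ?thesis unfolding exp_full_def sym_moment_term .
qed

definition cube_weight :: "nat \<Rightarrow> real \<Rightarrow> real \<Rightarrow> real \<Rightarrow> real \<times> real \<times> real \<times> real \<Rightarrow> real" where
  "cube_weight d \<beta> \<gamma> \<mu> = (\<lambda>(u, v, z1, z2). sym_weight (\<mu> - 1) u * sym_weight (\<gamma> - 1) v *
     jac_weight (\<mu> + (real d - 1) / 2) (\<beta> - 3/2) z1 * sym_weight (\<beta> - 1) z2)"

definition cube_const :: "nat \<Rightarrow> real \<Rightarrow> real \<Rightarrow> real \<Rightarrow> real" where
  "cube_const d \<beta> \<gamma> \<mu> = c_jac (\<mu> + (real d - 1) / 2) (\<beta> - 3/2) * c_geg (\<beta> - 1/2) * c_geg (\<gamma> - 1/2) * c_geg (\<mu> - 1/2)"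

text \<open>Binomial expansion in the order v, z, u. The powers of A are kept together, so that z1
  enters each term through a single Jacobi moment.\<close>

lemma exp_multinomial:
  fixes A P Q B S V u v z :: real
  shows "(A * (P + u * Q) + B * z * S + v * V) ^ n / fact n =
    (\<Sum>l\<le>n. \<Sum>j\<le>n - l. \<Sum>h\<le>n - l - j.
       ((V ^ l / fact l) * (S ^ j / fact j) * (P ^ (n - l - j - h) / fact (n - l - j - h) * (Q ^ h / fact h))) *
       (u ^ h * (v ^ l * (A ^ (n - l - j) * B ^ j * z ^ j))))"
proof -
  have "(A * (P + u * Q) + B * z * S + v * V) ^ n / fact n =
    (\<Sum>l\<le>n. (A * (P + u * Q) + B * z * S) ^ (n - l) / fact (n - l) * ((v * V) ^ l / fact l))"
    by (rule exp_binomial[symmetric])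
  also have "\<dots> = (\<Sum>l\<le>n. (\<Sum>j\<le>n - l. (A * P + A * u * Q) ^ (n - l - j) / fact (n - l - j) * ((B * z * S) ^ j / fact j)) *
      ((v * V) ^ l / fact l))"
    unfolding exp_binomial by (simp add: algebra_simps)
  also have "\<dots> = (\<Sum>l\<le>n. (\<Sum>j\<le>n - l. (\<Sum>h\<le>n - l - j. (A * P) ^ (n - l - j - h) / fact (n - l - j - h) * ((A * u * Q) ^ h / fact h)) *
      ((B * z * S) ^ j / fact j)) * ((v * V) ^ l / fact l))"
    unfolding exp_binomial ..
  also have "\<dots> = (\<Sum>l\<le>n. \<Sum>j\<le>n - l. \<Sum>h\<le>n - l - j.
       ((V ^ l / fact l) * (S ^ j / fact j) * (P ^ (n - l - j - h) / fact (n - l - j - h) * (Q ^ h / fact h))) *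
       (u ^ h * (v ^ l * (A ^ (n - l - j) * B ^ j * z ^ j))))"
    unfolding sum_distrib_right
  proof (intro sum.cong refl)
    fix l j h assume "h \<in> {..n - l - j}"
    then have "A ^ (n - l - j) = A ^ (n - l - j - h) * A ^ h" by (metis atMost_iff le_add_diff_inverse2 power_add)
    then show "(A * P) ^ (n - l - j - h) / fact (n - l - j - h) * ((A * u * Q) ^ h / fact h) *
      ((B * z * S) ^ j / fact j) * ((v * V) ^ l / fact l) =
       ((V ^ l / fact l) * (S ^ j / fact j) * (P ^ (n - l - j - h) / fact (n - l - j - h) * (Q ^ h / fact h))) *
       (u ^ h * (v ^ l * (A ^ (n - l - j) * B ^ j * z ^ j)))"
      by (simp add: power_mult_distrib mult_ac)
  qed
  finally show ?thesis .
qed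

context
  fixes \<beta> \<gamma> \<mu> :: real and d :: nat
  assumes b: "\<beta> > 1/2" and g: "\<gamma> > 0" and m: "\<mu> > 0" and d: "d \<ge> 1"
begin

lemma has_bochner_integral_cube_monom:
  "has_bochner_integral lborel (\<lambda>(u, v, z1, z2). (u ^ h * (v ^ l * (((1 - z1) / 2) ^ i * ((1 + z1) / 2) ^ j * z2 ^ k))) *
      cube_weight d \<beta> \<gamma> \<mu> (u, v, z1, z2))
    (2 powr (alpha d \<beta> \<mu> - 1/2) / cube_const d \<beta> \<gamma> \<mu> *
     (sym_moment \<mu> h * (sym_moment \<gamma> l * (pochhammer (\<mu> + (real d + 1) / 2) i * pochhammer (\<beta> - 1/2) j /
        pochhammer (alpha d \<beta> \<mu> + 1/2) (i + j) * sym_moment \<beta> k))))"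
proof -
  let ?a = "\<mu> + (real d - 1) / 2" and ?b = "\<beta> - 3/2"
  have "(real d - 1) / 2 \<ge> 0" using d by simp
  then have a: "?a > - 1" using m by linarith
  have b': "?b > - 1" "\<beta> > 0" using b by simp_all
  have e: "?a + ?b + 1 = alpha d \<beta> \<mu> - 1/2" "?a + 1 = \<mu> + (real d + 1) / 2" "?b + 1 = \<beta> - 1/2"
    "?a + ?b + 2 = alpha d \<beta> \<mu> + 1/2"
    by (simp_all add: alpha_def field_simps)
  note J = has_bochner_integral_jac_weight[OF a b'(1), of i j, unfolded e]
  note I = has_bochner_integral_lborel_product[OF has_bochner_integral_sym_weight[OF m, of h]
      has_bochner_integral_lborel_product[OF has_bochner_integral_sym_weight[OF g, of l]
      has_bochner_integral_lborel_product[OF J has_bochner_integral_sym_weight[OF b'(2), of k]]]]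
  have f: "(\<lambda>p. fst p ^ h * sym_weight (\<mu> - 1) (fst p) * (fst (snd p) ^ l * sym_weight (\<gamma> - 1) (fst (snd p)) *
      (((1 - fst (snd (snd p))) / 2) ^ i * ((1 + fst (snd (snd p))) / 2) ^ j * jac_weight ?a ?b (fst (snd (snd p))) *
      (snd (snd (snd p)) ^ k * sym_weight (\<beta> - 1) (snd (snd (snd p))))))) =
     (\<lambda>(u, v, z1, z2). (u ^ h * (v ^ l * (((1 - z1) / 2) ^ i * ((1 + z1) / 2) ^ j * z2 ^ k))) *
      cube_weight d \<beta> \<gamma> \<mu> (u, v, z1, z2))"
    by (simp add: fun_eq_iff cube_weight_def mult_ac)
  have v: "sym_moment \<mu> h / c_geg (\<mu> - 1/2) * (sym_moment \<gamma> l / c_geg (\<gamma> - 1/2) *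
     (2 powr (alpha d \<beta> \<mu> - 1/2) * (pochhammer (\<mu> + (real d + 1) / 2) i * pochhammer (\<beta> - 1/2) j /
        pochhammer (alpha d \<beta> \<mu> + 1/2) (i + j)) / c_jac ?a ?b * (sym_moment \<beta> k / c_geg (\<beta> - 1/2)))) =
     2 powr (alpha d \<beta> \<mu> - 1/2) / cube_const d \<beta> \<gamma> \<mu> *
     (sym_moment \<mu> h * (sym_moment \<gamma> l * (pochhammer (\<mu> + (real d + 1) / 2) i * pochhammer (\<beta> - 1/2) j /
        pochhammer (alpha d \<beta> \<mu> + 1/2) (i + j) * sym_moment \<beta> k)))"
    by (simp add: cube_const_def mult_ac)
  show ?thesis using I unfolding f v .
qed

lemma has_bochner_integral_cube_exp:
  "has_bochner_integral lborel (\<lambda>(u, v, z1, z2).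
      ((1 - z1) / 2 * (P + u * Q) + (1 + z1) / 2 * z2 * S + v * V) ^ n / fact n * cube_weight d \<beta> \<gamma> \<mu> (u, v, z1, z2))
    (2 powr (alpha d \<beta> \<mu> - 1/2) / cube_const d \<beta> \<gamma> \<mu> * exp_full d \<beta> \<gamma> \<mu> n P (Q\<^sup>2) (S\<^sup>2) (V\<^sup>2))"
proof -
  let ?c = "\<lambda>l j h. (V ^ l / fact l) * (S ^ j / fact j) * (P ^ (n - l - j - h) / fact (n - l - j - h) * (Q ^ h / fact h))"
  let ?D = "2 powr (alpha d \<beta> \<mu> - 1/2) / cube_const d \<beta> \<gamma> \<mu>"
  let ?f = "\<lambda>l j h (u, v, z1, z2). (u ^ h * (v ^ l * (((1 - z1) / 2) ^ (n - l - j) * ((1 + z1) / 2) ^ j * z2 ^ j))) *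
      cube_weight d \<beta> \<gamma> \<mu> (u, v, z1, z2)"
  \<comment> \<open>\<open>n - l - j + j\<close> is the form in which the Jacobi moment arrives; for
    j \<le> n - l it equals n - l.\<close>
  let ?r = "\<lambda>l j. pochhammer (\<mu> + (real d + 1) / 2) (n - l - j) * pochhammer (\<beta> - 1/2) j / pochhammer (alpha d \<beta> \<mu> + 1/2) (n - l - j + j)"
  have "has_bochner_integral lborel (\<lambda>p. \<Sum>l\<le>n. \<Sum>j\<le>n - l. \<Sum>h\<le>n - l - j. ?c l j h * ?f l j h p)
     (\<Sum>l\<le>n. \<Sum>j\<le>n - l. \<Sum>h\<le>n - l - j. ?c l j h * (?D * (sym_moment \<mu> h * (sym_moment \<gamma> l * (?r l j * sym_moment \<beta> j)))))"
    by (rule has_bochner_integral_sum, rule has_bochner_integral_sum, rule has_bochner_integral_sum,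
        rule has_bochner_integral_mult_right, rule has_bochner_integral_cube_monom)
  moreover have "(\<lambda>p. \<Sum>l\<le>n. \<Sum>j\<le>n - l. \<Sum>h\<le>n - l - j. ?c l j h * ?f l j h p) =
    (\<lambda>(u, v, z1, z2). ((1 - z1) / 2 * (P + u * Q) + (1 + z1) / 2 * z2 * S + v * V) ^ n / fact n * cube_weight d \<beta> \<gamma> \<mu> (u, v, z1, z2))"
  proof (rule ext)
    fix p :: "real \<times> real \<times> real \<times> real"
    obtain u v z1 z2 where p: "p = (u, v, z1, z2)" by (rule prod_cases4)
    show "(\<Sum>l\<le>n. \<Sum>j\<le>n - l. \<Sum>h\<le>n - l - j. ?c l j h * ?f l j h p) =
      (case p of (u, v, z1, z2) \<Rightarrow> ((1 - z1) / 2 * (P + u * Q) + (1 + z1) / 2 * z2 * S + v * V) ^ n / fact n * cube_weight d \<beta> \<gamma> \<mu> (u, v, z1, z2))"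
      unfolding p prod.case exp_multinomial sum_distrib_right by (simp only: mult.assoc)
  qed
  moreover have "(\<Sum>l\<le>n. \<Sum>j\<le>n - l. \<Sum>h\<le>n - l - j. ?c l j h * (?D * (sym_moment \<mu> h * (sym_moment \<gamma> l * (?r l j * sym_moment \<beta> j))))) =
    ?D * exp_full d \<beta> \<gamma> \<mu> n P (Q\<^sup>2) (S\<^sup>2) (V\<^sup>2)"
  proof -
    have E: "exp_full d \<beta> \<gamma> \<mu> n P (Q\<^sup>2) (S\<^sup>2) (V\<^sup>2) =
      (\<Sum>l\<le>n. sym_moment \<gamma> l * (V ^ l / fact l) * (\<Sum>j\<le>n - l. sym_moment \<beta> j * (S ^ j / fact j) *
       (pochhammer (\<mu> + (real d + 1) / 2) (n - l - j) * pochhammer (\<beta> - 1/2) j / pochhammer (alpha d \<beta> \<mu> + 1/2) (n - l)) *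
       (\<Sum>h\<le>n - l - j. sym_moment \<mu> h * (P ^ (n - l - j - h) / fact (n - l - j - h) * (Q ^ h / fact h)))))"
      unfolding exp_ball_conv_moments exp_cone_conv_moments[OF less_imp_le[OF b]] exp_full_conv_moments ..
    have "?D * exp_full d \<beta> \<gamma> \<mu> n P (Q\<^sup>2) (S\<^sup>2) (V\<^sup>2) = (\<Sum>l\<le>n. \<Sum>j\<le>n - l. \<Sum>h\<le>n - l - j. ?c l j h * (?D * (sym_moment \<mu> h * (sym_moment \<gamma> l * (?r l j * sym_moment \<beta> j)))))"
      unfolding E sum_distrib_left
    proof (intro sum.cong refl)
      fix l j h assume "j \<in> {..n - l}"
      then have "n - l - j + j = n - l" by simp
      then show "?D * (sym_moment \<gamma> l * (V ^ l / fact l) * (sym_moment \<beta> j * (S ^ j / fact j) *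
       (pochhammer (\<mu> + (real d + 1) / 2) (n - l - j) * pochhammer (\<beta> - 1/2) j / pochhammer (alpha d \<beta> \<mu> + 1/2) (n - l)) *
       (sym_moment \<mu> h * (P ^ (n - l - j - h) / fact (n - l - j - h) * (Q ^ h / fact h))))) =
       ?c l j h * (?D * (sym_moment \<mu> h * (sym_moment \<gamma> l * (?r l j * sym_moment \<beta> j))))"
        by (simp only: mult_ac)
    qed
    then show ?thesis by (rule sym)
  qed
  ultimately show ?thesis by (simp only:)
qed

end

section \<open>From the cube integral to the zonal kernel\<close>

lemma exp_ball_minus: "exp_ball \<mu> i (- P) W = (- 1) ^ i * exp_ball \<mu> i P W"
  unfolding exp_ball_def sum_distrib_left
proof (intro sum.cong refl)
  fix h assume "h \<in> {..i div 2}"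
  then have "(- P) ^ (i - 2 * h) = (- 1) ^ i * P ^ (i - 2 * h)"
    by (auto simp: uminus_power_if)
  then show "(- P) ^ (i - 2 * h) / fact (i - 2 * h) * ((W / 4) ^ h / (fact h * pochhammer (\<mu> + 1/2) h)) =
     (- 1) ^ i * (P ^ (i - 2 * h) / fact (i - 2 * h) * ((W / 4) ^ h / (fact h * pochhammer (\<mu> + 1/2) h)))"
    by simp
qed

lemma exp_cone_minus: "exp_cone d \<beta> \<mu> k (- P) W T = (- 1) ^ k * exp_cone d \<beta> \<mu> k P W T"
  unfolding exp_cone_def sum_distrib_left exp_ball_minus
proof (intro sum.cong refl)
  fix j assume "j \<in> {..k div 2}"
  then have "(- 1) ^ (k - 2 * j) = (- 1 :: real) ^ k" by (auto simp: uminus_power_if)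
  then show "(- 1) ^ (k - 2 * j) * exp_ball \<mu> (k - 2 * j) P W * (pochhammer (\<mu> + (real d + 1) / 2) (k - 2 * j) *
      hagen j (\<beta> - 1/2) / (4 ^ j * pochhammer (alpha d \<beta> \<mu> + 1/2) k) * T ^ j) =
     (- 1) ^ k * (exp_ball \<mu> (k - 2 * j) P W * (pochhammer (\<mu> + (real d + 1) / 2) (k - 2 * j) *
      hagen j (\<beta> - 1/2) / (4 ^ j * pochhammer (alpha d \<beta> \<mu> + 1/2) k) * T ^ j))" by simp
qed

text \<open>Of the arguments, only P can carry the sign of s t, because the others are squares. The
  sign costs (-1)^n, hence the restriction to even n or s t \<ge> 0.\<close>

lemma exp_full_minus: "exp_full d \<beta> \<gamma> \<mu> n (- P) W T R = (- 1) ^ n * exp_full d \<beta> \<gamma> \<mu> n P W T R"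
  unfolding exp_full_def sum_distrib_left exp_cone_minus
proof (intro sum.cong refl)
  fix l assume "l \<in> {..n div 2}"
  then have "(- 1) ^ (n - 2 * l) = (- 1 :: real) ^ n" by (auto simp: uminus_power_if)
  then show "(- 1) ^ (n - 2 * l) * exp_cone d \<beta> \<mu> (n - 2 * l) P W T * ((R / 4) ^ l / (fact l * pochhammer (\<gamma> + 1/2) l)) =
     (- 1) ^ n * (exp_cone d \<beta> \<mu> (n - 2 * l) P W T * ((R / 4) ^ l / (fact l * pochhammer (\<gamma> + 1/2) l)))" by simp
qed

definition zonal_coeff :: "nat \<Rightarrow> real \<Rightarrow> nat \<Rightarrow> real" where
  "zonal_coeff n \<nu> k = (real n + \<nu>) / \<nu> * ((-1) ^ k * pochhammer \<nu> (n - k) / fact k * 2 ^ (n - 2 * k))"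

lemma Z_poly_conv_sum: "Z_poly n \<nu> r = (\<Sum>k\<le>n div 2. zonal_coeff n \<nu> k * (r ^ (n - 2 * k) / fact (n - 2 * k)))"
  unfolding Z_poly_def gegenbauer_def zonal_coeff_def sum_distrib_left
  by (intro sum.cong refl) (simp add: power_mult_distrib)

lemma zonal_kernel_conv_sum:
  "zonal_kernel \<beta> \<gamma> \<mu> n p q = (\<Sum>k\<le>n div 2. zonal_coeff n (alpha CARD('d) \<beta> \<mu> + \<gamma>) k * exp_kernel \<beta> \<gamma> \<mu> (n - 2 * k) p q)"
  for p q :: "(real ^ 'd) \<times> real"
  by (simp add: zonal_kernel_def zonal_coeff_def Let_def)

lemma kernel_integral_eq_zonal_kernel:
  fixes x y :: "real ^ 'd"
  assumes b: "\<beta> > 1/2" and g: "\<gamma> > 0" and m: "\<mu> > 0"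
    and xt: "(x, t) \<in> double_cone" and ys: "(y, s) \<in> double_cone" and par: "even n \<or> s * t \<ge> 0"
  shows "2 powr (1/2 - alpha CARD('d) \<beta> \<mu>) * kernel_integral n \<beta> \<gamma> \<mu> (x, t) (y, s) = zonal_kernel \<beta> \<gamma> \<mu> n (x, t) (y, s)"
proof -
  define \<nu> where "\<nu> = alpha CARD('d) \<beta> \<mu> + \<gamma>"
  define P where "P = sgn (s * t) * (x \<bullet> y)"
  define Q where "Q = sgn (s * t) * (sqrt (t\<^sup>2 - (norm x)\<^sup>2) * sqrt (s\<^sup>2 - (norm y)\<^sup>2))"
  define V where "V = sqrt (1 - s\<^sup>2) * sqrt (1 - t\<^sup>2)"
  define C where "C = cube_const CARD('d) \<beta> \<gamma> \<mu>"
  let ?a = "\<mu> + (real CARD('d) - 1) / 2"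
  let ?\<zeta> = "\<lambda>u v z1 z2. (1 - z1) / 2 * (P + u * Q) + (1 + z1) / 2 * z2 * (s * t) + v * V"
  have card: "CARD('d) \<ge> 1" by (simp add: Suc_le_eq)
  have zeta: "zeta x t y s u v z1 z2 = ?\<zeta> u v z1 z2" for u v z1 z2
    unfolding zeta_def P_def Q_def V_def by (simp add: algebra_simps)
  have "(real CARD('d) - 1) / 2 \<ge> 0" using card by simp
  then have "?a + 1 > 0" "\<beta> - 3/2 + 1 > 0" using b m by linarith+
  then have "c_jac ?a (\<beta> - 3/2) > 0"
    unfolding c_jac_def by (intro divide_pos_pos mult_pos_pos Gamma_real_pos) linarith+
  then have C: "C > 0" unfolding C_def cube_const_def using c_geg_pos[of \<beta>] c_geg_pos[OF g] c_geg_pos[OF m] b by simp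
  have "has_bochner_integral lborel (\<lambda>p. \<Sum>k\<le>n div 2. zonal_coeff n \<nu> k * (case p of (u, v, z1, z2) \<Rightarrow>
       ?\<zeta> u v z1 z2 ^ (n - 2 * k) / fact (n - 2 * k) * cube_weight CARD('d) \<beta> \<gamma> \<mu> (u, v, z1, z2)))
     (\<Sum>k\<le>n div 2. zonal_coeff n \<nu> k * (2 powr (alpha CARD('d) \<beta> \<mu> - 1/2) / C *
        exp_full CARD('d) \<beta> \<gamma> \<mu> (n - 2 * k) P (Q\<^sup>2) ((s * t)\<^sup>2) (V\<^sup>2)))"
    unfolding C_def
    by (rule has_bochner_integral_sum, rule has_bochner_integral_mult_right, rule has_bochner_integral_cube_exp[OF b g m card])
  moreover have "(\<lambda>p. \<Sum>k\<le>n div 2. zonal_coeff n \<nu> k * (case p of (u, v, z1, z2) \<Rightarrow>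
       ?\<zeta> u v z1 z2 ^ (n - 2 * k) / fact (n - 2 * k) * cube_weight CARD('d) \<beta> \<gamma> \<mu> (u, v, z1, z2))) =
     (\<lambda>p. indicator ({-1..1} \<times> {-1..1} \<times> {-1..1} \<times> {-1..1}) p *\<^sub>R (case p of (u, v, z1, z2) \<Rightarrow>
        Z_poly n \<nu> (zeta x t y s u v z1 z2) * (1 - z1) powr ?a * (1 + z1) powr (\<beta> - 3/2)
        * (1 - z2\<^sup>2) powr (\<beta> - 1) * (1 - v\<^sup>2) powr (\<gamma> - 1) * (1 - u\<^sup>2) powr (\<mu> - 1)))" (is "?F = ?G")
  proof (rule ext)
    fix p :: "real \<times> real \<times> real \<times> real"
    obtain u v z1 z2 where p: "p = (u, v, z1, z2)" by (rule prod_cases4)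
    have "?F p = Z_poly n \<nu> (?\<zeta> u v z1 z2) * cube_weight CARD('d) \<beta> \<gamma> \<mu> (u, v, z1, z2)"
      unfolding p prod.case Z_poly_conv_sum sum_distrib_right by (simp only: mult.assoc)
    also have "\<dots> = ?G p"
      unfolding p prod.case zeta cube_weight_def sym_weight_def jac_weight_def indicator_times
      by (simp add: mult_ac)
    finally show "?F p = ?G p" .
  qed
  ultimately have int: "(LINT (u, v, z1, z2):{-1..1} \<times> {-1..1} \<times> {-1..1} \<times> {-1..1}|lborel.
        Z_poly n \<nu> (zeta x t y s u v z1 z2) * (1 - z1) powr ?a * (1 + z1) powr (\<beta> - 3/2)
        * (1 - z2\<^sup>2) powr (\<beta> - 1) * (1 - v\<^sup>2) powr (\<gamma> - 1) * (1 - u\<^sup>2) powr (\<mu> - 1)) =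
     (\<Sum>k\<le>n div 2. zonal_coeff n \<nu> k * (2 powr (alpha CARD('d) \<beta> \<mu> - 1/2) / C *
        exp_full CARD('d) \<beta> \<gamma> \<mu> (n - 2 * k) P (Q\<^sup>2) ((s * t)\<^sup>2) (V\<^sup>2)))"
    unfolding set_lebesgue_integral_def by (simp only: has_bochner_integral_iff)
  have "2 powr (1/2 - alpha CARD('d) \<beta> \<mu>) * kernel_integral n \<beta> \<gamma> \<mu> (x, t) (y, s) =
     2 powr (1/2 - alpha CARD('d) \<beta> \<mu>) * (C * (\<Sum>k\<le>n div 2. zonal_coeff n \<nu> k * (2 powr (alpha CARD('d) \<beta> \<mu> - 1/2) / C *
        exp_full CARD('d) \<beta> \<gamma> \<mu> (n - 2 * k) P (Q\<^sup>2) ((s * t)\<^sup>2) (V\<^sup>2))))"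
    unfolding kernel_integral_def prod.case \<nu>_def[symmetric] int C_def cube_const_def ..
  also have "\<dots> = (\<Sum>k\<le>n div 2. zonal_coeff n \<nu> k * exp_full CARD('d) \<beta> \<gamma> \<mu> (n - 2 * k) P (Q\<^sup>2) ((s * t)\<^sup>2) (V\<^sup>2))"
    unfolding sum_distrib_left
  proof (intro sum.cong refl)
    fix k
    \<comment> \<open>Removes the power of 2 left over by \<open>c_jac\<close>.\<close>
    have "2 powr (1/2 - alpha CARD('d) \<beta> \<mu>) * 2 powr (alpha CARD('d) \<beta> \<mu> - 1/2) = (1 :: real)"
      by (simp add: powr_add[symmetric])
    moreover have "w1 * (C * (c * (w2 / C * e))) = (w1 * w2) * (c * e)" for w1 w2 c e
      using C by simp
    ultimately show "2 powr (1/2 - alpha CARD('d) \<beta> \<mu>) * (C * (zonal_coeff n \<nu> k * (2 powr (alpha CARD('d) \<beta> \<mu> - 1/2) / C *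
        exp_full CARD('d) \<beta> \<gamma> \<mu> (n - 2 * k) P (Q\<^sup>2) ((s * t)\<^sup>2) (V\<^sup>2)))) =
        zonal_coeff n \<nu> k * exp_full CARD('d) \<beta> \<gamma> \<mu> (n - 2 * k) P (Q\<^sup>2) ((s * t)\<^sup>2) (V\<^sup>2)"
      by (simp only: mult_1)
  qed
  also have "\<dots> = zonal_kernel \<beta> \<gamma> \<mu> n (x, t) (y, s)"
    unfolding zonal_kernel_conv_sum \<nu>_def[symmetric]
  proof (intro sum.cong refl arg_cong2[where f = "(*)"])
    fix k assume k: "k \<in> {..n div 2}"
    have cone: "norm x \<le> \<bar>t\<bar>" "norm y \<le> \<bar>s\<bar>" "\<bar>t\<bar> \<le> 1" "\<bar>s\<bar> \<le> 1"
      using xt ys by (auto simp: double_cone_def)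
    have nn: "t\<^sup>2 - (norm x)\<^sup>2 \<ge> 0" "s\<^sup>2 - (norm y)\<^sup>2 \<ge> 0" "1 - t\<^sup>2 \<ge> 0" "1 - s\<^sup>2 \<ge> 0"
      using cone by (simp_all add: abs_le_square_iff[symmetric] abs_square_le_1)
    \<comment> \<open>On the cone s t = 0 forces x = 0 or y = 0, so that \<open>sgn 0 = 0\<close>
      deletes only terms that are 0 anyway.\<close>
    have zero: "x \<bullet> y = 0" "(t\<^sup>2 - (norm x)\<^sup>2) * (s\<^sup>2 - (norm y)\<^sup>2) = 0" if "s * t = 0"
      using that cone(1,2) by auto
    have V2: "V\<^sup>2 = (1 - t\<^sup>2) * (1 - s\<^sup>2)" using nn by (simp add: V_def power_mult_distrib mult.commute)
    have "(sgn (s * t))\<^sup>2 = (if s * t = 0 then 0 else 1)" by (simp add: sgn_if)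
    then have Q2: "Q\<^sup>2 = (t\<^sup>2 - (norm x)\<^sup>2) * (s\<^sup>2 - (norm y)\<^sup>2)"
      using nn zero(2) by (cases "s * t = 0") (simp_all add: Q_def power_mult_distrib)
    have S2: "(s * t)\<^sup>2 = t\<^sup>2 * s\<^sup>2" by (simp add: power_mult_distrib mult.commute)
    have "exp_full CARD('d) \<beta> \<gamma> \<mu> (n - 2 * k) P W T R = exp_full CARD('d) \<beta> \<gamma> \<mu> (n - 2 * k) (x \<bullet> y) W T R" for W T R
    proof (cases "s * t < 0")
      case True
      then have "even (n - 2 * k)" "P = - (x \<bullet> y)" using par by (simp_all add: P_def)
      then show ?thesis by (simp add: exp_full_minus)
    next
      case False
      then have "P = x \<bullet> y" using zero(1) by (cases "s * t = 0") (simp_all add: P_def sgn_if)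
      then show ?thesis by simp
    qed
    then show "exp_full CARD('d) \<beta> \<gamma> \<mu> (n - 2 * k) P (Q\<^sup>2) ((s * t)\<^sup>2) (V\<^sup>2) = exp_kernel \<beta> \<gamma> \<mu> (n - 2 * k) (x, t) (y, s)"
      unfolding exp_kernel_def fst_conv snd_conv V2 Q2 S2 .
  qed
  finally show ?thesis .
qed

section \<open>Limits in the parameters\<close>

lemma tendsto_pochhammer:
  fixes f :: "'a \<Rightarrow> real"
  assumes "(f \<longlongrightarrow> a) F"
  shows "((\<lambda>i. pochhammer (f i) n) \<longlongrightarrow> pochhammer a n) F"
  unfolding pochhammer_prod by (intro tendsto_intros assms)

lemma tendsto_hagen:
  assumes "(f \<longlongrightarrow> a) F"
  shows "((\<lambda>i. hagen j (f i)) \<longlongrightarrow> hagen j a) F"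
proof (cases "j = 0")
  case False
  then show ?thesis unfolding hagen_def by (simp, intro tendsto_intros tendsto_pochhammer assms) simp
qed (simp add: hagen_def)

text \<open>The parameters occur in denominators only through \<alpha> + \<gamma> and rising
  factorials of \<mu> + 1/2, \<gamma> + 1/2 and \<alpha> + 1/2. These stay positive on the closed
  region, also where the weights of the integral cease to be integrable.\<close>

lemma tendsto_zonal_kernel:
  fixes p q :: "(real ^ 'd) \<times> real"
  assumes lim: "(b \<longlongrightarrow> \<beta>) F" "(g \<longlongrightarrow> \<gamma>) F" "(m \<longlongrightarrow> \<mu>) F"
    and par: "\<beta> \<ge> 1/2" "\<gamma> \<ge> 0" "\<mu> \<ge> 0"
  shows "((\<lambda>i. zonal_kernel (b i) (g i) (m i) n p q) \<longlongrightarrow> zonal_kernel \<beta> \<gamma> \<mu> n p q) F"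
proof -
  have al: "alpha CARD('d) \<beta> \<mu> > 0"
    by (rule alpha_pos[of \<beta> \<gamma>]) (use par in simp_all)
  have la: "((\<lambda>i. alpha CARD('d) (b i) (m i)) \<longlongrightarrow> alpha CARD('d) \<beta> \<mu>) F"
    unfolding alpha_def by (intro tendsto_intros lim)
  have nz: "pochhammer (\<mu> + 1/2) h \<noteq> 0" "pochhammer (\<gamma> + 1/2) h \<noteq> 0"
    "pochhammer (alpha CARD('d) \<beta> \<mu> + 1/2) h \<noteq> 0" "alpha CARD('d) \<beta> \<mu> + \<gamma> \<noteq> 0" for h
    using par al by (auto intro!: less_imp_neq[THEN not_sym] pochhammer_pos)
  have ball: "((\<lambda>i. exp_ball (m i) k P W) \<longlongrightarrow> exp_ball \<mu> k P W) F" for k P W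
    unfolding exp_ball_def by (intro tendsto_intros tendsto_pochhammer lim) (simp add: nz)
  have cone: "((\<lambda>i. exp_cone CARD('d) (b i) (m i) k P W T) \<longlongrightarrow> exp_cone CARD('d) \<beta> \<mu> k P W T) F" for k P W T
    unfolding exp_cone_def by (intro tendsto_intros tendsto_pochhammer tendsto_hagen ball la lim) (simp_all add: nz)
  have "((\<lambda>i. exp_kernel (b i) (g i) (m i) k p q) \<longlongrightarrow> exp_kernel \<beta> \<gamma> \<mu> k p q) F" for k
    unfolding exp_kernel_def exp_full_def
    by (intro tendsto_intros tendsto_pochhammer cone lim) (simp_all add: nz)
  moreover have "((\<lambda>i. zonal_coeff n (alpha CARD('d) (b i) (m i) + g i) k) \<longlongrightarrow> zonal_coeff n (alpha CARD('d) \<beta> \<mu> + \<gamma>) k) F" for k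
    unfolding zonal_coeff_def by (intro tendsto_intros tendsto_pochhammer la lim) (simp_all add: nz)
  ultimately show ?thesis unfolding zonal_kernel_conv_sum by (intro tendsto_intros)
qed

text \<open>\<open>G\<close> stands for the normalized integral, identified with the zonal kernel on
  the open region; continuity of that kernel carries its value to the boundary.\<close>

lemma holds_under_limit_zonal_kernel:
  fixes p q :: "(real ^ 'd) \<times> real"
  assumes par: "\<beta> \<ge> 1/2" "\<gamma> \<ge> 0" "\<mu> \<ge> 0"
    and eq: "\<And>b g m. b > 1/2 \<Longrightarrow> g > 0 \<Longrightarrow> m > 0 \<Longrightarrow> G b g m = zonal_kernel b g m n p q"
  shows "holds_under_limit G \<beta> \<gamma> \<mu> (kernel_even n (cone_weight \<beta> \<gamma> \<mu>) p q)"
proof -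
  have "\<gamma> > - 1/2" "\<mu> > - 1/2" using par by simp_all
  moreover from alpha_pos[OF par(1) this] have "alpha CARD('d) \<beta> \<mu> + \<gamma> > 0"
    using par(2) by (rule add_pos_nonneg)
  ultimately have k: "kernel_even n (cone_weight \<beta> \<gamma> \<mu>) p q = zonal_kernel \<beta> \<gamma> \<mu> n p q"
    using kernel_even_eq_zonal_kernel[OF par(1)] by metis
  have "((\<lambda>(b, g, m). G b g m) \<longlongrightarrow> zonal_kernel \<beta> \<gamma> \<mu> n p q)
     (at (\<beta>, \<gamma>, \<mu>) within {1/2<..} \<times> {0<..} \<times> {0<..})"
  proof (rule Lim_transform_eventually)
    let ?F = "at (\<beta>, \<gamma>, \<mu>) within {1/2<..} \<times> {0<..} \<times> {0<..}"
    have "((\<lambda>z. z) \<longlongrightarrow> (\<beta>, \<gamma>, \<mu>)) ?F" by (rule tendsto_ident_at)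
    from tendsto_fst[OF this] tendsto_fst[OF tendsto_snd[OF this]] tendsto_snd[OF tendsto_snd[OF this]]
    show "((\<lambda>z. zonal_kernel (fst z) (fst (snd z)) (snd (snd z)) n p q) \<longlongrightarrow> zonal_kernel \<beta> \<gamma> \<mu> n p q) ?F"
      unfolding fst_conv snd_conv by (rule tendsto_zonal_kernel) (rule par)+
    show "\<forall>\<^sub>F z in ?F. zonal_kernel (fst z) (fst (snd z)) (snd (snd z)) n p q = (case z of (b, g, m) \<Rightarrow> G b g m)"
      unfolding eventually_at_filter by (intro always_eventually) (auto simp: eq)
  qed
  then show ?thesis unfolding holds_under_limit_def k by (auto simp: eq)
qed

theorem theorem5p5:
  fixes \<beta> \<gamma> \<mu> t s :: real and x y :: "real ^ 'd" and n :: nat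
  assumes "\<beta> > - 1/2" "\<gamma> > - 1/2" "\<mu> > - 1/2"
    and "(x, t) \<in> double_cone" "(y, s) \<in> double_cone"
  shows
    "(n \<ge> 1 \<longrightarrow> (CARD('d) = 1 \<longrightarrow> alpha CARD('d) \<beta> \<mu> > - 1/2) \<longrightarrow>
        kernel_odd n (cone_weight \<beta> \<gamma> \<mu>) (x, t) (y, s) =
          (alpha CARD('d) \<beta> \<mu> + \<gamma> + 1) / (alpha CARD('d) \<beta> \<mu> + 1/2) * s * t
            * kernel_even (n - 1) (cone_weight (\<beta> + 1) \<gamma> \<mu>) (x, t) (y, s))
     \<and> (\<beta> \<ge> 1/2 \<and> \<gamma> \<ge> 0 \<and> \<mu> \<ge> 0 \<longrightarrow>
          (even n \<or> s * t \<ge> 0 \<longrightarrow>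
             holds_under_limit
               (\<lambda>b g m. 2 powr (1/2 - alpha CARD('d) b m) * kernel_integral n b g m (x, t) (y, s))
               \<beta> \<gamma> \<mu>
               (kernel_even n (cone_weight \<beta> \<gamma> \<mu>) (x, t) (y, s)))
        \<and> holds_under_limit
               (\<lambda>b g m. 2 powr (1/2 - alpha CARD('d) b m) * kernel_integral n b g m (x, \<bar>t\<bar>) (y, \<bar>s\<bar>))
               \<beta> \<gamma> \<mu>
            (kernel_even n (cone_weight \<beta> \<gamma> \<mu>) (x, t) (y, s)))"
proof (intro conjI impI)
  assume n: "n \<ge> 1" and one: "CARD('d) = 1 \<longrightarrow> alpha CARD('d) \<beta> \<mu> > - 1/2"
  have "alpha CARD('d) \<beta> \<mu> > - 1/2"
  \<comment> \<open>From dimension 2 on, (d - 1)/2 \<ge> 1/2 compensates \<beta> + \<mu> > -1;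
    dimension 1 is covered by the extra premise.\<close>
  proof (cases "CARD('d) = 1")
    case False
    moreover have "CARD('d) > 0" by simp
    ultimately have "CARD('d) \<ge> 2" by linarith
    then have "(real CARD('d) - 1) / 2 \<ge> 1/2" by simp
    then show ?thesis using assms(1,3) unfolding alpha_def by linarith
  qed (use one in simp)
  then show "kernel_odd n (cone_weight \<beta> \<gamma> \<mu>) (x, t) (y, s) =
          (alpha CARD('d) \<beta> \<mu> + \<gamma> + 1) / (alpha CARD('d) \<beta> \<mu> + 1/2) * s * t
            * kernel_even (n - 1) (cone_weight (\<beta> + 1) \<gamma> \<mu>) (x, t) (y, s)"
    using kernel_odd_eq[OF assms(2,3,1) _ n, of "(x, t)" "(y, s)"] by simp
next
  assume par: "\<beta> \<ge> 1/2 \<and> \<gamma> \<ge> 0 \<and> \<mu> \<ge> 0" and "even n \<or> s * t \<ge> 0"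
  then show "holds_under_limit
       (\<lambda>b g m. 2 powr (1/2 - alpha CARD('d) b m) * kernel_integral n b g m (x, t) (y, s)) \<beta> \<gamma> \<mu>
       (kernel_even n (cone_weight \<beta> \<gamma> \<mu>) (x, t) (y, s))"
    by (intro holds_under_limit_zonal_kernel kernel_integral_eq_zonal_kernel assms) auto
next
  assume par: "\<beta> \<ge> 1/2 \<and> \<gamma> \<ge> 0 \<and> \<mu> \<ge> 0"
  \<comment> \<open>\<open>exp_kernel\<close> contains t and s only through their squares.\<close>
  have abs: "zonal_kernel b g m n (x, \<bar>t\<bar>) (y, \<bar>s\<bar>) = zonal_kernel b g m n (x, t) (y, s)" for b g m
    by (simp add: zonal_kernel_def exp_kernel_def)
  have cone: "(x, \<bar>t\<bar>) \<in> double_cone" "(y, \<bar>s\<bar>) \<in> double_cone"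
    using assms(4,5) by (auto simp: double_cone_def)
  show "holds_under_limit
       (\<lambda>b g m. 2 powr (1/2 - alpha CARD('d) b m) * kernel_integral n b g m (x, \<bar>t\<bar>) (y, \<bar>s\<bar>)) \<beta> \<gamma> \<mu>
       (kernel_even n (cone_weight \<beta> \<gamma> \<mu>) (x, t) (y, s))"
  proof (rule holds_under_limit_zonal_kernel)
    fix b g m :: real assume "b > 1/2" "g > 0" "m > 0"
    then show "2 powr (1/2 - alpha CARD('d) b m) * kernel_integral n b g m (x, \<bar>t\<bar>) (y, \<bar>s\<bar>) = zonal_kernel b g m n (x, t) (y, s)"
      unfolding abs[symmetric] by (intro kernel_integral_eq_zonal_kernel cone) auto
  qed (use par in auto)
qed

end
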